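(* Let $n\ge1$ be an integer, and let $\alpha=a/b\in(0,2)$ and $\nu=e/f>0$ be rational numbers with $a,b,e,f\in\mathbb{N}$ and $\gcd(a,b)=\gcd(e,f)=1$. Suppose that one of the following conditions holds: (i) $n$ is an odd integer and $a/f$ is an odd integer; (ii) $n$ is an even integer and $a/f$ is an even integer; (iii) $n$ is an even integer, $a/f$ is an odd integer and $a$ and $f$ are both odd integers. Let $(j_0,l_0)$ be the smallest nonnegative integers satisfying $n+2j=\alpha(\nu+l)$, $(j,l)\in\hat{\mathbb{N}}\times\hat{\mathbb{N}}$. Then for $r>0$ $$q_{\alpha,\nu,n}(r)=\frac{1}{2^n\pi^{\frac n2}\Gamma(\nu)}\Biggl\{\frac{r^{\alpha\nu-n}}{2^{\alpha\nu-n}}A_{1;\alpha,\nu,n}(r^\alpha)+A_{2;\alpha,\nu,n}(r^2)+\frac{r^{2j_0}}{2^{2j_0}}A_{3;\alpha,\nu,n}(r^a)+\frac{r^{2j_0}}{2^{2j_0}}A_{4;\alpha,\nu,n}(r^a)\log\frac r2\Biggr\},$$ where $A_{1;\alpha,\nu,n},A_{2;\alpha,\nu,n},A_{3;\alpha,\nu,n},A_{4;\alpha,\nu,n}$ are entire functions given as follows. If $a$ is odd, $$\begin{aligned} A_{1;\alpha,\nu,n}(z)=&\sum_{l\in\hat{\mathbb{N}};\ l\ne l_0+2bq,\ q\in\hat{\mathbb{N}}}\frac{(-1)^l}{l!}\Gamma(\nu+l)\frac{\Gamma\left(\frac{n-\alpha(\nu+l)}{2}\right)}{\Gamma\left(\frac{\alpha(\nu+l)}{2}\right)}\frac{z^l}{2^{\alpha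 l}},\\ A_{2;\alpha,\nu,n}(z)=&\frac2\alpha\sum_{j\in\hat{\mathbb{N}};\ j\ne j_0+aq,\ q\in\hat{\mathbb{N}}}\frac{(-1)^j}{j!}\frac{\Gamma\left(\frac{n+2j}{\alpha}\right)}{\Gamma\left(\frac{n+2j}{2}\right)}\Gamma\left(\frac{\alpha\nu-n-2j}{\alpha}\right)\frac{z^j}{2^{2j}},\\ A_{3;\alpha,\nu,n}(z)=&-\frac{2(-1)^{l_0+j_0}}{\alpha}\sum_{q=0}^\infty\frac{(-1)^q}{(l_0+2qb)!\,(j_0+aq)!}\frac{\Gamma(\nu+l_0+2bq)}{\Gamma\left(\frac n2+j_0+aq\right)}\Bigl\{\psi(\nu+l_0+2bq)-\psi(l_0+2bq+1)\\ &\qquad-\frac{a}{2b}\psi\left(\frac n2+j_0+aq\right)-\frac{a}{2b}\psi(j_0+aq+1)\Bigr\}\frac{z^{2q}}{2^{2aq}},\\ A_{4;\alpha,\nu,n}(z)=&-2(-1)^{l_0+j_0}\sum_{q=0}^\infty\frac{(-1)^q}{(l_0+2qb)!\,(j_0+aq)!}\frac{\Gamma(\nu+l_0+2bq)}{\Gamma\left(\frac n2+j_0+aq\right)}\frac{z^{2q}}{2^{2aq}}; \end{aligned}$$ whereas if $a$ is even, $$\begin{aligned} A_{1;\alpha,\nu,n}(z)=&\sum_{l\in\hat{\mathbb{N}};\ l\ne l_0+bq,\ q\in\hat{\mathbb{N}}}\frac{(-1)^l}{l!}\Gamma(\nu+l)\frac{\Gamma\left(\frac{n-\alpha(\nu+l)}{2}\right)}{\Gamma\left(\frac{\alpha(\nu+l)}{2}\right)}\frac{z^l}{2^{\alpha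 l}},\\ A_{2;\alpha,\nu,n}(z)=&\frac2\alpha\sum_{j\in\hat{\mathbb{N}};\ j\ne j_0+\frac{aq}{2},\ q\in\hat{\mathbb{N}}}\frac{(-1)^j}{j!}\frac{\Gamma\left(\frac{n+2j}{\alpha}\right)}{\Gamma\left(\frac{n+2j}{2}\right)}\Gamma\left(\frac{\alpha\nu-n-2j}{\alpha}\right)\frac{z^j}{2^{2j}},\\ A_{3;\alpha,\nu,n}(z)=&-\frac{2(-1)^{l_0+j_0}}{\alpha}\sum_{q=0}^\infty\frac{(-1)^{q\left(b+\frac a2\right)}}{(l_0+qb)!\left(j_0+\frac{aq}{2}\right)!}\frac{\Gamma(\nu+l_0+bq)}{\Gamma\left(\frac n2+j_0+\frac{aq}{2}\right)}\Bigl\{\psi(\nu+l_0+bq)-\psi(l_0+bq+1)\\ &\qquad-\frac{a}{2b}\psi\left(\frac n2+j_0+\frac{aq}{2}\right)-\frac{a}{2b}\psi\left(j_0+\frac{aq}{2}+1\right)\Bigr\}\frac{z^q}{2^{aq}},\\ A_{4;\alpha,\nu,n}(z)=&-2(-1)^{l_0+j_0}\sum_{q=0}^\infty\frac{(-1)^{q\left(b+\frac a2\right)}}{(l_0+qb)!\left(j_0+\frac{aq}{2}\right)!}\frac{\Gamma(\nu+l_0+bq)}{\Gamma\left(\frac n2+j_0+\frac{aq}{2}\right)}\frac{z^q}{2^{aq}}. \end{aligned}$$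
   Context: $\Vert\cdot\Vert$ is the Euclidean norm on $\mathbb{R}^n$. For an integer $n\ge1$, $\alpha\in(0,2]$, $\nu>0$, $p_{\alpha,\nu,n}$ denotes the probability density function on $\mathbb{R}^n$ whose characteristic function is $\int_{\mathbb{R}^n}e^{i\mathbf{x}\cdot\boldsymbol{t}}p_{\alpha,\nu,n}(\mathbf{x})\,d^n\mathbf{x}=(1+\Vert\boldsymbol{t}\Vert^\alpha)^{-\nu}$ for all $\boldsymbol{t}\in\mathbb{R}^n$. It is a radial function; one takes the version which is continuous on $\mathbb{R}^n\setminus\{\mathbf{0}\}$, and $q_{\alpha,\nu,n}(r)$, $r>0$, denotes the value of $p_{\alpha,\nu,n}(\mathbf{x})$ at points with $\Vert\mathbf{x}\Vert=r$. $\mathbb{N}=\{1,2,\ldots\}$, $\hat{\mathbb{N}}=\mathbb{N}\cup\{0\}$, and $\psi=\Gamma'/\Gamma$ is the digamma function. Under any of the conditions (i)-(iii) the equation $n+2j=\alpha(\nu+l)$ has solutions $(j,l)\in\hat{\mathbb{N}}\times\hat{\mathbb{N}}$; since $j$ increases strictly with $l$ along solutions, the smallest one is well defined. *)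

theory Defs
  imports "HOL-Probability.Probability" "HOL-Complex_Analysis.Complex_Analysis"
begin

(* The last conjunct selects the version that is continuous away from the origin; p 0 is
   left unconstrained, since the density may be unbounded there. *)
definition linnik_density :: "real \<Rightarrow> real \<Rightarrow> (real ^ 'n \<Rightarrow> real) \<Rightarrow> bool" where
  "linnik_density \<alpha> \<nu> p \<longleftrightarrow>
     p \<in> borel_measurable borel \<and> (\<forall>x. 0 \<le> p x) \<and>
     prob_space (density lborel (\<lambda>x. ennreal (p x))) \<and>
     (\<forall>t. (LINT x|lborel. exp (\<i> * complex_of_real (x \<bullet> t)) * complex_of_real (p x))
            = complex_of_real ((1 + norm t powr \<alpha>) powr (- \<nu>))) \<and>
     continuous_on (- {0}) p"

definition resonance :: "nat \<Rightarrow> real \<Rightarrow> real \<Rightarrow> nat \<Rightarrow> nat \<Rightarrow> bool" where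
  "resonance n \<alpha> \<nu> j l \<longleftrightarrow> real n + 2 * real j = \<alpha> * (\<nu> + real l)"

(* For \<alpha> > 0, j is strictly increasing in l along the solutions, so the two coordinates
   can be minimised separately: (res_j, res_l) is again a solution. *)
definition res_j :: "nat \<Rightarrow> real \<Rightarrow> real \<Rightarrow> nat" where
  "res_j n \<alpha> \<nu> = (LEAST j. \<exists>l. resonance n \<alpha> \<nu> j l)"

definition res_l :: "nat \<Rightarrow> real \<Rightarrow> real \<Rightarrow> nat" where
  "res_l n \<alpha> \<nu> = (LEAST l. \<exists>j. resonance n \<alpha> \<nu> j l)"

(* Below, a and b are the numerator and denominator of \<alpha> in lowest terms, and n is the
   dimension. *)

definition A1_index :: "nat \<Rightarrow> nat \<Rightarrow> real \<Rightarrow> real \<Rightarrow> nat \<Rightarrow> nat set" where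
  "A1_index a b \<alpha> \<nu> n =
     (if odd a then {l. \<not> (\<exists>q. l = res_l n \<alpha> \<nu> + 2 * b * q)}
      else {l. \<not> (\<exists>q. l = res_l n \<alpha> \<nu> + b * q)})"

definition A1_term :: "real \<Rightarrow> real \<Rightarrow> nat \<Rightarrow> complex \<Rightarrow> nat \<Rightarrow> complex" where
  "A1_term \<alpha> \<nu> n z l =
     complex_of_real ((-1) ^ l / fact l * Gamma (\<nu> + real l)
       * (Gamma ((real n - \<alpha> * (\<nu> + real l)) / 2) / Gamma (\<alpha> * (\<nu> + real l) / 2)))
     * (z ^ l / complex_of_real (2 powr (\<alpha> * real l)))"

definition A1 :: "nat \<Rightarrow> nat \<Rightarrow> real \<Rightarrow> real \<Rightarrow> nat \<Rightarrow> complex \<Rightarrow> complex" where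
  "A1 a b \<alpha> \<nu> n z = (\<Sum>\<^sub>\<infinity>l\<in>A1_index a b \<alpha> \<nu> n. A1_term \<alpha> \<nu> n z l)"

definition A2_index :: "nat \<Rightarrow> real \<Rightarrow> real \<Rightarrow> nat \<Rightarrow> nat set" where
  "A2_index a \<alpha> \<nu> n =
     (if odd a then {j. \<not> (\<exists>q. j = res_j n \<alpha> \<nu> + a * q)}
      else {j. \<not> (\<exists>q. j = res_j n \<alpha> \<nu> + a * q div 2)})"

definition A2_term :: "real \<Rightarrow> real \<Rightarrow> nat \<Rightarrow> complex \<Rightarrow> nat \<Rightarrow> complex" where
  "A2_term \<alpha> \<nu> n z j =
     complex_of_real ((-1) ^ j / fact j
       * (Gamma ((real n + 2 * real j) / \<alpha>) / Gamma ((real n + 2 * real j) / 2))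
       * Gamma ((\<alpha> * \<nu> - real n - 2 * real j) / \<alpha>))
     * (z ^ j / 2 ^ (2 * j))"

definition A2 :: "nat \<Rightarrow> real \<Rightarrow> real \<Rightarrow> nat \<Rightarrow> complex \<Rightarrow> complex" where
  "A2 a \<alpha> \<nu> n z =
     complex_of_real (2 / \<alpha>) * (\<Sum>\<^sub>\<infinity>j\<in>A2_index a \<alpha> \<nu> n. A2_term \<alpha> \<nu> n z j)"

definition A4_term :: "nat \<Rightarrow> nat \<Rightarrow> real \<Rightarrow> real \<Rightarrow> nat \<Rightarrow> complex \<Rightarrow> nat \<Rightarrow> complex" where
  "A4_term a b \<alpha> \<nu> n z q =
     (let j0 = res_j n \<alpha> \<nu>; l0 = res_l n \<alpha> \<nu> in
      if odd a then
        complex_of_real ((-1) ^ q / (fact (l0 + 2 * q * b) * fact (j0 + a * q))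
          * (Gamma (\<nu> + real (l0 + 2 * b * q)) / Gamma (real n / 2 + real (j0 + a * q))))
        * (z ^ (2 * q) / 2 ^ (2 * a * q))
      else
        complex_of_real ((-1) ^ (q * (b + a div 2)) / (fact (l0 + q * b) * fact (j0 + a * q div 2))
          * (Gamma (\<nu> + real (l0 + b * q)) / Gamma (real n / 2 + real (j0 + a * q div 2))))
        * (z ^ q / 2 ^ (a * q)))"

definition A3_bracket :: "nat \<Rightarrow> nat \<Rightarrow> real \<Rightarrow> real \<Rightarrow> nat \<Rightarrow> nat \<Rightarrow> real" where
  "A3_bracket a b \<alpha> \<nu> n q =
     (let j0 = res_j n \<alpha> \<nu>; l0 = res_l n \<alpha> \<nu> in
      if odd a then
        Digamma (\<nu> + real (l0 + 2 * b * q)) - Digamma (real (l0 + 2 * b * q + 1))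
          - real a / (2 * real b) * Digamma (real n / 2 + real (j0 + a * q))
          - real a / (2 * real b) * Digamma (real (j0 + a * q + 1))
      else
        Digamma (\<nu> + real (l0 + b * q)) - Digamma (real (l0 + b * q + 1))
          - real a / (2 * real b) * Digamma (real n / 2 + real (j0 + a * q div 2))
          - real a / (2 * real b) * Digamma (real (j0 + a * q div 2 + 1)))"

(* The summands of A3 are those of A4 times the digamma bracket. *)
definition A3_term :: "nat \<Rightarrow> nat \<Rightarrow> real \<Rightarrow> real \<Rightarrow> nat \<Rightarrow> complex \<Rightarrow> nat \<Rightarrow> complex" where
  "A3_term a b \<alpha> \<nu> n z q =
     A4_term a b \<alpha> \<nu> n z q * complex_of_real (A3_bracket a b \<alpha> \<nu> n q)"

definition A3 :: "nat \<Rightarrow> nat \<Rightarrow> real \<Rightarrow> real \<Rightarrow> nat \<Rightarrow> complex \<Rightarrow> complex" where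
  "A3 a b \<alpha> \<nu> n z =
     complex_of_real (- (2 * (-1) ^ (res_l n \<alpha> \<nu> + res_j n \<alpha> \<nu>) / \<alpha>))
     * (\<Sum>q. A3_term a b \<alpha> \<nu> n z q)"

definition A4 :: "nat \<Rightarrow> nat \<Rightarrow> real \<Rightarrow> real \<Rightarrow> nat \<Rightarrow> complex \<Rightarrow> complex" where
  "A4 a b \<alpha> \<nu> n z =
     complex_of_real (- 2 * (-1) ^ (res_l n \<alpha> \<nu> + res_j n \<alpha> \<nu>))
     * (\<Sum>q. A4_term a b \<alpha> \<nu> n z q)"

end

theory Submission
  imports Defs "HOL-Number_Theory.Cong"
begin

text \<open>
  Write $s = c + it$ with a small $c > 0$. Inserting the Mellin inversion
  $e^{-\lambda} = \frac{1}{2\pi}\int \Gamma(s) \lambda^{-s} dt$ into the Gamma integrals for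
  $\Gamma(\nu) (1 + u)^{-\nu}$ and $\Gamma(\alpha s / 2) u^{-s}$ writes the characteristic function as a mixture of
  Gaussians with complex weight. Fourier inversion with a Gaussian regulariser, which needs only
  continuity of the density at the point in question, turns this into the Mellin--Barnes integral
  \[ p(x) = \frac{1}{2^n \pi^{n/2} \Gamma(\nu)} \frac{1}{2\pi} \int
     \Gamma(s) \Gamma(\nu - s) \frac{\Gamma((n - \alpha s)/2)}{\Gamma(\alpha s/2)} \left(\frac{r}{2}\right)^{\alpha s - n} dt. \]
  Closing the contour to the right along the lines $c + 2 b k$ gives minus the sum of the residues. The
  poles are $\nu + l$ and $(n + 2j)/\alpha$; those in just one of the families are simple and make up $A_1$
  and $A_2$, while the common ones, the solutions of the resonance equation, are double and yield $A_3$
  and $A_4$. As $\alpha$ is rational, the sines from the reflection formula take the same nonzero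
  moduli on all these lines, and only finitely many positive moduli at the poles, which bounds the
  remainders and the coefficients.
\<close>

section \<open>Gaussian Fourier inversion\<close>

text \<open>The regulariser cannot be dispensed with: (1 + |t|^\<alpha>)^(-\<nu>) is integrable on
  R^n only for \<alpha> \<nu> > n, and the density may be unbounded at 0. Mellin integrals are
  written in the variable x = log of the usual one, so that Mellin inversion is Fourier inversion on
  the line. Stirling's formula is replaced by two crude estimates: Gamma (x + 1) is at least M^x
  e^(-M) for every M > 0, which beats any exponential, and |1/Gamma (s + it)| is at most e^(pi |t| /
  2) / Gamma s for s at least 1/2. Gamma factors whose argument moves to the left are turned into
  reciprocal ones by reflection. The reciprocal factors then grow at most like exp ((pi/2 + pi
  \<alpha>/2) |t|), up to a power of |t|, against sines of size exp ((pi + pi \<alpha>/2) |t|); the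
  surplus pi/2 pays for everything. The step 2 b between the lines changes the arguments of the two
  sines by 2 b pi and a pi, hence not their moduli. The conditions (i)-(iii) provide a solution of
  the resonance equation; the set of all solutions then follows from coprimality.\<close>

text \<open>Lebesgue measure is the image of a finite product of one-dimensional Lebesgue measures
  under the coordinates, so the product form of Fubini applies. This reduces Gaussian transforms to
  dimension one.\<close>

lemma lborel_prod_Basis:
  fixes f :: "'a::euclidean_space \<Rightarrow> real \<Rightarrow> complex"
  assumes "\<And>b. b \<in> Basis \<Longrightarrow> integrable lborel (f b)"
  shows "integrable lborel (\<lambda>x::'a. \<Prod>b\<in>Basis. f b (x \<bullet> b))"
    and "(LINT x|lborel. (\<Prod>b\<in>Basis. f b ((x::'a) \<bullet> b))) = (\<Prod>b\<in>Basis. LINT x|lborel. f b x)"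
proof -
  interpret product_sigma_finite "\<lambda>_::'a. lborel :: real measure"
    by standard
  have eq: "lborel = distr (\<Pi>\<^sub>M b\<in>(Basis::'a set). lborel) borel (\<lambda>g. \<Sum>b\<in>Basis. g b *\<^sub>R b)"
    by (rule lborel_eq)
  have m: "(\<lambda>g. \<Sum>b\<in>Basis. g b *\<^sub>R b) \<in> (\<Pi>\<^sub>M b\<in>(Basis::'a set). lborel) \<rightarrow>\<^sub>M borel"
    by measurable
  have m': "(\<lambda>x::'a. \<Prod>b\<in>Basis. f b (x \<bullet> b)) \<in> borel_measurable borel"
    using assms by (intro borel_measurable_prod) (auto dest: borel_measurable_integrable)
  have inner: "(\<Prod>b\<in>Basis. f b ((\<Sum>b\<in>Basis. g b *\<^sub>R b) \<bullet> b)) = (\<Prod>b\<in>Basis. f b (g b))" for g :: "'a \<Rightarrow> real"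
    by (rule prod.cong) auto
  show "integrable lborel (\<lambda>x::'a. \<Prod>b\<in>Basis. f b (x \<bullet> b))"
    unfolding eq by (subst integrable_distr_eq[OF m m'])
      (simp only: inner, intro product_integrable_prod finite_Basis assms)
  show "(LINT x|lborel. (\<Prod>b\<in>Basis. f b ((x::'a) \<bullet> b))) = (\<Prod>b\<in>Basis. LINT x|lborel. f b x)"
    unfolding eq by (subst integral_distr[OF m m'])
      (simp only: inner, intro product_integral_prod finite_Basis assms)
qed

lemma gauss_fourier_1d:
  fixes c t :: real
  assumes c: "c > 0"
  shows "integrable lborel (\<lambda>x::real. exp (\<i> * (x * t) - c * x\<^sup>2))"
    and "(LINT x|lborel. exp (\<i> * complex_of_real (x * t) - c * x\<^sup>2))
          = sqrt (pi / c) * exp (- (t\<^sup>2 / (4 * c)))"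
proof -
  define g where "g = (\<lambda>x::real. exp (\<i> * complex_of_real (x * t) - c * x\<^sup>2))"
  \<comment> \<open>The scale at which exp (- c x^2) turns into the standard normal density, whose
    characteristic function is known.\<close>
  define k where "k = sqrt (2 * c)"
  have k: "k > 0" "k\<^sup>2 = 2 * c" using c by (auto simp: k_def)
  have eq: "g (0 + (1/k) * x) = sqrt (2 * pi) * (std_normal_density x *\<^sub>R iexp ((t / k) * x))" for x
  proof -
    have e: "c * (0 + (1 / k) * x)\<^sup>2 = x\<^sup>2 / 2"
      using k c by (simp add: power_mult_distrib power_divide field_simps)
    hence "g (0 + (1/k) * x) = exp (\<i> * complex_of_real (t / k * x)) * exp (of_real (- x\<^sup>2 / 2))"
      unfolding g_def e by (simp add: mult.commute exp_add[symmetric])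
    thus ?thesis by (simp add: std_normal_density_def scaleR_conv_of_real flip: exp_of_real of_real_mult)
  qed
  interpret R: real_distribution std_normal_distribution by (rule real_dist_normal_dist)
  have iN: "integrable std_normal_distribution (\<lambda>x. iexp ((t / k) * x))"
    by (rule R.integrable_iexp) auto
  have i1: "integrable lborel (\<lambda>x. std_normal_density x *\<^sub>R iexp ((t / k) * x))"
    using iN by (subst (asm) integrable_density) auto
  have v1: "(LINT x|lborel. std_normal_density x *\<^sub>R iexp ((t / k) * x)) = exp (- ((t / k)^2) / 2)"
    using fun_cong[OF char_std_normal_distribution, of "t / k"]
    unfolding char_def by (subst (asm) integral_density) auto
  have "integrable lborel (\<lambda>x. g (0 + (1/k) * x))"
    unfolding eq by (intro integrable_mult_right i1)
  thus "integrable lborel (\<lambda>x::real. exp (\<i> * (x * t) - c * x\<^sup>2))"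
    using lborel_integrable_real_affine_iff[of "1/k" g 0] k by (simp add: g_def)
  have "(LINT x|lborel. g x) = \<bar>1/k\<bar> *\<^sub>R (LINT x|lborel. g (0 + (1/k) * x))"
    using k by (intro lborel_integral_real_affine) auto
  also have "\<dots> = (1/k) * (sqrt (2 * pi) * exp (- ((t / k)^2) / 2))"
    unfolding eq using k v1 by (simp add: scaleR_conv_of_real)
  also have "\<dots> = complex_of_real (sqrt (pi / c) * exp (- (t\<^sup>2 / (4 * c))))"
  proof -
    have "(1/k) * sqrt (2*pi) = sqrt (pi / c)" using c by (simp add: k_def real_sqrt_divide real_sqrt_mult)
    moreover have "(t / k)^2 / 2 = t\<^sup>2 / (4 * c)" using k by (simp add: power_divide)
    ultimately show ?thesis by (metis (no_types, opaque_lifting) minus_divide_left mult.assoc of_real_mult)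
  qed
  finally show "(LINT x|lborel. exp (\<i> * complex_of_real (x * t) - c * x\<^sup>2))
          = sqrt (pi / c) * exp (- (t\<^sup>2 / (4 * c)))" by (simp add: g_def)
qed

text \<open>Both the inner product and the squared norm are sums over the coordinates, so the
  integrand is a product of one-dimensional ones.\<close>

lemma gauss_fourier:
  fixes t :: "'a::euclidean_space" and c :: real
  assumes c: "c > 0"
  shows "integrable lborel (\<lambda>x::'a. exp (\<i> * (x \<bullet> t) - c * (norm x)\<^sup>2))"
    and "(LINT x|lborel. exp (\<i> * complex_of_real ((x::'a) \<bullet> t) - c * (norm x)\<^sup>2))
          = (pi / c) powr (DIM('a) / 2) * exp (- ((norm t)\<^sup>2 / (4 * c)))"
proof -
  define f where "f = (\<lambda>b (x::real). exp (\<i> * complex_of_real (x * (t \<bullet> b)) - c * x\<^sup>2))"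
  have eq: "exp (\<i> * complex_of_real (x \<bullet> t) - c * (norm x)\<^sup>2) = (\<Prod>b\<in>Basis. f b (x \<bullet> b))" for x :: 'a
  proof -
    have 1: "(norm x)\<^sup>2 = (\<Sum>b\<in>Basis. (x \<bullet> b)\<^sup>2)"
      unfolding power2_norm_eq_inner by (subst euclidean_inner) (simp add: power2_eq_square)
    have 2: "x \<bullet> t = (\<Sum>b\<in>Basis. (x \<bullet> b) * (t \<bullet> b))" by (rule euclidean_inner)
    show ?thesis unfolding f_def 1 2
      by (simp add: exp_sum[symmetric] sum_subtractf sum_distrib_left)
  qed
  have I: "integrable lborel (f b)" for b unfolding f_def by (rule gauss_fourier_1d[OF c])
  show "integrable lborel (\<lambda>x::'a. exp (\<i> * (x \<bullet> t) - c * (norm x)\<^sup>2))"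
    unfolding eq by (rule lborel_prod_Basis(1)[OF I])
  have "(LINT x|lborel. exp (\<i> * complex_of_real ((x::'a) \<bullet> t) - c * (norm x)\<^sup>2)) = 
     (\<Prod>b\<in>Basis. complex_of_real (sqrt (pi / c) * exp (- ((t \<bullet> b)\<^sup>2 / (4 * c)))))"
    unfolding eq by (subst lborel_prod_Basis(2)[OF I]) (simp add: f_def gauss_fourier_1d(2)[OF c, unfolded of_real_mult] del: of_real_power)
  also have "\<dots> = complex_of_real (sqrt (pi/c) ^ DIM('a) * exp (- (\<Sum>b\<in>Basis. (t \<bullet> b)\<^sup>2) / (4 * c)))"
    unfolding of_real_prod[symmetric]
    by (simp add: prod.distrib exp_sum[symmetric] sum_negf sum_divide_distrib)
  also have "sqrt (pi/c) ^ DIM('a) = (pi / c) powr (DIM('a) / 2)"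
    using c by (simp add: powr_half_sqrt[symmetric] powr_powr flip: powr_realpow)
  also have "(\<Sum>b\<in>Basis. (t \<bullet> b)\<^sup>2) = (norm t)\<^sup>2"
      unfolding power2_norm_eq_inner by (subst (2) euclidean_inner) (simp add: power2_eq_square)
  finally show "(LINT x|lborel. exp (\<i> * complex_of_real ((x::'a) \<bullet> t) - c * (norm x)\<^sup>2))
          = (pi / c) powr (DIM('a) / 2) * exp (- ((norm t)\<^sup>2 / (4 * c)))" by simp
qed

text \<open>A majorant of product form supplies the integrability on the product space; several of
  the interchanges of integrals below have such a majorant.\<close>

lemma Fubini_lborel_bound:
  fixes h :: "'a::euclidean_space \<Rightarrow> 'b::euclidean_space \<Rightarrow> complex"
  assumes f: "integrable lborel f" and g: "integrable lborel g"
    and h [measurable]: "case_prod h \<in> borel_measurable (lborel \<Otimes>\<^sub>M lborel)"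
    and le: "\<And>x y. norm (h x y) \<le> f x * g y"
  shows "integrable (lborel \<Otimes>\<^sub>M lborel) (case_prod h)"
    and "(LINT y|lborel. LINT x|lborel. h x y) = (LINT x|lborel. LINT y|lborel. h x y)"
proof -
  have P: "pair_sigma_finite (lborel :: 'a measure) (lborel :: 'b measure)"
    by unfold_locales
  have [measurable]: "f \<in> borel_measurable borel" "g \<in> borel_measurable borel"
    using f g by (auto dest: borel_measurable_integrable)
  have fg: "integrable (lborel \<Otimes>\<^sub>M lborel) (\<lambda>(x, y). f x * g y)"
  proof (rule pair_sigma_finite.Fubini_integrable[OF P])
    show "integrable lborel (\<lambda>x. LINT y|lborel. norm (case (x, y) of (x, y) \<Rightarrow> f x * g y))"
      using f by (simp add: abs_mult)
  qed (use g in auto)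
  show 1: "integrable (lborel \<Otimes>\<^sub>M lborel) (case_prod h)"
  proof (rule Bochner_Integration.integrable_bound[OF fg h])
    show "AE x in lborel \<Otimes>\<^sub>M lborel. norm (case x of (x, y) \<Rightarrow> h x y) \<le> norm (case x of (x, y) \<Rightarrow> f x * g y)"
      using order_trans[OF le abs_ge_self] by (intro AE_I2) (auto split: prod.split)
  qed
  show "(LINT y|lborel. LINT x|lborel. h x y) = (LINT x|lborel. LINT y|lborel. h x y)"
    by (rule pair_sigma_finite.Fubini_integral[OF P 1])
qed

lemma lborel_integral_affine:
  fixes f :: "'a::euclidean_space \<Rightarrow> 'b::{banach, second_countable_topology}"
  assumes c: "c > 0" and [measurable]: "f \<in> borel_measurable borel"
  shows "(LINT x|lborel. f x) = (c ^ DIM('a)) *\<^sub>R (LINT x|lborel. f (t + c *\<^sub>R x))"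
proof -
  have "(LINT x|lborel. f x) = (LINT x|density (distr lborel borel (\<lambda>x. t + c *\<^sub>R x)) (\<lambda>_. ennreal (\<bar>c\<bar>^DIM('a))). f x)"
    using c by (subst lborel_affine[of c t]) auto
  also have "\<dots> = (c ^ DIM('a)) *\<^sub>R (LINT x|lborel. f (t + c *\<^sub>R x))"
    using c by (subst integral_density) (auto simp: integral_distr)
  finally show ?thesis .
qed

lemma gauss_integral:
  fixes c :: real
  assumes c: "c > 0"
  shows "integrable lborel (\<lambda>x::'a::euclidean_space. exp (- c * (norm x)\<^sup>2))"
    and "(LINT x::'a|lborel. exp (- c * (norm x)\<^sup>2)) = (pi / c) powr (DIM('a) / 2)"
proof -
  have 1: "integrable lborel (\<lambda>x::'a. complex_of_real (exp (- c * (norm x)\<^sup>2)))"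
    using gauss_fourier(1)[OF c, of "0::'a"] by (simp add: exp_of_real[symmetric])
  thus 2: "integrable lborel (\<lambda>x::'a. exp (- c * (norm x)\<^sup>2))"
    by (subst (asm) complex_of_real_integrable_eq)
  have "complex_of_real (LINT x::'a|lborel. exp (- c * (norm x)\<^sup>2)) = complex_of_real ((pi / c) powr (DIM('a) / 2))"
    using gauss_fourier(2)[OF c, of "0::'a"] by (simp add: exp_of_real[symmetric] flip: integral_complex_of_real)
  thus "(LINT x::'a|lborel. exp (- c * (norm x)\<^sup>2)) = (pi / c) powr (DIM('a) / 2)"
    using of_real_eq_iff by blast
qed

text \<open>The Gaussian weight dominates the double integrand by |f x| exp (- e |t|^2), so the
  order of integration may be exchanged without any integrability of the transform; the inner
  integral is the Gaussian transform at x - y.\<close>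

lemma gauss_regularised_fourier_inversion:
  fixes f :: "'a::euclidean_space \<Rightarrow> complex"
  assumes f: "integrable lborel f" and e: "e > 0"
  shows "(LINT t|lborel. (LINT x|lborel. f x * exp (\<i> * (x \<bullet> t))) * exp (- \<i> * (y \<bullet> t) - e * (norm t)\<^sup>2))
    = (LINT x|lborel. f x * ((pi / e) powr (DIM('a) / 2) * exp (- ((norm (x - y))\<^sup>2 / (4 * e)))))"
    (is "?L = ?R")
proof -
  define h where "h = (\<lambda>x t. f x * exp (\<i> * complex_of_real ((x - y) \<bullet> t) - e * (norm t)\<^sup>2))"
  have [measurable]: "f \<in> borel_measurable borel"
    using f by (auto dest: borel_measurable_integrable)
  have hm: "case_prod h \<in> borel_measurable (lborel \<Otimes>\<^sub>M lborel)"
    unfolding h_def by measurable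
  have eq: "(LINT x|lborel. f x * exp (\<i> * (x \<bullet> t))) * exp (- \<i> * (y \<bullet> t) - e * (norm t)\<^sup>2)
     = (LINT x|lborel. h x t)" for t
    unfolding h_def
    by (subst Bochner_Integration.integral_mult_left_zero[symmetric])
       (auto intro!: Bochner_Integration.integral_cong simp: mult.assoc inner_diff_left algebra_simps simp flip: exp_add)
  have "?L = (LINT t|lborel. LINT x|lborel. h x t)" by (simp only: eq)
  also have "\<dots> = (LINT x|lborel. LINT t|lborel. h x t)"
  proof (rule Fubini_lborel_bound(2))
    show "integrable lborel (\<lambda>x. norm (f x))" using f by simp
    show "integrable lborel (\<lambda>t::'a. exp (- e * (norm t)\<^sup>2))" by (rule gauss_integral[OF e])
    show "cmod (h x t) \<le> cmod (f x) * exp (- e * (norm t)\<^sup>2)" for x t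
      by (simp add: h_def norm_mult)
  qed (rule hm)
  also have "(\<lambda>x. LINT t|lborel. h x t) = (\<lambda>x. f x * ((pi / e) powr (DIM('a) / 2) * exp (- ((norm (x - y))\<^sup>2 / (4 * e)))))"
    unfolding h_def inner_commute[of "_ - y"] by (simp only: Bochner_Integration.integral_mult_right_zero gauss_fourier(2)[OF e])
  finally show ?thesis .
qed

text \<open>The weight is the heat kernel at time \<open>X k\<close>. Near y the function is bounded
  and a rescaling reduces to dominated convergence; away from y the kernel is uniformly small and f
  is only required to be integrable. Boundedness far from y must not be used, because the density
  may blow up at 0.\<close>

lemma gauss_approx_identity:
  fixes f :: "'a::euclidean_space \<Rightarrow> complex" and X :: "nat \<Rightarrow> real"
  assumes f: "integrable lborel f" and y: "isCont f y"
    and X: "X \<longlonglongrightarrow> 0" "\<And>k. X k > 0"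
  shows "(\<lambda>k. LINT x|lborel. f x * ((4 * pi * X k) powr (- (DIM('a) / 2)) * exp (- ((norm (x - y))\<^sup>2 / (4 * X k)))))
     \<longlonglongrightarrow> f y"
proof -
  have [measurable]: "f \<in> borel_measurable borel"
    using f by (auto dest: borel_measurable_integrable)
  define K where "K = (\<lambda>e (x::'a). (4 * pi * e) powr (- (DIM('a) / 2)) * exp (- ((norm x)\<^sup>2 / (4 * e))))"
  have Kpos: "K e x \<ge> 0" for e x by (simp add: K_def)
  \<comment> \<open>Continuity at the single point y is used here to bound f by |f y| + 1 on a ball,
    and once more for the pointwise limit below.\<close>
  obtain d where d: "d > 0" "\<And>x. dist x y < d \<Longrightarrow> dist (f x) (f y) < 1"
    using y unfolding continuous_at_eps_delta by (metis zero_less_one)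
  define f1 where "f1 = (\<lambda>x. indicator (ball y d) x *\<^sub>R f x)"
  define f2 where "f2 = (\<lambda>x. indicator (- ball y d) x *\<^sub>R f x)"
  have [measurable]: "f1 \<in> borel_measurable borel" "f2 \<in> borel_measurable borel"
    unfolding f1_def f2_def by (auto intro!: borel_measurable_scaleR borel_measurable_indicator)
  have [measurable]: "K e \<in> borel_measurable borel" for e unfolding K_def by measurable
  have i2: "integrable lborel f2"
    unfolding f2_def using f by (intro integrable_mult_indicator) auto
  have i1: "integrable lborel f1"
    unfolding f1_def using f by (intro integrable_mult_indicator) auto
  have K_le: "K e x \<le> (4 * pi * e) powr (- (DIM('a) / 2))" if "e > 0" for e x
    using that unfolding K_def by (intro mult_left_le) auto
  have iK: "integrable lborel (\<lambda>x. g x * K e (x - y))" if "integrable lborel g" "e > 0" for g :: "'a \<Rightarrow> complex" and e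
  proof (rule Bochner_Integration.integrable_bound)
    show "integrable lborel (\<lambda>x. (4 * pi * e) powr (- (DIM('a) / 2)) *\<^sub>R g x)" using that by simp
    have [measurable]: "g \<in> borel_measurable borel" using that(1) by (auto dest: borel_measurable_integrable)
    show "(\<lambda>x. g x * K e (x - y)) \<in> borel_measurable lborel" by measurable
    show "AE x in lborel. cmod (g x * K e (x - y)) \<le> cmod ((4 * pi * e) powr (- (DIM('a) / 2)) *\<^sub>R g x)"
      using K_le[OF that(2)] Kpos that(2)
      by (intro AE_I2) (auto simp: norm_mult mult.commute[of _ "cmod _"] intro!: mult_left_mono)
  qed
  have split: "(LINT x|lborel. f x * K (X k) (x - y)) = (LINT x|lborel. f1 x * K (X k) (x - y)) + (LINT x|lborel. f2 x * K (X k) (x - y))" for k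
    unfolding Bochner_Integration.integral_add[OF iK[OF i1 X(2)] iK[OF i2 X(2)], symmetric]
    by (intro Bochner_Integration.integral_cong) (auto simp: f1_def f2_def indicator_def)
  have c1: "(\<lambda>k. LINT x|lborel. f1 x * K (X k) (x - y)) \<longlonglongrightarrow> f y"
  proof -
    have K1: "integrable lborel (K 1)" "(LINT x|lborel. K 1 x) = 1"
    proof -
      have "K 1 = (\<lambda>x. (4 * pi) powr (- (DIM('a) / 2)) * exp (- (1/4) * (norm x)\<^sup>2))"
        by (auto simp: K_def)
      thus "integrable lborel (K 1)" "(LINT x|lborel. K 1 x) = 1"
        using gauss_integral[where c = "1/4" and 'a = 'a] by (auto simp: powr_minus field_simps)
    qed
    \<comment> \<open>Substituting x = y + sqrt (X k) u moves the dependence on k from the kernel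
      into the argument of \<open>f1\<close>.\<close>
    have "(LINT x|lborel. f1 x * K (X k) (x - y)) = (LINT u|lborel. f1 (y + sqrt (X k) *\<^sub>R u) * K 1 u)" for k
    proof -
      have p: "sqrt (X k) > 0" using X(2) by simp
      have sc: "sqrt (X k) ^ DIM('a) * K (X k) (sqrt (X k) *\<^sub>R u) = K 1 u" for u
      proof -
        have a: "sqrt (X k) ^ DIM('a) = X k powr (DIM('a) / 2)"
          using X(2)[of k] by (simp add: powr_half_sqrt[symmetric] powr_powr flip: powr_realpow)
        have b: "(4 * pi * X k) powr (- (DIM('a) / 2)) = (4 * pi) powr (- (DIM('a) / 2)) * X k powr (- (DIM('a) / 2))"
          using X(2)[of k] by (subst powr_mult) auto
        have c: "X k powr (DIM('a) / 2) * X k powr (- (DIM('a) / 2)) = 1"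
          using X(2)[of k] by (simp flip: powr_add)
        have d: "(norm (sqrt (X k) *\<^sub>R u))\<^sup>2 / (4 * X k) = (norm u)\<^sup>2 / 4"
          using X(2)[of k] by (simp add: power_mult_distrib)
        have e: "X k powr (DIM('a) / 2) * ((4 * pi) powr (- (DIM('a) / 2)) * X k powr (- (DIM('a) / 2)) * E) = (4 * pi) powr (- (DIM('a) / 2)) * E" for E
          using c by algebra
        thus ?thesis unfolding K_def a b d e by simp
      qed
      have "(LINT x|lborel. f1 x * K (X k) (x - y)) = (LINT u|lborel. (sqrt (X k) ^ DIM('a)) *\<^sub>R (f1 (y + sqrt (X k) *\<^sub>R u) * K (X k) (y + sqrt (X k) *\<^sub>R u - y)))"
        by (subst lborel_integral_affine[OF p, where t = y]) auto
      also have "\<dots> = (LINT u|lborel. f1 (y + sqrt (X k) *\<^sub>R u) * K 1 u)"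
        by (intro Bochner_Integration.integral_cong) (auto simp: scaleR_conv_of_real mult_ac simp flip: sc)
      finally show ?thesis .
    qed
    moreover have "(\<lambda>k. LINT u|lborel. f1 (y + sqrt (X k) *\<^sub>R u) * K 1 u) \<longlonglongrightarrow> (LINT u|lborel. f y * K 1 u)"
    proof (rule integral_dominated_convergence)
      show "integrable lborel (\<lambda>u. (cmod (f y) + 1) * K 1 u)" using K1 by simp
      show "AE u in lborel. (\<lambda>k. f1 (y + sqrt (X k) *\<^sub>R u) * K 1 u) \<longlonglongrightarrow> f y * K 1 u"
      proof (intro AE_I2 tendsto_mult tendsto_const)
        fix u
        have "(\<lambda>k. y + sqrt (X k) *\<^sub>R u) \<longlonglongrightarrow> y + sqrt 0 *\<^sub>R u"
          by (intro tendsto_intros X)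
        hence lim: "(\<lambda>k. y + sqrt (X k) *\<^sub>R u) \<longlonglongrightarrow> y" by simp
        have "(\<lambda>k. f (y + sqrt (X k) *\<^sub>R u)) \<longlonglongrightarrow> f y"
          by (rule isCont_tendsto_compose[OF y lim])
        moreover have "eventually (\<lambda>k. y + sqrt (X k) *\<^sub>R u \<in> ball y d) sequentially"
          using topological_tendstoD[OF lim open_ball] d by (metis centre_in_ball)
        ultimately show "(\<lambda>k. f1 (y + sqrt (X k) *\<^sub>R u)) \<longlonglongrightarrow> f y"
          by (elim Lim_transform_eventually) (auto elim!: eventually_mono simp: f1_def)
      qed
      show "AE u in lborel. cmod (f1 (y + sqrt (X k) *\<^sub>R u) * K 1 u) \<le> (cmod (f y) + 1) * K 1 u" for k
      proof (intro AE_I2)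
        fix u
        have "cmod (f1 x) \<le> cmod (f y) + 1" for x
        proof (cases "dist x y < d")
          case True
          hence "cmod (f x - f y) < 1" using d(2) by (simp add: dist_norm)
          thus ?thesis using norm_triangle_sub[of "f x" "f y"] by (auto simp: f1_def indicator_def)
        qed (auto simp: f1_def indicator_def dist_commute)
        thus "cmod (f1 (y + sqrt (X k) *\<^sub>R u) * K 1 u) \<le> (cmod (f y) + 1) * K 1 u"
          using Kpos by (auto simp: norm_mult intro!: mult_right_mono)
      qed
    qed measurable
    ultimately show ?thesis using K1 by (simp add: complex_of_real_integrable_eq)
  qed
  have c2: "(\<lambda>k. LINT x|lborel. f2 x * K (X k) (x - y)) \<longlonglongrightarrow> 0"
  proof (rule Lim_null_comparison)
    \<comment> \<open>The supremum of the kernel outside the ball of radius d; its exponential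
      factor wins over the power of e.\<close>
    define q where "q = (\<lambda>e. (4 * pi * e) powr (- (DIM('a) / 2)) * exp (- (d\<^sup>2 / (4 * e))))"
    have "filterlim X (at_right 0) sequentially"
      using X(1) less_imp_neq[OF X(2)] X(2) by (auto simp: filterlim_at intro!: always_eventually)
    moreover have "(q \<longlongrightarrow> 0) (at_right 0)"
    proof -
      define m where "m = real DIM('a) / 2"
      have "d\<^sup>2 > 0" using d by simp
      hence "((\<lambda>e. (4 * pi * e) powr (- m) * exp (- (d\<^sup>2 / (4 * e)))) \<longlongrightarrow> 0) (at_right 0)"
        by real_asymp
      thus ?thesis by (simp add: q_def m_def)
    qed
    ultimately have "(\<lambda>k. q (X k)) \<longlonglongrightarrow> 0" by (rule filterlim_compose[rotated])
    thus "(\<lambda>k. q (X k) * (LINT x|lborel. cmod (f2 x))) \<longlonglongrightarrow> 0"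
      by (rule tendsto_mult_left_zero)
    show "\<forall>\<^sub>F k in sequentially. cmod (LINT x|lborel. f2 x * K (X k) (x - y)) \<le> q (X k) * (LINT x|lborel. cmod (f2 x))"
    proof (intro always_eventually allI)
      fix k
      have "cmod (LINT x|lborel. f2 x * K (X k) (x - y)) \<le> (LINT x|lborel. q (X k) * cmod (f2 x))"
      proof (rule Bochner_Integration.integral_norm_bound_integral[OF iK[OF i2 X(2)]])
        fix x
        have "K (X k) (x - y) \<le> q (X k)" if "\<not> dist y x < d"
        proof -
          have "d\<^sup>2 \<le> (norm (x - y))\<^sup>2" using that d(1) by (intro power_mono) (auto simp: dist_norm norm_minus_commute)
          thus ?thesis using X(2)[of k] by (auto simp: K_def q_def intro!: mult_left_mono divide_right_mono)
        qed
        thus "cmod (f2 x * K (X k) (x - y)) \<le> q (X k) * cmod (f2 x)"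
          using Kpos by (auto simp: f2_def norm_mult indicator_def mult.commute intro!: mult_left_mono)
      qed (use i2 in simp)
      thus "cmod (LINT x|lborel. f2 x * K (X k) (x - y)) \<le> q (X k) * (LINT x|lborel. cmod (f2 x))" by simp
    qed
  qed
  have "(\<lambda>k. LINT x|lborel. f x * K (X k) (x - y)) \<longlonglongrightarrow> f y + 0"
    unfolding split by (intro tendsto_add c1 c2)
  thus ?thesis by (simp add: K_def)
qed

text \<open>The approximate identity read on the Fourier side; (2 pi)^d is the quotient of the
  factor produced by the Gaussian transform and the normalisation of the heat kernel.\<close>

lemma fourier_inversion_gauss:
  fixes f :: "'a::euclidean_space \<Rightarrow> complex" and X :: "nat \<Rightarrow> real"
  assumes f: "integrable lborel f" and y: "isCont f y"
    and X: "X \<longlonglongrightarrow> 0" "\<And>k. X k > 0"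
  shows "(\<lambda>k. (LINT t|lborel. (LINT x|lborel. f x * exp (\<i> * (x \<bullet> t))) * exp (- \<i> * (y \<bullet> t) - X k * (norm t)\<^sup>2)))
     \<longlonglongrightarrow> (2 * pi) ^ DIM('a) * f y"
proof -
  have c: "(2 * pi) ^ DIM('a) * (4 * pi * e) powr (- (DIM('a) / 2)) = (pi / e) powr (DIM('a) / 2)" if "e > 0" for e :: real
  proof -
    have "(2 * pi) ^ DIM('a) = (4 * pi * pi) powr (DIM('a) / 2)"
    proof -
      have "(4 * pi * pi) powr (DIM('a) / 2) = ((2 * pi) powr 2) powr (DIM('a) / 2)"
        by (simp add: power2_eq_square mult.assoc)
      thus ?thesis by (simp only: powr_powr) (simp add: powr_realpow)
    qed
    also have "4 * pi * pi = (4 * pi * e) * (pi / e)" using that by simp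
    finally show ?thesis using that by (simp add: powr_mult powr_minus powr_divide field_simps)
  qed
  have "(\<lambda>k. (2 * pi) ^ DIM('a) * (LINT x|lborel. f x * ((4 * pi * X k) powr (- (DIM('a) / 2)) * exp (- ((norm (x - y))\<^sup>2 / (4 * X k))))))
     \<longlonglongrightarrow> (2 * pi) ^ DIM('a) * f y"
    by (intro tendsto_mult tendsto_const gauss_approx_identity assms)
  also have "(\<lambda>k. (2 * pi) ^ DIM('a) * (LINT x|lborel. f x * ((4 * pi * X k) powr (- (DIM('a) / 2)) * exp (- ((norm (x - y))\<^sup>2 / (4 * X k))))))
    = (\<lambda>k. (LINT t|lborel. (LINT x|lborel. f x * exp (\<i> * (x \<bullet> t))) * exp (- \<i> * (y \<bullet> t) - X k * (norm t)\<^sup>2)))"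
    unfolding gauss_regularised_fourier_inversion[OF f X(2)] c[OF X(2), symmetric]
    by (intro ext) (simp add: mult_ac flip: Bochner_Integration.integral_mult_right_zero)
  finally show ?thesis .
qed

text \<open>With an integrable transform the regulariser disappears by dominated convergence. This
  classical form serves the Mellin inversion of exp (- exp y) on the real line.\<close>

lemma fourier_inversion:
  fixes f :: "'a::euclidean_space \<Rightarrow> complex"
  assumes f: "integrable lborel f" and y: "isCont f y"
    and F: "integrable lborel (\<lambda>t. LINT x|lborel. f x * exp (\<i> * (x \<bullet> t)))"
  shows "(LINT t|lborel. (LINT x|lborel. f x * exp (\<i> * (x \<bullet> t))) * exp (- \<i> * (y \<bullet> t))) = (2 * pi) ^ DIM('a) * f y"
proof -
  define F where "F = (\<lambda>t. LINT x|lborel. f x * exp (\<i> * (x \<bullet> t)))"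
  have [measurable]: "F \<in> borel_measurable borel"
    using F by (auto simp: F_def dest: borel_measurable_integrable)
  define X where "X = (\<lambda>k. inverse (real (Suc k)))"
  have X: "X \<longlonglongrightarrow> 0" "\<And>k. X k > 0" unfolding X_def by (auto intro: LIMSEQ_inverse_real_of_nat simp del: of_nat_Suc)
  have "(\<lambda>k. LINT t|lborel. F t * exp (- \<i> * (y \<bullet> t) - X k * (norm t)\<^sup>2)) \<longlonglongrightarrow> (LINT t|lborel. F t * exp (- \<i> * (y \<bullet> t)))"
  proof (rule integral_dominated_convergence)
    show "integrable lborel (\<lambda>t. norm (F t))" using F by (simp add: F_def)
    show "AE t in lborel. (\<lambda>k. F t * exp (- \<i> * (y \<bullet> t) - X k * (norm t)\<^sup>2)) \<longlonglongrightarrow> F t * exp (- \<i> * (y \<bullet> t))"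
    proof (intro AE_I2)
      fix t :: 'a
      have "(\<lambda>k. F t * exp (- \<i> * (y \<bullet> t) - of_real (X k * (norm t)\<^sup>2))) \<longlonglongrightarrow> F t * exp (- \<i> * (y \<bullet> t) - of_real (0 * (norm t)\<^sup>2))"
        by (intro tendsto_intros X)
      thus "(\<lambda>k. F t * exp (- \<i> * (y \<bullet> t) - X k * (norm t)\<^sup>2)) \<longlonglongrightarrow> F t * exp (- \<i> * (y \<bullet> t))" by simp
    qed
    show "AE t in lborel. norm (F t * exp (- \<i> * (y \<bullet> t) - X k * (norm t)\<^sup>2)) \<le> norm (F t)" for k
    proof (intro AE_I2)
      fix t :: 'a
      have "X k * (norm t)\<^sup>2 \<ge> 0" using X(2)[of k] by simp
      thus "norm (F t * exp (- \<i> * (y \<bullet> t) - X k * (norm t)\<^sup>2)) \<le> norm (F t)"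
        by (auto simp: norm_mult intro!: mult_left_le)
    qed
  qed measurable
  from LIMSEQ_unique[OF this[unfolded F_def] fourier_inversion_gauss[OF f y X]] show ?thesis
    by simp
qed

section \<open>Bounds for the Gamma function\<close>

text \<open>Euler's integral under the substitution t = exp x. On a vertical line it exhibits Gamma
  as the Fourier transform of an integrable function on the whole line.\<close>

lemma Gamma_integral_exp_aux:
  fixes z :: complex
  assumes z: "Re z > 0"
  shows "integrable lborel (\<lambda>x::real. exp (z * x - of_real (exp x)))"
    and "(LINT x|lborel. exp (z * complex_of_real x - of_real (exp x))) = Gamma z"
proof -
  define f where "f = (\<lambda>t. complex_of_real t powr (z - 1) / of_real (exp t))"
  have "x \<in> range exp" if "x > 0" for x :: real
    using that by (metis exp_ln rangeI)
  hence img: "exp ` (UNIV :: real set) = {0<..}"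
    by auto
  have eq: "\<bar>exp x\<bar> *\<^sub>R f (exp x) = exp (z * complex_of_real x - of_real (exp x))" for x :: real
  proof -
    have L: "Ln (complex_of_real (exp x)) = of_real x"
      by (subst Ln_of_real) auto
    have "\<bar>exp x\<bar> *\<^sub>R f (exp x) = exp (of_real x) * (exp ((z - 1) * of_real x) / exp (of_real (exp x)))"
      unfolding f_def by (simp add: powr_def L scaleR_conv_of_real exp_of_real)
    also have "\<dots> = exp (z * complex_of_real x - of_real (exp x))"
      unfolding exp_diff[symmetric] exp_add[symmetric] by (simp add: algebra_simps)
    finally show ?thesis .
  qed
  have "f absolutely_integrable_on exp ` UNIV \<and> integral (exp ` UNIV) f = Gamma z"
    unfolding img f_def using absolutely_integrable_Gamma_integral'[OF z] Gamma_integral_complex'[OF z]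
    by (auto simp: integral_unique)
  hence "(\<lambda>x. \<bar>exp x\<bar> *\<^sub>R f (exp x)) absolutely_integrable_on UNIV \<and>
     integral UNIV (\<lambda>x::real. \<bar>exp x\<bar> *\<^sub>R f (exp x)) = Gamma z"
    by (subst has_absolute_integral_change_of_variables_real) (auto intro!: derivative_eq_intros inj_onI)
  hence *: "(\<lambda>x::real. exp (z * complex_of_real x - of_real (exp x))) absolutely_integrable_on UNIV"
     "integral UNIV (\<lambda>x::real. exp (z * complex_of_real x - of_real (exp x))) = Gamma z"
    unfolding eq by auto
  show 1: "integrable lborel (\<lambda>x::real. exp (z * x - of_real (exp x)))"
    using *(1) by (subst (asm) set_integrable_def) (auto simp: integrable_completion)
  show "(LINT x|lborel. exp (z * complex_of_real x - of_real (exp x))) = Gamma z"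
    using *(2) integral_lborel[OF 1] by simp
qed

text \<open>Translating x by ln l in the previous lemma absorbs the factor l.\<close>

lemma Gamma_integral_exp:
  fixes z :: complex and l :: real
  assumes z: "Re z > 0" and l: "l > 0"
  shows "integrable lborel (\<lambda>x::real. exp (z * x - of_real (l * exp x)))"
    and "(LINT x|lborel. exp (z * complex_of_real x - of_real (l * exp x))) = Gamma z * exp (- z * ln l)"
proof -
  define F where "F = (\<lambda>x::real. exp (z * x - of_real (exp x)))"
  have eq: "F (ln l + 1 * x) = exp (z * ln l) * exp (z * x - of_real (l * exp x))" for x
  proof -
    have "exp (ln l + 1 * x) = l * exp x" using l by (simp add: exp_add)
    thus ?thesis unfolding F_def by (simp add: algebra_simps flip: exp_add)
  qed
  have "integrable lborel (\<lambda>x. exp (- z * ln l) * F (ln l + 1 * x))"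
    using Gamma_integral_exp_aux(1)[OF z] lborel_integrable_real_affine_iff[of 1 F "ln l"]
    by (simp add: F_def)
  also have "(\<lambda>x. exp (- z * ln l) * F (ln l + 1 * x)) = (\<lambda>x::real. exp (z * x - of_real (l * exp x)))"
    unfolding eq by (simp add: mult.assoc[symmetric] flip: exp_add)
  finally show "integrable lborel (\<lambda>x::real. exp (z * x - of_real (l * exp x)))" .
  have "Gamma z = (LINT x|lborel. F (ln l + 1 * x))"
    using Gamma_integral_exp_aux(2)[OF z] lborel_integral_real_affine[of 1 F "ln l"] by (simp add: F_def)
  also have "\<dots> = exp (z * ln l) * (LINT x|lborel. exp (z * complex_of_real x - of_real (l * exp x)))"
    unfolding eq by simp
  finally show "(LINT x|lborel. exp (z * complex_of_real x - of_real (l * exp x))) = Gamma z * exp (- z * ln l)"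
    by (simp add: exp_minus)
qed

lemma Gamma_integral_exp_real:
  fixes a l :: real
  assumes "a > 0" "l > 0"
  shows "integrable lborel (\<lambda>x::real. exp (a * x - l * exp x))"
    and "(LINT x|lborel. exp (a * x - l * exp x)) = Gamma a * exp (- a * ln l)"
proof -
  have eq: "exp (complex_of_real a * of_real x - of_real (l * exp x)) = complex_of_real (exp (a * x - l * exp x))" for x
    by (simp add: exp_of_real[symmetric])
  show 1: "integrable lborel (\<lambda>x::real. exp (a * x - l * exp x))"
    using Gamma_integral_exp(1)[of "of_real a" l] assms unfolding eq by (simp add: complex_of_real_integrable_eq)
  have "complex_of_real (LINT x|lborel. exp (a * x - l * exp x)) = complex_of_real (Gamma a * exp (- a * ln l))"
    using Gamma_integral_exp(2)[of "of_real a" l] assms unfolding eq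
    by (simp add: Gamma_complex_of_real flip: integral_complex_of_real exp_of_real)
  thus "(LINT x|lborel. exp (a * x - l * exp x)) = Gamma a * exp (- a * ln l)"
    using of_real_eq_iff by blast
qed

lemma norm_Gamma_le:
  assumes "Re z > 0" shows "norm (Gamma z) \<le> Gamma (Re z)"
proof -
  have "norm (Gamma z) \<le> (LINT x|lborel. norm (exp (z * complex_of_real x - of_real (exp x))))"
    unfolding Gamma_integral_exp_aux(2)[OF assms, symmetric] by (rule integral_norm_bound)
  also have "\<dots> = Gamma (Re z)"
    using Gamma_integral_exp_real(2)[of "Re z" 1] assms by simp
  finally show ?thesis .
qed

text \<open>Keep only t at least M in Euler's integral and bound t^x below by M^x there. As M is
  free, this shows that Gamma outgrows every exponential, which stands in for Stirling's
  formula.\<close>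

lemma Gamma_ge_powr:
  fixes M x :: real
  assumes "M > 0" "x \<ge> 0"
  shows "M powr x * exp (- M) \<le> Gamma (x + 1)"
proof -
  have 1: "((\<lambda>t. t powr x / exp t) has_integral Gamma (x + 1)) {0..}"
    using Gamma_integral_real[of "x + 1"] assms by simp
  have "((\<lambda>t. exp (- 1 * t)) has_integral exp (- 1 * M) / 1) {M..}"
    by (rule has_integral_exp_minus_to_infinity) simp
  hence "((\<lambda>t. M powr x * exp (- t)) has_integral M powr x * exp (- M)) {M..}"
    using has_integral_mult_right[of "\<lambda>t. exp (- 1 * t)" _ _ "M powr x"] by simp
  hence 2: "((\<lambda>t. if t \<in> {M..} then M powr x * exp (- t) else 0) has_integral M powr x * exp (- M)) {0..}"
    using assms by (subst has_integral_restrict) auto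
  show ?thesis
    by (rule has_integral_le[OF 2 1]) (use assms in \<open>auto simp: exp_minus field_simps powr_mono2\<close>)
qed

text \<open>Comparison with the integrand of the Gamma integral, made symmetric under x to
  -x.\<close>

lemma integrable_exp_neg_abs:
  fixes k :: real
  assumes k: "k > 0"
  shows "integrable lborel (\<lambda>x::real. exp (- k * \<bar>x\<bar>))"
proof -
  define f where "f = (\<lambda>x::real. exp (k * x - 1 * exp x))"
  have i: "integrable lborel f" unfolding f_def by (rule Gamma_integral_exp_real) (use k in auto)
  have "integrable lborel (\<lambda>x. f (0 + (-1) * x))"
    using i lborel_integrable_real_affine_iff[of "-1" f 0] by simp
  hence j: "integrable lborel (\<lambda>x. exp 1 * (f x + f (0 + (-1) * x)))" using i by simp
  show ?thesis
  proof (rule Bochner_Integration.integrable_bound[OF j])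
    have "exp (- k * \<bar>x\<bar>) \<le> exp 1 * (f x + f (- x))" for x
    proof -
      \<comment> \<open>At -|x| the inner exponential is at most 1, so dropping it costs the factor
        exp 1.\<close>
      have "exp (- k * \<bar>x\<bar>) \<le> exp 1 * f (- \<bar>x\<bar>)"
        by (simp add: f_def flip: exp_add)
      also have "f (- \<bar>x\<bar>) \<le> f x + f (- x)" by (auto simp: f_def abs_if)
      finally show ?thesis by simp
    qed
    moreover have "f x \<ge> 0" for x by (simp add: f_def)
    ultimately show "AE x in lborel. norm (exp (- k * \<bar>x\<bar>)) \<le> norm (exp 1 * (f x + f (0 + - 1 * x)))"
      by (auto intro!: AE_I2)
  qed simp
qed

section \<open>Lower bounds for the complex sine and growth of the reciprocal Gamma function\<close>

lemma exp_abs_le_cosh: "exp \<bar>y\<bar> \<le> 2 * cosh (y::real)"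
  by (auto simp: cosh_def abs_if)

lemma norm_sin_ge_cosh: "\<bar>sin (Re z)\<bar> * cosh (Im z) \<le> norm (sin z)"
  using abs_Re_le_cmod[of "sin z"] by (simp add: Re_sin cosh_def abs_mult)

lemma norm_sin_ge_exp: "\<bar>sin (Re z)\<bar> * exp \<bar>Im z\<bar> / 2 \<le> norm (sin z)"
proof -
  have "\<bar>sin (Re z)\<bar> * exp \<bar>Im z\<bar> \<le> \<bar>sin (Re z)\<bar> * (2 * cosh (Im z))"
    by (intro mult_left_mono exp_abs_le_cosh) auto
  thus ?thesis using norm_sin_ge_cosh[of z] by simp
qed

text \<open>|sin (x + iy)|^2 = sin^2 x + sinh^2 y. Unlike the preceding bounds this one does not
  degenerate when \<open>Re z\<close> hits a zero of the sine, as is needed on horizontal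
  segments.\<close>

lemma norm_sin_ge_sinh: "\<bar>sinh (Im z)\<bar> \<le> norm (sin z)"
proof -
  have "(sinh (Im z))\<^sup>2 = (sin (Re z))\<^sup>2 * (sinh (Im z))\<^sup>2 + (cos (Re z))\<^sup>2 * (sinh (Im z))\<^sup>2"
    unfolding distrib_right[symmetric] by simp
  also have "\<dots> \<le> (sin (Re z))\<^sup>2 * (cosh (Im z))\<^sup>2 + (cos (Re z))\<^sup>2 * (sinh (Im z))\<^sup>2"
    by (simp add: distrib_left cosh_square_eq)
  also have "\<dots> = (norm (sin z))\<^sup>2"
    unfolding cmod_power2 by (simp add: Re_sin Im_sin cosh_def sinh_def power_mult_distrib power_divide)
  finally have "\<bar>sinh (Im z)\<bar>\<^sup>2 \<le> (norm (sin z))\<^sup>2" by simp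
  thus ?thesis by (rule power2_le_imp_le) simp
qed

text \<open>On this line the conjugate of z is 1 - z, so the squared modulus is exactly the product
  in the reflection formula.\<close>

lemma norm_rGamma_half_le: "norm (rGamma (Complex (1/2) t)) \<le> rGamma (1/2) * exp (pi * \<bar>t\<bar> / 2)"
proof -
  define z where "z = Complex (1/2) t"
  have "cnj z = 1 - z" by (simp add: z_def complex_eq_iff)
  hence "rGamma (1 - z) = cnj (rGamma z)" by (simp add: cnj_rGamma)
  hence "complex_of_real ((norm (rGamma z))\<^sup>2) = rGamma z * rGamma (1 - z)"
    by (simp only: complex_norm_square)
  also have "\<dots> = sin (of_real pi * z) / of_real pi" by (rule rGamma_reflection_complex)
  finally have "Re (complex_of_real ((norm (rGamma z))\<^sup>2)) = Re (sin (of_real pi * z) / of_real pi)" by simp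
  hence eq: "(norm (rGamma z))\<^sup>2 = cosh (pi * t) / pi"
    by (simp add: Re_sin Re_divide_of_real z_def cosh_def)
  have "cosh (pi * t) \<le> exp \<bar>pi * t\<bar>"
    by (auto simp: cosh_def abs_if)
  hence "(norm (rGamma z))\<^sup>2 \<le> exp (pi * \<bar>t\<bar>) / pi"
    unfolding eq by (intro divide_right_mono) (auto simp: abs_mult)
  also have "\<dots> = (rGamma (1/2) * exp (pi * \<bar>t\<bar> / 2))\<^sup>2"
  proof -
    have "(rGamma (1/2 :: real))\<^sup>2 = 1 / pi"
      unfolding rGamma_inverse_Gamma Gamma_one_half_real power_inverse by (simp add: inverse_eq_divide)
    moreover have "(exp (pi * \<bar>t\<bar> / 2))\<^sup>2 = exp (pi * \<bar>t\<bar>)"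
      by (subst power2_eq_square, subst exp_add[symmetric]) simp
    ultimately show ?thesis by (simp add: power_mult_distrib)
  qed
  finally show ?thesis unfolding z_def
    by (rule power2_le_imp_le) (simp add: rGamma_inverse_Gamma Gamma_one_half_real)
qed

text \<open>In Gauss's product every factor of $|\<Gamma>(s)/\<Gamma>(s + it)|$ decreases in $s$, so the worst value for
  $s \<ge> 1/2$ is the one at $s = 1/2$, where the reflection formula evaluates it.\<close>

lemma norm_rGamma_vertical_le:
  assumes s: "s \<ge> 1/2"
  shows "norm (rGamma (Complex s t)) \<le> rGamma s * exp (pi * \<bar>t\<bar> / 2)"
proof -
  \<comment> \<open>Cross-multiplied form of the monotonicity in s of one factor of the
    product.\<close>
  have fac: "norm (Complex s t + of_nat k) * (1/2 + real k) \<le> norm (Complex (1/2) t + of_nat k) * (s + real k)" for k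
  proof -
    define a b where "a = s + real k" and "b = 1/2 + real k"
    have ab: "0 < b" "b \<le> a" using s by (auto simp: a_def b_def)
    have "(a\<^sup>2 + t\<^sup>2) * b\<^sup>2 \<le> (b\<^sup>2 + t\<^sup>2) * a\<^sup>2"
    proof -
      have "t\<^sup>2 * b\<^sup>2 \<le> t\<^sup>2 * a\<^sup>2" using ab by (intro mult_left_mono power_mono) auto
      thus ?thesis by (simp add: algebra_simps)
    qed
    hence "sqrt ((a\<^sup>2 + t\<^sup>2) * b\<^sup>2) \<le> sqrt ((b\<^sup>2 + t\<^sup>2) * a\<^sup>2)" by (rule real_sqrt_le_mono)
    thus ?thesis using ab by (simp add: real_sqrt_mult a_def b_def cmod_def)
  qed
  have poch: "norm (pochhammer (Complex s t) n) * pochhammer (1/2) n \<le> norm (pochhammer (Complex (1/2) t) n) * pochhammer s n" for n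
  proof -
    have "(\<Prod>k<n. norm (Complex s t + of_nat k) * (1/2 + real k)) \<le> (\<Prod>k<n. norm (Complex (1/2) t + of_nat k) * (s + real k))"
      by (intro prod_mono conjI fac) auto
    thus ?thesis by (simp add: pochhammer_prod prod_norm prod.distrib atLeast0LessThan)
  qed
  have ser: "norm (rGamma_series (Complex s t) n) * rGamma_series (1/2) n \<le> norm (rGamma_series (Complex (1/2) t) n) * rGamma_series s n" for n
  proof -
    have nr: "norm (rGamma_series (Complex x t) n) = norm (pochhammer (Complex x t) (n+1)) / (fact n * exp (x * ln (real n)))" for x
      by (simp add: rGamma_series_def norm_divide norm_mult)
    show ?thesis
      unfolding nr using poch[of "n+1"]
      by (simp add: rGamma_series_def divide_right_mono mult_ac)
  qed
  have lim: "norm (rGamma (Complex s t)) * rGamma (1/2) \<le> norm (rGamma (Complex (1/2) t)) * rGamma s"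
    by (rule LIMSEQ_le[OF tendsto_mult[OF tendsto_norm[OF rGamma_series_LIMSEQ] rGamma_series_LIMSEQ]
            tendsto_mult[OF tendsto_norm[OF rGamma_series_LIMSEQ] rGamma_series_LIMSEQ]])
       (use ser in auto)
  also have "\<dots> \<le> (rGamma (1/2) * exp (pi * \<bar>t\<bar> / 2)) * rGamma s"
    using s by (intro mult_right_mono norm_rGamma_half_le) (auto simp: rGamma_inverse_Gamma intro!: less_imp_le Gamma_real_pos)
  finally have "rGamma (1/2) * norm (rGamma (Complex s t)) \<le> rGamma (1/2) * (rGamma s * exp (pi * \<bar>t\<bar> / 2))"
    by (simp add: mult_ac)
  thus ?thesis
    by (subst (asm) mult_le_cancel_left_pos) (auto simp: rGamma_inverse_Gamma Gamma_one_half_real)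
qed

text \<open>\<open>Gamma_ge_powr\<close> with M = 1 gives Gamma y at least 1/e for y at least 1; the
  functional equation carries the bound down to 1/2.\<close>

lemma rGamma_real_le:
  assumes "x \<ge> (1/2::real)" shows "rGamma x \<le> exp 1"
proof -
  have ge: "rGamma y \<le> exp 1" if "y \<ge> 1" for y :: real
  proof -
    have "exp (-1) \<le> Gamma y" using Gamma_ge_powr[of 1 "y - 1"] that by simp
    hence "inverse (Gamma y) \<le> inverse (exp (-1))" by (rule le_imp_inverse_le) simp
    thus ?thesis by (simp add: rGamma_inverse_Gamma exp_minus)
  qed
  show ?thesis
  proof (cases "x \<ge> 1")
    case False
    have "rGamma x = x * rGamma (x + 1)" by (simp add: rGamma_plus1)
    also have "\<dots> \<le> 1 * exp 1" using False assms by (intro mult_mono ge) (auto simp: rGamma_inverse_Gamma intro!: less_imp_le Gamma_real_pos)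
    finally show ?thesis by simp
  qed (rule ge)
qed

text \<open>Shifting the argument by m brings it into the half plane where the vertical bound holds;
  the Pochhammer factor costs only a polynomial.\<close>

lemma norm_rGamma_le:
  assumes "Re z \<ge> 1/2 - real m"
  shows "norm (rGamma z) \<le> exp 1 * (norm z + m) ^ m * exp (pi * \<bar>Im z\<bar> / 2)"
proof -
  have 1: "norm (rGamma (z + of_nat m)) \<le> exp 1 * exp (pi * \<bar>Im z\<bar> / 2)"
  proof -
    have "z + of_nat m = Complex (Re z + m) (Im z)" by (simp add: complex_eq_iff)
    hence "norm (rGamma (z + of_nat m)) \<le> rGamma (Re z + m) * exp (pi * \<bar>Im z\<bar> / 2)"
      using norm_rGamma_vertical_le[of "Re z + m" "Im z"] assms by simp
    also have "\<dots> \<le> exp 1 * exp (pi * \<bar>Im z\<bar> / 2)"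
      using assms by (intro mult_right_mono rGamma_real_le) auto
    finally show ?thesis .
  qed
  have 2: "norm (pochhammer z m) \<le> (norm z + m) ^ m"
  proof -
    have "norm (pochhammer z m) = (\<Prod>k<m. norm (z + of_nat k))"
      by (simp add: pochhammer_prod prod_norm atLeast0LessThan)
    also have "\<dots> \<le> (\<Prod>k<m. norm z + m)"
      by (intro prod_mono conjI norm_ge_zero order_trans[OF norm_triangle_ineq]) auto
    finally show ?thesis by simp
  qed
  have "norm (rGamma z) = norm (pochhammer z m) * norm (rGamma (z + of_nat m))"
    by (subst pochhammer_rGamma[of z m]) (simp add: norm_mult)
  also have "\<dots> \<le> (norm z + m) ^ m * (exp 1 * exp (pi * \<bar>Im z\<bar> / 2))"
    by (intro mult_mono 1 2) auto
  finally show ?thesis by (simp add: mult_ac)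
qed

section \<open>The Mellin--Barnes representation\<close>

lemma Re_pos_not_nonpos_Ints: "Re z > 0 \<Longrightarrow> z \<notin> \<int>\<^sub>\<le>\<^sub>0"
  by (auto elim!: nonpos_Ints_cases)

text \<open>By reflection Gamma z is pi / (Gamma (1 - z) sin (pi z)): growth exp (pi |t| / 2) over
  growth exp (pi |t|). The bound c at most 1/2 puts 1 - z where
  \<open>norm_rGamma_vertical_le\<close> applies.\<close>

lemma Gamma_vertical_decay:
  assumes c: "0 < c" "c \<le> 1/2"
  obtains C where "\<And>t. norm (Gamma (Complex c t)) \<le> C * exp (- (pi / 2) * \<bar>t\<bar>)"
proof
  fix t
  define z where "z = Complex c t"
  define S where "S = \<bar>sin (pi * c)\<bar>"
  have S: "S > 0" using c sin_gt_zero[of "pi * c"] by (auto simp: S_def)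
  have sin: "S * exp (pi * \<bar>t\<bar>) / 2 \<le> norm (sin (of_real pi * z))"
    using norm_sin_ge_exp[of "of_real pi * z"] by (simp add: S_def z_def abs_mult)
  moreover have "S * exp (pi * \<bar>t\<bar>) / 2 > 0" using S by simp
  ultimately have ns: "norm (sin (of_real pi * z)) > 0" by linarith
  have "rGamma z * rGamma (1 - z) = sin (of_real pi * z) / of_real pi"
    by (rule rGamma_reflection_complex)
  moreover from this have "rGamma z \<noteq> 0" using ns by auto
  ultimately have "Gamma z = of_real pi * rGamma (1 - z) / sin (of_real pi * z)"
    using ns by (auto simp: Gamma_def field_simps)
  hence "norm (Gamma z) = pi * norm (rGamma (1 - z)) / norm (sin (of_real pi * z))"
    by (simp add: norm_mult norm_divide)
  also have "1 - z = Complex (1 - c) (- t)" by (simp add: z_def complex_eq_iff)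
  also have "pi * norm (rGamma (Complex (1 - c) (- t))) / norm (sin (of_real pi * z))
     \<le> pi * (rGamma (1 - c) * exp (pi * \<bar>t\<bar> / 2)) / (S * exp (pi * \<bar>t\<bar>) / 2)"
    using norm_rGamma_vertical_le[of "1 - c" "- t"] c sin S
    by (intro frac_le mult_left_mono) (auto intro!: mult_nonneg_nonneg less_imp_le[OF Gamma_real_pos] simp: rGamma_inverse_Gamma)
  also have "\<dots> = (2 * pi * rGamma (1 - c) / S) * (exp (pi * \<bar>t\<bar> / 2) / exp (pi * \<bar>t\<bar>))" by simp
  also have "exp (pi * \<bar>t\<bar> / 2) / exp (pi * \<bar>t\<bar>) = exp (- (pi / 2) * \<bar>t\<bar>)"
    unfolding exp_diff[symmetric] by (simp add: algebra_simps)
  finally show "norm (Gamma (Complex c t)) \<le> (2 * pi * rGamma (1 - c) / \<bar>sin (pi * c)\<bar>) * exp (- (pi / 2) * \<bar>t\<bar>)"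
    unfolding z_def S_def .
qed

lemma continuous_Complex [continuous_intros]:
  "continuous_on A f \<Longrightarrow> continuous_on A g \<Longrightarrow> continuous_on A (\<lambda>x. Complex (f x) (g x))"
  unfolding Complex_eq by (intro continuous_intros)

lemma continuous_on_Gamma_compose:
  fixes f :: "_ \<Rightarrow> complex"
  assumes "continuous_on A f" "\<And>x. x \<in> A \<Longrightarrow> f x \<notin> \<int>\<^sub>\<le>\<^sub>0"
  shows "continuous_on A (\<lambda>x. Gamma (f x))"
  by (rule continuous_on_compose2[OF continuous_on_Gamma[of "- \<int>\<^sub>\<le>\<^sub>0"] assms(1)]) (use assms(2) in auto)

lemma measurable_Gamma_vertical:
  assumes "c > 0" shows "(\<lambda>t. Gamma (Complex c t)) \<in> borel_measurable borel"
  using assms by (intro borel_measurable_continuous_onI continuous_on_Gamma_compose continuous_intros Re_pos_not_nonpos_Ints) auto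

lemma integrable_Gamma_vertical:
  assumes c: "0 < c" "c \<le> 1/2"
  shows "integrable lborel (\<lambda>t. Gamma (Complex c t))"
proof -
  obtain C where C: "\<And>t. norm (Gamma (Complex c t)) \<le> C * exp (- (pi / 2) * \<bar>t\<bar>)"
    using Gamma_vertical_decay[OF c] by blast
  show ?thesis
  proof (rule Bochner_Integration.integrable_bound)
    show "integrable lborel (\<lambda>t. C * exp (- (pi / 2) * \<bar>t\<bar>))"
      by (intro integrable_mult_right integrable_exp_neg_abs) auto
    show "(\<lambda>t. Gamma (Complex c t)) \<in> borel_measurable lborel"
      using measurable_Gamma_vertical c by simp
    show "AE t in lborel. norm (Gamma (Complex c t)) \<le> norm (C * exp (- (pi / 2) * \<bar>t\<bar>))"
      using order_trans[OF C abs_ge_self] by (intro AE_I2) simp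
  qed
qed

text \<open>On the line, Gamma is the Fourier transform of exp (c x - exp x) and decays
  exponentially, so classical inversion applies. Here y is the logarithm of the usual Mellin
  variable.\<close>

lemma mellin_inversion_exp:
  assumes c: "0 < c" "c \<le> 1/2"
  shows "(LINT t|lborel. Gamma (Complex c t) * exp (- Complex c t * of_real y)) = of_real (2 * pi * exp (- exp y))"
proof -
  define f where "f = (\<lambda>x::real. exp (complex_of_real c * of_real x - of_real (exp x)))"
  have F: "(LINT x|lborel. f x * exp (\<i> * of_real (x \<bullet> t))) = Gamma (Complex c t)" for t :: real
  proof -
    have "f x * exp (\<i> * of_real (x \<bullet> t)) = exp (Complex c t * of_real x - of_real (exp x))" for x
      unfolding f_def exp_add[symmetric] by (simp add: Complex_eq algebra_simps)
    thus ?thesis using Gamma_integral_exp_aux(2)[of "Complex c t"] c by simp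
  qed
  have i: "integrable lborel f" unfolding f_def
    using Gamma_integral_exp_aux(1)[of "of_real c"] c by simp
  have "(LINT t|lborel. Gamma (Complex c t) * exp (- \<i> * of_real (y \<bullet> t))) = (2 * pi) ^ DIM(real) * f y"
    unfolding F[symmetric]
  proof (rule fourier_inversion[OF i])
    show "isCont f y" unfolding f_def by (intro continuous_intros)
    show "integrable lborel (\<lambda>t. LINT x|lborel. f x * iexp (x \<bullet> t))"
      unfolding F by (rule integrable_Gamma_vertical[OF c])
  qed
  hence "exp (- of_real c * of_real y) * (LINT t|lborel. Gamma (Complex c t) * exp (- \<i> * of_real (y * t)))
     = exp (- of_real c * of_real y) * (of_real (2 * pi) * f y)" by simp
  also have "\<dots> = of_real (2 * pi) * exp (- of_real (exp y))"
    unfolding f_def by (simp add: mult.left_commute flip: exp_add)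
  also have "exp (- of_real c * of_real y) * (LINT t|lborel. Gamma (Complex c t) * exp (- \<i> * of_real (y * t)))
    = (LINT t|lborel. exp (- of_real c * of_real y) * (Gamma (Complex c t) * exp (- \<i> * of_real (y * t))))" by simp
  also have "\<dots> = (LINT t|lborel. Gamma (Complex c t) * exp (- Complex c t * of_real y))"
    by (intro Bochner_Integration.integral_cong)
       (auto simp: mult.left_commute Complex_eq algebra_simps simp flip: exp_add)
  finally show ?thesis by (simp flip: exp_of_real)
qed

text \<open>Integrate the previous identity at y + v against exp (\<nu> v - exp v). One order of
  integration yields Gamma (\<nu> - s), convergent because c < \<nu>; the other yields the Gamma
  integral with rate 1 + exp y.\<close>

lemma mellin_inversion_binomial:
  assumes c: "0 < c" "c \<le> 1/2" "c < \<nu>"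
  shows "(LINT t|lborel. Gamma (Complex c t) * Gamma (of_real \<nu> - Complex c t) * exp (- Complex c t * of_real y))
    = of_real (2 * pi * (Gamma \<nu> * (1 + exp y) powr (- \<nu>)))"
proof -
  define h where "h = (\<lambda>t (v::real). Gamma (Complex c t) * exp (- Complex c t * of_real (y + v))
     * exp (of_real \<nu> * of_real v - of_real (exp v)))"
  have [measurable]: "(\<lambda>t. Gamma (Complex c t)) \<in> borel_measurable borel"
    using measurable_Gamma_vertical c by simp
  have [measurable]: "(\<lambda>t. Complex c t) \<in> borel_measurable borel"
    by (intro borel_measurable_continuous_onI continuous_intros)
  have hm: "case_prod h \<in> borel_measurable (lborel \<Otimes>\<^sub>M lborel)"
    unfolding h_def by measurable
  have bound: "norm (h t v) \<le> norm (Gamma (Complex c t)) * (exp (- c * y) * exp ((\<nu> - c) * v - 1 * exp v))" for t v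
    by (simp add: h_def norm_mult algebra_simps flip: exp_add)
  have fub: "(LINT v|lborel. LINT t|lborel. h t v) = (LINT t|lborel. LINT v|lborel. h t v)"
    by (rule Fubini_lborel_bound(2)[OF _ _ hm bound])
       (use c in \<open>auto intro!: integrable_mult_right integrable_norm integrable_Gamma_vertical Gamma_integral_exp_real(1)[of _ 1, simplified]\<close>)
  have 1: "(LINT t|lborel. h t v) = complex_of_real (2 * pi * exp (\<nu> * v - (1 + exp y) * exp v))" for v
  proof -
    have "(LINT t|lborel. h t v) = of_real (2 * pi * exp (- exp (y + v))) * exp (of_real \<nu> * of_real v - of_real (exp v))"
      unfolding h_def using mellin_inversion_exp[OF c(1,2), of "y + v"] by simp
    also have "\<dots> = complex_of_real (2 * pi * exp (\<nu> * v - (1 + exp y) * exp v))"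
      by (simp add: exp_add distrib_right mult.assoc flip: exp_of_real)
         (simp add: algebra_simps flip: exp_add)
    finally show ?thesis .
  qed
  have 2: "(LINT v|lborel. h t v) = Gamma (Complex c t) * Gamma (of_real \<nu> - Complex c t) * exp (- Complex c t * of_real y)" for t
  proof -
    have "h t v = (Gamma (Complex c t) * exp (- Complex c t * of_real y)) * exp ((of_real \<nu> - Complex c t) * of_real v - of_real (exp v))" for v
      unfolding h_def by (simp add: mult.assoc algebra_simps flip: exp_add)
    thus ?thesis using Gamma_integral_exp_aux(2)[of "of_real \<nu> - Complex c t"] c by (simp add: mult_ac)
  qed
  have "(LINT v|lborel. LINT t|lborel. h t v) = of_real (2 * pi * (Gamma \<nu> * exp (- \<nu> * ln (1 + exp y))))"
    unfolding 1 integral_complex_of_real using Gamma_integral_exp_real(2)[of \<nu> "1 + exp y"] c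
    by (simp add: add_pos_pos)
  also have "exp (- \<nu> * ln (1 + exp y)) = (1 + exp y) powr (- \<nu>)"
    using add_pos_pos[OF zero_less_one exp_gt_zero[of y]] by (simp add: powr_def)
  finally show ?thesis unfolding fub 2 .
qed


section \<open>The characteristic function as a mixture of Gaussians\<close>

lemma two_sided_exp_bound:
  fixes f K1 K2 a b x :: real
  assumes "f \<le> K1 * exp (a * x)" "f \<le> K2 * exp (- b * x)" "K1 \<ge> 0" "K2 \<ge> 0"
  shows "f \<le> max K1 K2 * exp (- min a b * \<bar>x\<bar>)"
proof (cases "x \<le> 0")
  case True
  have "f \<le> K1 * exp (a * x)" by fact
  also have "\<dots> \<le> max K1 K2 * exp (- min a b * \<bar>x\<bar>)"
    using True assms by (intro mult_mono) (auto simp: mult_right_mono_neg)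
  finally show ?thesis .
next
  case False
  have "f \<le> K2 * exp (- b * x)" by fact
  also have "\<dots> \<le> max K1 K2 * exp (- min a b * \<bar>x\<bar>)"
    using False assms by (intro mult_mono) (auto simp: mult_right_mono)
  finally show ?thesis .
qed

text \<open>With L = ln (r / 2) the last factor is (r / 2)^(\<alpha> s - n). The denominator Gamma
  (\<alpha> s / 2) is written as the entire function \<open>rGamma\<close>, so it creates no
  singularities.\<close>

definition mb_kernel :: "real \<Rightarrow> real \<Rightarrow> nat \<Rightarrow> real \<Rightarrow> complex \<Rightarrow> complex" where
  "mb_kernel \<alpha> \<nu> n L s = Gamma s * Gamma (of_real \<nu> - s) * rGamma (of_real \<alpha> * s / 2)
     * Gamma ((of_nat n - of_real \<alpha> * s) / 2) * exp ((of_real \<alpha> * s - of_nat n) * of_real L)"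

context
  fixes \<alpha> \<nu> c :: real
  assumes \<alpha>: "0 < \<alpha>" "\<alpha> < 2" and c: "0 < c" "c \<le> 1/2" "c < \<nu>"
begin

text \<open>The factor \<open>rGamma\<close> is there to cancel the value Gamma (\<alpha> s / 2)
  that the integral over the Gaussian scale produces in \<open>mix_laplace\<close>.\<close>

private definition mb_weight :: "real \<Rightarrow> complex" where
  "mb_weight t = Gamma (Complex c t) * Gamma (of_real \<nu> - Complex c t) * rGamma (of_real \<alpha> * Complex c t / 2)"

private lemma measurable_mb_weight [measurable]: "mb_weight \<in> borel_measurable borel"
  unfolding mb_weight_def using c
  by (intro borel_measurable_continuous_onI continuous_on_mult continuous_on_Gamma_compose continuous_on_rGamma
       continuous_intros Re_pos_not_nonpos_Ints continuous_on_compose2[OF continuous_on_rGamma[of UNIV]]) auto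

private lemma integrable_mb_weight: "integrable lborel mb_weight"
proof -
  obtain C where C: "\<And>t. norm (Gamma (Complex c t)) \<le> C * exp (- (pi / 2) * \<bar>t\<bar>)"
    using Gamma_vertical_decay[OF c(1,2)] by blast
  \<comment> \<open>Decay rate of Gamma s minus growth rate of the reciprocal Gamma; it is positive
    because \<alpha> < 2. Half of it will pay for the linear factor.\<close>
  define d where "d = pi / 2 - pi * \<alpha> / 4"
  have d: "d > 0" using \<alpha> by (simp add: d_def)
  have C0: "C \<ge> 0" using order_trans[OF norm_ge_zero C[of 0]] by simp
  have rG: "norm (rGamma (of_real \<alpha> * Complex c t / 2)) \<le> exp 1 * (3 + 2 * \<bar>t\<bar>) * exp (pi * \<alpha> / 4 * \<bar>t\<bar>)" for t
  proof -
    define w where "w = of_real \<alpha> * Complex c t / 2"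
    have Re: "Re w = \<alpha> * c / 2" "Im w = \<alpha> * t / 2" by (simp_all add: w_def)
    have "norm (rGamma w) \<le> exp 1 * (norm w + real 1) ^ 1 * exp (pi * \<bar>Im w\<bar> / 2)"
      using mult_pos_pos[OF \<alpha>(1) c(1)] by (intro norm_rGamma_le) (simp add: Re)
    also have "norm w + real 1 \<le> 3 + 2 * \<bar>t\<bar>"
    proof -
      have "norm w \<le> \<bar>Re w\<bar> + \<bar>Im w\<bar>" by (rule cmod_le)
      moreover have "\<alpha> * c \<le> 2 * 1" using \<alpha> c by (intro mult_mono) auto
      moreover have "\<alpha> * \<bar>t\<bar> \<le> 2 * \<bar>t\<bar>" using \<alpha> by (intro mult_right_mono) auto
      ultimately show ?thesis using \<alpha> c by (simp add: Re abs_mult)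
    qed
    hence "exp 1 * (norm w + real 1) ^ 1 * exp (pi * \<bar>Im w\<bar> / 2) \<le> exp 1 * (3 + 2 * \<bar>t\<bar>) * exp (pi * \<bar>Im w\<bar> / 2)"
      by (intro mult_right_mono mult_left_mono) auto
    also have "pi * \<bar>Im w\<bar> / 2 = pi * \<alpha> / 4 * \<bar>t\<bar>" using \<alpha> by (simp add: Re abs_mult)
    finally show ?thesis by (simp add: w_def)
  qed
  \<comment> \<open>Chosen so that 3 + 2 |t| is at most K (1 + d |t| / 2): the summand 3 covers the
    constant, 4 / d the slope.\<close>
  define K where "K = 3 + 4 / d"
  have lin: "3 + 2 * \<bar>t\<bar> \<le> K * exp (d / 2 * \<bar>t\<bar>)" for t :: real
  proof -
    have "3 + 2 * \<bar>t\<bar> \<le> K * (1 + d / 2 * \<bar>t\<bar>)"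
      using d by (simp add: K_def field_simps)
    also have "\<dots> \<le> K * exp (d / 2 * \<bar>t\<bar>)"
      using d by (intro mult_left_mono exp_ge_add_one_self) (auto simp: K_def)
    finally show ?thesis .
  qed
  show ?thesis
  proof (rule Bochner_Integration.integrable_bound)
    define B where "B = C * Gamma (\<nu> - c) * exp 1 * K"
    show "integrable lborel (\<lambda>t. B * exp (- (d / 2) * \<bar>t\<bar>))"
      using d by (intro integrable_mult_right integrable_exp_neg_abs) auto
    show "mb_weight \<in> borel_measurable lborel" by simp
    show "AE t in lborel. norm (mb_weight t) \<le> norm (B * exp (- (d / 2) * \<bar>t\<bar>))"
    proof (intro AE_I2)
      fix t
      have "norm (mb_weight t) \<le> (C * exp (- (pi / 2) * \<bar>t\<bar>)) * Gamma (\<nu> - c) * (exp 1 * (K * exp (d / 2 * \<bar>t\<bar>)) * exp (pi * \<alpha> / 4 * \<bar>t\<bar>))"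
        unfolding mb_weight_def norm_mult
      proof (intro mult_mono)
        show "norm (Gamma (of_real \<nu> - Complex c t)) \<le> Gamma (\<nu> - c)"
          using norm_Gamma_le[of "of_real \<nu> - Complex c t"] c by simp
        show "norm (rGamma (of_real \<alpha> * Complex c t / 2)) \<le> exp 1 * (K * exp (d / 2 * \<bar>t\<bar>)) * exp (pi * \<alpha> / 4 * \<bar>t\<bar>)"
          by (rule order_trans[OF rG]) (intro mult_right_mono mult_left_mono lin, auto)
      qed (use C C0 c d in \<open>auto simp: K_def intro!: mult_nonneg_nonneg\<close>)
      also have "\<dots> = B * (exp (- (pi / 2) * \<bar>t\<bar>) * exp (d / 2 * \<bar>t\<bar>) * exp (pi * \<alpha> / 4 * \<bar>t\<bar>))"
        by (simp add: B_def mult_ac)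
      also have "exp (- (pi / 2) * \<bar>t\<bar>) * exp (d / 2 * \<bar>t\<bar>) * exp (pi * \<alpha> / 4 * \<bar>t\<bar>) = exp (- (d / 2) * \<bar>t\<bar>)"
        unfolding exp_add[symmetric] by (simp add: d_def field_simps)
      also have "B * exp (- (d / 2) * \<bar>t\<bar>) \<le> norm (B * exp (- (d / 2) * \<bar>t\<bar>))" by simp
      finally show "norm (mb_weight t) \<le> norm (B * exp (- (d / 2) * \<bar>t\<bar>))" .
    qed
  qed
qed

text \<open>The complex weight with which the Gaussian exp (- exp x |t|^2) enters the mixture; x is
  the logarithm of its rate.\<close>

private definition mix :: "real \<Rightarrow> complex" where
  "mix x = (LINT t|lborel. mb_weight t * exp (of_real \<alpha> * Complex c t / 2 * of_real x))"

private lemma measurable_mix [measurable]: "mix \<in> borel_measurable borel"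
proof -
  have [measurable]: "(\<lambda>t. Complex c t) \<in> borel_measurable borel"
    by (intro borel_measurable_continuous_onI continuous_intros)
  show ?thesis unfolding mix_def by measurable
qed

private lemma norm_mix_le: "norm (mix x) \<le> (LINT t|lborel. norm (mb_weight t)) * exp (\<alpha> * c / 2 * x)"
proof -
  have "norm (mix x) \<le> (LINT t|lborel. norm (mb_weight t * exp (of_real \<alpha> * Complex c t / 2 * of_real x)))"
    unfolding mix_def by (rule integral_norm_bound)
  also have "\<dots> = (LINT t|lborel. norm (mb_weight t) * exp (\<alpha> * c / 2 * x))"
    by (simp add: norm_mult)
  finally show ?thesis by simp
qed

private lemma mix_fubini:
  assumes g: "integrable lborel (\<lambda>x. exp (\<alpha> * c / 2 * x) * g x)" "g \<in> borel_measurable borel" "\<And>x. g x \<ge> 0"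
  shows "(LINT x|lborel. mix x * of_real (g x)) =
     (LINT t|lborel. mb_weight t * (LINT x|lborel. exp (of_real \<alpha> * Complex c t / 2 * of_real x) * of_real (g x)))"
proof -
  define h where "h = (\<lambda>t x. mb_weight t * exp (of_real \<alpha> * Complex c t / 2 * of_real x) * complex_of_real (g x))"
  have [measurable]: "g \<in> borel_measurable borel" by fact
  have [measurable]: "(\<lambda>t. Complex c t) \<in> borel_measurable borel"
    by (intro borel_measurable_continuous_onI continuous_intros)
  have hm: "case_prod h \<in> borel_measurable (lborel \<Otimes>\<^sub>M lborel)"
    unfolding h_def by measurable
  have bound: "norm (h t x) \<le> norm (mb_weight t) * (exp (\<alpha> * c / 2 * x) * g x)" for t x
    using g(3)[of x] by (simp add: h_def norm_mult)
  have "(LINT x|lborel. LINT t|lborel. h t x) = (LINT t|lborel. LINT x|lborel. h t x)"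
    by (rule Fubini_lborel_bound(2)[OF _ _ hm bound]) (use integrable_mb_weight g in auto)
  moreover have "(LINT t|lborel. h t x) = mix x * of_real (g x)" for x
    by (simp add: h_def mix_def)
  moreover have "(LINT x|lborel. h t x) = mb_weight t * (LINT x|lborel. exp (of_real \<alpha> * Complex c t / 2 * of_real x) * of_real (g x))" for t
    by (simp only: h_def mult.assoc[of "mb_weight t"] Bochner_Integration.integral_mult_right_zero)
  ultimately show ?thesis by simp
qed

text \<open>Integrating over x first gives Gamma (\<alpha> s / 2) u^(- \<alpha> s / 2), which
  cancels the reciprocal Gamma of the weight. What remains is
  \<open>mellin_inversion_binomial\<close> at (\<alpha> / 2) ln u. For u = |t|^2 the result is the
  characteristic function times 2 pi Gamma \<nu>.\<close>

private lemma mix_laplace: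
  assumes u: "u > 0"
  shows "(LINT x|lborel. mix x * of_real (exp (- u * exp x))) = of_real (2 * pi * (Gamma \<nu> * (1 + u powr (\<alpha> / 2)) powr (- \<nu>)))"
proof -
  have e: "exp w * of_real (exp (- u * exp x)) = exp (w - of_real (u * exp x))" for w :: complex and x
    unfolding exp_of_real[symmetric] exp_add[symmetric] by simp
  have e': "exp w * exp (- u * exp x) = exp (w - u * exp x)" for w x
    unfolding exp_add[symmetric] by simp
  have *: "(LINT x|lborel. exp (of_real \<alpha> * Complex c t / 2 * of_real x) * of_real (exp (- u * exp x)))
    = Gamma (of_real \<alpha> * Complex c t / 2) * exp (- (of_real \<alpha> * Complex c t / 2) * of_real (ln u))" for t
    unfolding e using \<alpha> c u by (intro Gamma_integral_exp(2)) auto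
  have g: "integrable lborel (\<lambda>x. exp (\<alpha> * c / 2 * x) * exp (- u * exp x))"
    unfolding e' using \<alpha> c u by (intro Gamma_integral_exp_real(1)) auto
  have "(LINT x|lborel. mix x * of_real (exp (- u * exp x))) =
     (LINT t|lborel. mb_weight t * (Gamma (of_real \<alpha> * Complex c t / 2) * exp (- (of_real \<alpha> * Complex c t / 2) * of_real (ln u))))"
    unfolding *[symmetric] by (rule mix_fubini[OF g]) auto
  also have "\<dots> = (LINT t|lborel. Gamma (Complex c t) * Gamma (of_real \<nu> - Complex c t) * exp (- Complex c t * of_real (\<alpha> / 2 * ln u)))"
  proof (intro Bochner_Integration.integral_cong refl)
    fix t
    have "Gamma (of_real \<alpha> * Complex c t / 2) \<noteq> 0"
      using \<alpha> c by (subst Gamma_eq_zero_iff) (intro Re_pos_not_nonpos_Ints, auto)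
    thus "mb_weight t * (Gamma (of_real \<alpha> * Complex c t / 2) * exp (- (of_real \<alpha> * Complex c t / 2) * of_real (ln u)))
      = Gamma (Complex c t) * Gamma (of_real \<nu> - Complex c t) * exp (- Complex c t * of_real (\<alpha> / 2 * ln u))"
      by (simp add: mb_weight_def rGamma_inverse_Gamma mult_ac)
  qed
  also have "\<dots> = of_real (2 * pi * (Gamma \<nu> * (1 + exp (\<alpha> / 2 * ln u)) powr (- \<nu>)))"
    by (rule mellin_inversion_binomial[OF c])
  also have "exp (\<alpha> / 2 * ln u) = u powr (\<alpha> / 2)" using u by (simp add: powr_def)
  finally show ?thesis .
qed

text \<open>With the characteristic function written as a mixture, the regulariser just adds e to
  the rate exp x of each Gaussian, and the integral over t is explicit. After e tends to 0, the
  integral over x is again a Gamma integral and produces Gamma ((n - \<alpha> s) / 2) and the power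
  of |y| / 2.\<close>

lemma radial_density_mellin_barnes:
  fixes f :: "'a::euclidean_space \<Rightarrow> complex"
  assumes f: "integrable lborel f" and y: "isCont f y" "y \<noteq> 0"
    and char: "\<And>t. (LINT x|lborel. f x * exp (\<i> * of_real (x \<bullet> t))) = of_real ((1 + norm t powr \<alpha>) powr (- \<nu>))"
  shows "(2 * pi) ^ DIM('a) * f y * (2 * pi * Gamma \<nu>)
    = pi powr (DIM('a) / 2) * (LINT t|lborel. mb_kernel \<alpha> \<nu> DIM('a) (ln (norm y / 2)) (Complex c t))"
proof -
  define D where "D = real DIM('a) / 2"
  have D: "D \<ge> 1/2" by (simp add: D_def DIM_positive Suc_leI)
  \<comment> \<open>Makes the integral over x converge at plus infinity: the mixing weight may grow
    like exp (\<alpha> c x / 2), the Gaussian integral decays like exp (- D x).\<close>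
  have acD: "\<alpha> * c / 2 < D"
  proof -
    have "\<alpha> * c < 2 * (1 / 2)" using \<alpha> c by (intro mult_less_le_imp_less) auto
    thus ?thesis using D by simp
  qed
  define W where "W = (LINT t|lborel. norm (mb_weight t))"
  have W: "W \<ge> 0" by (simp add: W_def)
  define R where "R = (norm y)\<^sup>2 / 4"
  have R: "R > 0" using y by (simp add: R_def)
  \<comment> \<open>The Fourier transform at y of the Gaussian with rate exp x + e.\<close>
  define g where "g = (\<lambda>e x. (pi / (exp x + e)) powr D * exp (- (R / (exp x + e))))"
  have [measurable]: "g e \<in> borel_measurable borel" for e unfolding g_def by measurable
  have g0: "g e x \<ge> 0" for e x by (simp add: g_def)
  have pe: "(pi / exp x) powr D = pi powr D * exp (- D * x)" for x
  proof -
    have "(pi / exp x) powr D = pi powr D / exp x powr D" by (rule powr_divide)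
    thus ?thesis by (simp add: exp_powr_real exp_minus field_simps)
  qed
  have pw: "(pi / (exp x + e)) powr D \<le> pi powr D * exp (- D * x)" if "e \<ge> 0" for e x
  proof -
    have "(pi / (exp x + e)) powr D \<le> (pi / exp x) powr D"
      using that D by (intro powr_mono2 divide_left_mono) (auto intro!: mult_pos_pos add_pos_nonneg)
    also have "\<dots> = pi powr D * exp (- D * x)"
      by (rule pe)
    finally show ?thesis .
  qed
  have g1: "g e x \<le> pi powr D * exp (- D * x)" if "e \<ge> 0" for e x
  proof -
    have "g e x \<le> (pi / (exp x + e)) powr D"
      using R that by (auto simp: g_def intro!: mult_left_le divide_nonneg_pos add_pos_nonneg)
    thus ?thesis using pw[OF that, of x] by linarith
  qed
  \<comment> \<open>A bound uniform in e, from \<open>Gamma_ge_powr\<close> at R / v: the factor exp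
    (- R / v) tames v^(-D) as v tends to 0. This is where y being nonzero matters, since it gives R
    > 0.\<close>
  define M where "M = (pi / R) powr D * Gamma (D + 1)"
  have M0: "M \<ge> 0" using D by (auto simp: M_def intro!: mult_nonneg_nonneg less_imp_le[OF Gamma_real_pos])
  have g2: "g e x \<le> M" if "e \<ge> 0" for e x
  proof -
    define v where "v = exp x + e"
    have v: "v > 0" using that by (auto simp: v_def intro: add_pos_nonneg)
    have "(R / v) powr D * exp (- (R / v)) \<le> Gamma (D + 1)"
      using v R D by (intro Gamma_ge_powr) auto
    moreover have "(pi / v) powr D = (pi / R) powr D * (R / v) powr D"
      using v R by (simp flip: powr_mult)
    ultimately show ?thesis unfolding g_def v_def[symmetric] M_def
      by (simp add: mult.assoc mult_left_mono)
  qed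
  define k where "k = min (\<alpha> * c / 2) (D - \<alpha> * c / 2)"
  have k: "k > 0" using acD \<alpha> c by (simp add: k_def)
  have two: "exp (\<alpha> * c / 2 * x) * G \<le> max M' (pi powr D) * exp (- k * \<bar>x\<bar>)"
    if "G \<le> M'" "G \<le> pi powr D * exp (- D * x)" "M' \<ge> 0" for G M' x
    unfolding k_def
  proof (rule two_sided_exp_bound)
    show "exp (\<alpha> * c / 2 * x) * G \<le> M' * exp (\<alpha> * c / 2 * x)" using that by (simp add: mult.commute)
    have "exp (\<alpha> * c / 2 * x) * G \<le> exp (\<alpha> * c / 2 * x) * (pi powr D * exp (- D * x))"
      using that by (intro mult_left_mono) auto
    also have "\<dots> = pi powr D * exp (- (D - \<alpha> * c / 2) * x)"
      by (simp add: algebra_simps flip: exp_add)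
    finally show "exp (\<alpha> * c / 2 * x) * G \<le> pi powr D * exp (- (D - \<alpha> * c / 2) * x)" .
  qed (use that in auto)
  have ik: "integrable lborel (\<lambda>x. K * exp (- k * \<bar>x\<bar>))" for K :: real
    by (intro integrable_mult_right integrable_exp_neg_abs k)

  have A: "2 * pi * Gamma \<nu> * (LINT t|lborel. of_real ((1 + norm t powr \<alpha>) powr (- \<nu>)) * exp (- \<i> * of_real (y \<bullet> t) - e * (norm t)\<^sup>2))
      = (LINT x|lborel. mix x * of_real (g e x))" if e: "e > 0" for e
  proof -
    define h where "h = (\<lambda>x t. mix x * exp (\<i> * complex_of_real (t \<bullet> (- y)) - of_real ((exp x + e) * (norm t)\<^sup>2)))"
    have hm: "case_prod h \<in> borel_measurable (lborel \<Otimes>\<^sub>M lborel)"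
      unfolding h_def by measurable
    have P: "pair_sigma_finite (lborel :: real measure) (lborel :: 'a measure)" by unfold_locales
    have pos: "exp x + e > 0" for x using e by (simp add: add_pos_pos)
    have nh: "norm (h x t) = norm (mix x) * exp (- (exp x + e) * (norm t)\<^sup>2)" for x t
      by (simp add: h_def norm_mult algebra_simps)
    have int: "integrable (lborel \<Otimes>\<^sub>M lborel) (case_prod h)"
    proof (rule pair_sigma_finite.Fubini_integrable[OF P hm])
      \<comment> \<open>Absolute values destroy the oscillation and with it the factor exp (- R /
        v). For the interchange at fixed e > 0 the bound (pi / e)^D takes the place of M.\<close>
      have eq: "(LINT t|lborel. norm (case (x, t) of (x, t) \<Rightarrow> h x t)) = norm (mix x) * (pi / (exp x + e)) powr D" for x
        using gauss_integral(2)[OF pos, of x, where 'a = 'a] by (simp add: nh D_def)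
      show "integrable lborel (\<lambda>x. LINT t|lborel. norm (case (x, t) of (x, t) \<Rightarrow> h x t))"
        unfolding eq
      proof (rule Bochner_Integration.integrable_bound[OF ik])
        show "AE x in lborel. norm (norm (mix x) * (pi / (exp x + e)) powr D) \<le> norm (W * max ((pi / e) powr D) (pi powr D) * exp (- k * \<bar>x\<bar>))"
        proof (intro AE_I2)
          fix x
          have "norm (mix x) * (pi / (exp x + e)) powr D \<le> W * exp (\<alpha> * c / 2 * x) * (pi / (exp x + e)) powr D"
            by (intro mult_right_mono norm_mix_le[folded W_def]) auto
          also have "\<dots> = W * (exp (\<alpha> * c / 2 * x) * (pi / (exp x + e)) powr D)" by simp
          also have "\<dots> \<le> W * (max ((pi / e) powr D) (pi powr D) * exp (- k * \<bar>x\<bar>))"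
            using e D pos by (intro mult_left_mono two pw W powr_mono2 divide_left_mono) auto
          finally have "norm (mix x) * (pi / (exp x + e)) powr D \<le> W * max ((pi / e) powr D) (pi powr D) * exp (- k * \<bar>x\<bar>)"
            by (simp only: mult.assoc)
          thus "norm (norm (mix x) * (pi / (exp x + e)) powr D) \<le> norm (W * max ((pi / e) powr D) (pi powr D) * exp (- k * \<bar>x\<bar>))"
            unfolding real_norm_def by (subst abs_of_nonneg) (auto intro!: order_trans[OF _ abs_ge_self])
        qed
      qed measurable
      have "integrable lborel (\<lambda>t. h x t)" for x
        unfolding h_def using gauss_fourier(1)[OF pos, of "- y" x] by simp
      thus "AE x in lborel. integrable lborel (\<lambda>t. case (x, t) of (x, t) \<Rightarrow> h x t)" by simp
    qed
    have "(LINT t|lborel. LINT x|lborel. h x t) = (LINT x|lborel. LINT t|lborel. h x t)"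
      by (rule pair_sigma_finite.Fubini_integral[OF P int])
    moreover have "(LINT t|lborel. h x t) = mix x * of_real (g e x)" for x
      unfolding h_def using gauss_fourier(2)[OF pos, of "- y" x]
      by (simp add: g_def D_def R_def)
    moreover have "(LINT t|lborel. LINT x|lborel. h x t) =
      (LINT t|lborel. 2 * pi * Gamma \<nu> * (of_real ((1 + norm t powr \<alpha>) powr (- \<nu>)) * exp (- \<i> * of_real (y \<bullet> t) - e * (norm t)\<^sup>2)))"
    proof (rule integral_cong_AE)
      \<comment> \<open>\<open>mix_laplace\<close> needs |t|^2 > 0, so the origin is discarded as a
        null set.\<close>
      show "AE t in lborel. (LINT x|lborel. h x t) =
         2 * pi * Gamma \<nu> * (of_real ((1 + norm t powr \<alpha>) powr (- \<nu>)) * exp (- \<i> * of_real (y \<bullet> t) - e * (norm t)\<^sup>2))"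
        using AE_lborel_singleton[of "0::'a"]
      proof eventually_elim
        case (elim t)
        hence n: "(norm t)\<^sup>2 > 0" by simp
        have eq: "h x t = (mix x * of_real (exp (- (norm t)\<^sup>2 * exp x))) * exp (- \<i> * of_real (y \<bullet> t) - e * (norm t)\<^sup>2)" for x
          unfolding h_def exp_of_real[symmetric] mult.assoc exp_add[symmetric]
          by (simp add: inner_commute algebra_simps)
        have "((norm t)\<^sup>2) powr (\<alpha> / 2) = norm t powr \<alpha>"
          using n by (simp add: powr_powr flip: powr_numeral)
        thus ?case unfolding eq Bochner_Integration.integral_mult_left_zero mix_laplace[OF n]
          by (simp add: mult_ac)
      qed
      show "(\<lambda>t. LINT x|lborel. h x t) \<in> borel_measurable lborel"
        using hm by measurable
    qed measurable
    ultimately show ?thesis by simp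
  qed
  define X where "X = (\<lambda>k. inverse (real (Suc k)))"
  have X: "X \<longlonglongrightarrow> 0" "\<And>k. X k > 0"
    unfolding X_def by (auto intro: LIMSEQ_inverse_real_of_nat simp del: of_nat_Suc)
  have "(\<lambda>k. 2 * pi * Gamma \<nu> * (LINT t|lborel. of_real ((1 + norm t powr \<alpha>) powr (- \<nu>)) * exp (- \<i> * of_real (y \<bullet> t) - X k * (norm t)\<^sup>2)))
     \<longlonglongrightarrow> 2 * pi * Gamma \<nu> * ((2 * pi) ^ DIM('a) * f y)"
    using fourier_inversion_gauss[OF f y(1) X] unfolding char by (intro tendsto_mult tendsto_const)
  hence lim1: "(\<lambda>k. LINT x|lborel. mix x * of_real (g (X k) x)) \<longlonglongrightarrow> 2 * pi * Gamma \<nu> * ((2 * pi) ^ DIM('a) * f y)"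
    unfolding A[OF X(2)] .
  have lim2: "(\<lambda>k. LINT x|lborel. mix x * of_real (g (X k) x)) \<longlonglongrightarrow> (LINT x|lborel. mix x * of_real (g 0 x))"
  proof (rule integral_dominated_convergence[OF _ _ ik])
    show "AE x in lborel. (\<lambda>k. mix x * of_real (g (X k) x)) \<longlonglongrightarrow> mix x * of_real (g 0 x)"
      unfolding g_def by (intro AE_I2 tendsto_intros X) (auto simp: add_eq_0_iff)
    show "AE x in lborel. norm (mix x * of_real (g (X j) x)) \<le> W * max M (pi powr D) * exp (- k * \<bar>x\<bar>)" for j
    proof (intro AE_I2)
      fix x
      have "norm (mix x * of_real (g (X j) x)) = norm (mix x) * g (X j) x"
        using g0 by (simp add: norm_mult)
      also have "\<dots> \<le> W * exp (\<alpha> * c / 2 * x) * g (X j) x"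
        by (intro mult_right_mono norm_mix_le[folded W_def] g0)
      also have "\<dots> = W * (exp (\<alpha> * c / 2 * x) * g (X j) x)" by simp
      also have "\<dots> \<le> W * (max M (pi powr D) * exp (- k * \<bar>x\<bar>))"
        using less_imp_le[OF X(2)[of j]] by (intro mult_left_mono two g1 g2 M0 W)
      finally show "norm (mix x * of_real (g (X j) x)) \<le> W * max M (pi powr D) * exp (- k * \<bar>x\<bar>)" by simp
    qed
  qed measurable
  have "2 * pi * Gamma \<nu> * ((2 * pi) ^ DIM('a) * f y) = (LINT x|lborel. mix x * of_real (g 0 x))"
    by (rule LIMSEQ_unique[OF lim1 lim2])
  also have "\<dots> = (LINT t|lborel. mb_weight t * (LINT x|lborel. exp (of_real \<alpha> * Complex c t / 2 * of_real x) * of_real (g 0 x)))"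
  proof (rule mix_fubini)
    show "integrable lborel (\<lambda>x. exp (\<alpha> * c / 2 * x) * g 0 x)"
    proof (rule Bochner_Integration.integrable_bound[OF ik])
      show "AE x in lborel. norm (exp (\<alpha> * c / 2 * x) * g 0 x) \<le> norm (max M (pi powr D) * exp (- k * \<bar>x\<bar>))"
      proof (intro AE_I2)
        fix x
        have "exp (\<alpha> * c / 2 * x) * g 0 x \<le> max M (pi powr D) * exp (- k * \<bar>x\<bar>)"
          by (intro two g1 g2 M0) auto
        thus "norm (exp (\<alpha> * c / 2 * x) * g 0 x) \<le> norm (max M (pi powr D) * exp (- k * \<bar>x\<bar>))"
          unfolding real_norm_def using g0[of 0 x] by (subst abs_of_nonneg) (auto intro!: order_trans[OF _ abs_ge_self])
      qed
    qed measurable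
  qed (use g0 in auto)
  also have "\<dots> = (LINT t|lborel. pi powr D * mb_kernel \<alpha> \<nu> DIM('a) (ln (norm y / 2)) (Complex c t))"
  proof (intro Bochner_Integration.integral_cong refl)
    fix t
    define s where "s = Complex c t"
    define z where "z = (of_nat DIM('a) - of_real \<alpha> * s) / 2"
    have z: "Re z > 0" using acD by (simp add: z_def s_def D_def)
    \<comment> \<open>In \<open>g 0\<close> the variable occurs through exp (- x); reflecting x
      leads to the Gamma integral at z with rate R.\<close>
    define F where "F = (\<lambda>x::real. exp (z * of_real x - of_real (R * exp x)))"
    have eq: "exp (of_real \<alpha> * s / 2 * of_real x) * of_real (g 0 x) = pi powr D * F (0 + (-1) * x)" for x
    proof -
      have "g 0 x = pi powr D * (exp (- D * x) * exp (- (R * exp (- x))))"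
        by (simp add: g_def pe exp_minus[of x] inverse_eq_divide)
      also have "exp (- D * x) * exp (- (R * exp (- x))) = exp (- D * x - R * exp (- x))"
        by (simp flip: exp_add)
      finally have "exp (of_real \<alpha> * s / 2 * of_real x) * of_real (g 0 x) =
         pi powr D * (exp (of_real \<alpha> * s / 2 * of_real x) * exp (of_real (- D * x - R * exp (- x))))"
        by (simp add: mult_ac exp_of_real del: of_real_diff)
      also have "exp (of_real \<alpha> * s / 2 * of_real x) * exp (complex_of_real (- D * x - R * exp (- x))) = F (0 + (-1) * x)"
        unfolding F_def exp_add[symmetric] z_def D_def by (simp add: field_simps)
      finally show ?thesis .
    qed
    have "(LINT x|lborel. F (0 + (-1) * x)) = (LINT x|lborel. F x)"
      using lborel_integral_real_affine[of "-1" F 0] by simp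
    also have "\<dots> = Gamma z * exp (- z * of_real (ln R))"
      unfolding F_def by (rule Gamma_integral_exp(2)[OF z R])
    also have "ln R = 2 * ln (norm y / 2)"
    proof -
      have "R = (norm y / 2)\<^sup>2" by (simp add: R_def power_divide)
      thus ?thesis using y by (simp add: ln_realpow)
    qed
    finally have "(LINT x|lborel. F (0 + (-1) * x)) = Gamma z * exp (- z * of_real (2 * ln (norm y / 2)))" .
    hence "(LINT x|lborel. F (0 + (-1) * x)) = Gamma z * exp ((of_real \<alpha> * s - of_nat DIM('a)) * of_real (ln (norm y / 2)))"
    proof -
      have "- z * of_real (2 * ln (norm y / 2)) = (of_real \<alpha> * s - of_nat DIM('a)) * of_real (ln (norm y / 2))"
        by (simp add: z_def field_simps)
      thus ?thesis using \<open>(LINT x|lborel. F (0 + (-1) * x)) = Gamma z * exp (- z * of_real (2 * ln (norm y / 2)))\<close>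
        by (simp only:)
    qed
    hence "(LINT x|lborel. exp (of_real \<alpha> * s / 2 * of_real x) * of_real (g 0 x)) = pi powr D * (Gamma z * exp ((of_real \<alpha> * s - of_nat DIM('a)) * of_real (ln (norm y / 2))))"
      unfolding eq by simp
    thus "mb_weight t * (LINT x|lborel. exp (of_real \<alpha> * Complex c t / 2 * of_real x) * of_real (g 0 x))
       = pi powr D * mb_kernel \<alpha> \<nu> DIM('a) (ln (norm y / 2)) (Complex c t)"
      by (simp add: mb_weight_def mb_kernel_def s_def z_def mult_ac)
  qed
  finally show ?thesis by (simp add: D_def mult_ac)
qed

end

section \<open>Shifting vertical contours\<close>

text \<open>Split exp (- exp u) into two equal factors. One absorbs exp (b u) by
  \<open>Gamma_ge_powr\<close>; the other, by rescaling, leaves Gamma x times 2^x. The exponential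
  loss is harmless against superexponential decay.\<close>

lemma Gamma_add_le:
  fixes x b :: real
  assumes x: "x > 0" and b: "b \<ge> 0"
  shows "Gamma (x + b) \<le> Gamma (b + 1) * 2 powr (x + b) * Gamma x"
proof -
  have "Gamma (x + b) = (LINT u|lborel. exp ((x + b) * u - 1 * exp u))"
    using Gamma_integral_exp_real(2)[of "x + b" 1] assms by simp
  also have "\<dots> \<le> (LINT u|lborel. (2 powr b * Gamma (b + 1)) * exp (x * u - 1/2 * exp u))"
  proof (rule integral_mono)
    show "integrable lborel (\<lambda>u. exp ((x + b) * u - 1 * exp u))"
      using assms by (intro Gamma_integral_exp_real(1)) auto
    show "integrable lborel (\<lambda>u. (2 powr b * Gamma (b + 1)) * exp (x * u - 1/2 * exp u))"
      using assms by (intro integrable_mult_right Gamma_integral_exp_real(1)) auto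
    fix u
    have "(exp u / 2) powr b * exp (- (exp u / 2)) \<le> Gamma (b + 1)"
      using b by (intro Gamma_ge_powr) auto
    moreover have "(exp u / 2) powr b = exp (b * u) / 2 powr b"
      by (simp add: powr_divide exp_powr_real mult.commute)
    ultimately have "exp (b * u) * exp (- (exp u / 2)) \<le> 2 powr b * Gamma (b + 1)"
      by (simp add: field_simps)
    hence A: "(exp (b * u) * exp (- (exp u / 2))) * exp (x * u - 1/2 * exp u) \<le> (2 powr b * Gamma (b + 1)) * exp (x * u - 1/2 * exp u)"
      by (intro mult_right_mono) auto
    have B: "(exp (b * u) * exp (- (exp u / 2))) * exp (x * u - 1/2 * exp u) = exp ((x + b) * u - 1 * exp u)"
      unfolding exp_add[symmetric] by (simp add: algebra_simps)
    show "exp ((x + b) * u - 1 * exp u) \<le> (2 powr b * Gamma (b + 1)) * exp (x * u - 1/2 * exp u)"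
      using A unfolding B .
  qed
  also have "\<dots> = 2 powr b * Gamma (b + 1) * (Gamma x * exp (- x * ln (1/2)))"
    using Gamma_integral_exp_real(2)[of x "1/2"] x by simp
  also have "exp (- x * ln (1/2)) = 2 powr x"
    by (simp add: powr_def ln_div)
  finally show ?thesis by (simp add: powr_add mult_ac)
qed

text \<open>What is left of the kernel at a real point once reflection has replaced both Gamma
  factors with poles by reciprocal ones. It majorises the kernel on distant lines as well as the
  coefficients of all four series.\<close>

definition gamma_quotient :: "real \<Rightarrow> real \<Rightarrow> nat \<Rightarrow> real \<Rightarrow> real" where
  "gamma_quotient \<alpha> \<nu> n x = Gamma x * rGamma (1 - \<nu> + x) * rGamma (\<alpha> * x / 2) * rGamma (1 - real n / 2 + \<alpha> * x / 2)"

text \<open>The first two factors together grow at most like 2^x, the third is bounded, and the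
  fourth decays faster than any exponential because \<alpha> > 0. A compact interval is left to
  continuity.\<close>

lemma gamma_quotient_superexp:
  assumes \<alpha>: "\<alpha> > 0" and \<nu>: "\<nu> > 0" and x0: "x0 > 0" and K: "K \<ge> 1"
  obtains C where "C \<ge> 0" "\<And>x. x \<ge> x0 \<Longrightarrow> \<bar>gamma_quotient \<alpha> \<nu> n x\<bar> * K powr x \<le> C"
proof -
  \<comment> \<open>Beyond \<open>x1\<close> one has x at least \<nu> + 1, \<alpha> x / 2 at least
    1/2 for \<open>rGamma_real_le\<close>, and \<alpha> x at least n for
    \<open>Gamma_ge_powr\<close>.\<close>
  define x1 where "x1 = max (max x0 (\<nu> + 1)) (max (1 / \<alpha>) (real n / \<alpha>))"
  \<comment> \<open>The base for which M^(\<alpha> x / 2) = (2 K)^x: the 2 cancels the growth 2^x of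
    the first two factors and K^x is the asserted decay.\<close>
  define M where "M = (2 * K) powr (2 / \<alpha>)"
  have M: "M > 0" "M powr (\<alpha> / 2) = 2 * K" using K \<alpha> by (simp_all add: M_def powr_powr)
  define C1 where "C1 = Gamma (\<nu> + 1) * exp 1 * (exp M * M powr (real n / 2))"
  have large: "\<bar>gamma_quotient \<alpha> \<nu> n x\<bar> * K powr x \<le> C1" if "x \<ge> x1" for x
  proof -
    have x: "x \<ge> \<nu> + 1" "\<alpha> * x \<ge> 1" "\<alpha> * x \<ge> real n"
      using that \<alpha> by (auto simp: x1_def field_simps)
    have 1: "Gamma x * rGamma (1 - \<nu> + x) \<le> Gamma (\<nu> + 1) * 2 powr x"
    proof -
      have g: "Gamma (x - \<nu>) > 0" "Gamma (1 - \<nu> + x) > 0" using x by (auto intro!: Gamma_real_pos)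
      have "x - \<nu> \<notin> \<int>\<^sub>\<le>\<^sub>0" using x by (auto elim!: nonpos_Ints_cases)
      hence "Gamma (1 - \<nu> + x) = (x - \<nu>) * Gamma (x - \<nu>)"
        using Gamma_plus1[of "x - \<nu>"] x by (simp add: algebra_simps)
      moreover have "1 * Gamma (x - \<nu>) \<le> (x - \<nu>) * Gamma (x - \<nu>)"
        using x g by (intro mult_right_mono) auto
      ultimately have le: "Gamma (x - \<nu>) \<le> Gamma (1 - \<nu> + x)" by simp
      have "Gamma x \<le> Gamma (\<nu> + 1) * 2 powr x * Gamma (x - \<nu>)"
        using Gamma_add_le[of "x - \<nu>" \<nu>] x \<nu> by simp
      also have "\<dots> \<le> Gamma (\<nu> + 1) * 2 powr x * Gamma (1 - \<nu> + x)"
        using \<nu> by (intro mult_left_mono le mult_nonneg_nonneg less_imp_le[OF Gamma_real_pos]) auto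
      finally show ?thesis using g by (simp add: rGamma_inverse_Gamma field_simps)
    qed
    have 2: "rGamma (\<alpha> * x / 2) \<le> exp 1" using x by (intro rGamma_real_le) auto
    have 3: "rGamma (1 - real n / 2 + \<alpha> * x / 2) \<le> exp M * M powr (real n / 2) / (2 * K) powr x"
    proof -
      define y where "y = \<alpha> * x / 2 - real n / 2"
      have y: "y \<ge> 0" using x by (simp add: y_def)
      have "M powr y * exp (- M) \<le> Gamma (y + 1)" by (intro Gamma_ge_powr M y)
      hence "inverse (Gamma (y + 1)) \<le> inverse (M powr y * exp (- M))"
        using M by (intro le_imp_inverse_le) auto
      also have "M powr y = (2 * K) powr x / M powr (real n / 2)"
      proof -
        have "(2 * K) powr x = M powr (\<alpha> * x / 2)" unfolding M(2)[symmetric] powr_powr by simp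
        thus ?thesis by (simp add: y_def powr_diff)
      qed
      finally show ?thesis by (simp add: rGamma_inverse_Gamma y_def exp_minus field_simps)
    qed
    have p: "Gamma x \<ge> 0" "rGamma (1 - \<nu> + x) \<ge> 0" "rGamma (\<alpha> * x / 2) \<ge> 0" "rGamma (1 - real n / 2 + \<alpha> * x / 2) \<ge> 0"
      using x \<nu> \<alpha> by (auto simp: rGamma_inverse_Gamma intro!: less_imp_le[OF Gamma_real_pos])
    have "\<bar>gamma_quotient \<alpha> \<nu> n x\<bar> = (Gamma x * rGamma (1 - \<nu> + x)) * rGamma (\<alpha> * x / 2) * rGamma (1 - real n / 2 + \<alpha> * x / 2)"
      using p by (simp add: gamma_quotient_def abs_mult)
    also have "\<dots> \<le> (Gamma (\<nu> + 1) * 2 powr x) * exp 1 * (exp M * M powr (real n / 2) / (2 * K) powr x)"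
      using p \<nu> by (intro mult_mono 1 2 3) (auto intro!: mult_nonneg_nonneg less_imp_le[OF Gamma_real_pos])
    also have "\<dots> = C1 / K powr x"
      using K by (simp add: C1_def powr_mult)
    finally show ?thesis using K by (simp add: field_simps)
  qed
  have "continuous_on {x0..x1} (\<lambda>x. gamma_quotient \<alpha> \<nu> n x * K powr x)"
    unfolding gamma_quotient_def using x0 K
    by (intro continuous_intros continuous_on_compose2[OF continuous_on_rGamma[of UNIV]]) (auto elim!: nonpos_Ints_cases)
  hence "bounded ((\<lambda>x. gamma_quotient \<alpha> \<nu> n x * K powr x) ` {x0..x1})"
    by (intro compact_imp_bounded compact_continuous_image) auto
  then obtain C2 where C2: "\<forall>x\<in>{x0..x1}. \<bar>gamma_quotient \<alpha> \<nu> n x * K powr x\<bar> \<le> C2"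
    unfolding bounded_iff by auto
  show ?thesis
  proof
    show "max 0 (max C1 C2) \<ge> 0" by simp
    show "\<bar>gamma_quotient \<alpha> \<nu> n x\<bar> * K powr x \<le> max 0 (max C1 C2)" if "x \<ge> x0" for x
      using large[of x] bspec[OF C2, of x] that by (cases "x \<ge> x1") (auto simp: abs_mult)
  qed
qed

text \<open>Links the gauge integrals produced by contour segments with the Lebesgue integral over
  the line.\<close>

lemma tendsto_truncated_integral:
  fixes F :: "real \<Rightarrow> complex"
  assumes F: "integrable lborel F"
  shows "(\<lambda>k. integral {- real k..real k} F) \<longlonglongrightarrow> (LINT t|lborel. F t)"
proof -
  have [measurable]: "F \<in> borel_measurable borel" using F by (auto dest: borel_measurable_integrable)
  have eq: "integral {- real k..real k} F = (LINT t|lborel. indicator {- real k..real k} t *\<^sub>R F t)" for k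
  proof -
    have "set_integrable lborel {- real k..real k} F"
      unfolding set_integrable_def using F by (intro integrable_mult_indicator) auto
    thus ?thesis using set_borel_integral_eq_integral(2) by (metis set_lebesgue_integral_def)
  qed
  show ?thesis unfolding eq
  proof (rule integral_dominated_convergence)
    show "integrable lborel (\<lambda>t. norm (F t))" using F by simp
    show "AE t in lborel. (\<lambda>k. indicator {- real k..real k} t *\<^sub>R F t) \<longlonglongrightarrow> F t"
    proof (intro AE_I2 tendsto_eventually)
      fix t :: real
      show "\<forall>\<^sub>F k in sequentially. indicator {- real k..real k} t *\<^sub>R F t = F t"
        using eventually_ge_at_top[of "nat \<lceil>\<bar>t\<bar>\<rceil>"]
        by eventually_elim (auto simp: indicator_def abs_le_iff; linarith)
    qed
  qed (auto intro!: AE_I2 simp: indicator_def)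
qed

text \<open>Residue theorem on rectangles of height 2 k, with horizontal sides that vanish as k
  grows. Since the poles are real, every rectangle contains all those between the two lines.
  \<open>pts\<close> may also hold poles of S outside the strip; these have winding number
  0.\<close>

lemma vertical_contour_shift:
  fixes f :: "complex \<Rightarrow> complex" and a b :: real
  assumes ab: "a < b" and S: "open S" "connected S" "{z. a \<le> Re z \<and> Re z \<le> b} \<subseteq> S"
    and pts: "finite pts" "\<And>p. p \<in> pts \<Longrightarrow> Im p = 0 \<and> Re p \<noteq> a \<and> Re p \<noteq> b"
    and holo: "f holomorphic_on S - pts"
    and int: "integrable lborel (\<lambda>t. f (Complex a t))" "integrable lborel (\<lambda>t. f (Complex b t))"
    and hor: "\<And>x t. a \<le> x \<Longrightarrow> x \<le> b \<Longrightarrow> \<bar>t\<bar> \<ge> tmin \<Longrightarrow> norm (f (Complex x t)) \<le> g \<bar>t\<bar>"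
    and g: "(g \<longlongrightarrow> 0) at_top"
  shows "(LINT t|lborel. f (Complex b t)) - (LINT t|lborel. f (Complex a t))
     = 2 * pi * (\<Sum>p\<in>{p\<in>pts. a < Re p \<and> Re p < b}. residue f p)"
proof -
  define R where "R = (\<Sum>p\<in>{p\<in>pts. a < Re p \<and> Re p < b}. residue f p)"
  define J where "J = (\<lambda>x k. integral {- real k..real k} (\<lambda>t. f (Complex x t)))"
  have cont: "continuous_on A f" if "A \<subseteq> S - pts" for A
    using holomorphic_on_imp_continuous_on[OF holo] that continuous_on_subset by blast
  have bound: "norm (J b k - J a k - 2 * pi * R) \<le> 2 * (g (real k) * (b - a))"
    if k: "real k \<ge> tmin" "k > 0" for k
  proof -
    define T where "T = real k"
    have T: "T \<ge> tmin" "T > 0" using k by (auto simp: T_def)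
    define z1 z2 z3 z4 where "z1 = Complex a (-T)" and "z2 = Complex b (-T)" and "z3 = Complex b T" and "z4 = Complex a T"
    note zd = z1_def z2_def z3_def z4_def
    have rp: "rectpath z1 z3 = linepath z1 z2 +++ linepath z2 z3 +++ linepath z3 z4 +++ linepath z4 z1"
      by (simp add: rectpath_def zd Let_def)
    have img: "path_image (rectpath z1 z3) \<subseteq> S - pts"
    proof -
      have "path_image (rectpath z1 z3) = cbox z1 z3 - box z1 z3"
        using ab T by (intro path_image_rectpath_cbox_minus_box) (auto simp: zd)
      moreover have "cbox z1 z3 \<subseteq> S" using S(3) by (auto simp: in_cbox_complex_iff zd)
      \<comment> \<open>A real pole with real part different from a and b cannot lie on the boundary
        of a rectangle with T > 0.\<close>
      moreover have "p \<in> box z1 z3 \<or> p \<notin> cbox z1 z3" if "p \<in> pts" for p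
        using pts(2)[OF that] T by (auto simp: in_cbox_complex_iff in_box_complex_iff zd)
      ultimately show ?thesis by blast
    qed
    hence segs: "closed_segment z1 z2 \<subseteq> S - pts" "closed_segment z2 z3 \<subseteq> S - pts"
       "closed_segment z3 z4 \<subseteq> S - pts" "closed_segment z4 z1 \<subseteq> S - pts"
      by (auto simp: rp path_image_join)
    have ci: "f contour_integrable_on linepath z1 z2" "f contour_integrable_on linepath z2 z3"
       "f contour_integrable_on linepath z3 z4" "f contour_integrable_on linepath z4 z1"
      by (intro contour_integrable_continuous_linepath cont segs)+
    have "contour_integral (rectpath z1 z3) f = 2 * pi * \<i> * (\<Sum>p\<in>pts. winding_number (rectpath z1 z3) p * residue f p)"
    proof (rule Residue_theorem[OF S(1,2) pts(1) holo _ _ img])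
      show "\<forall>z. z \<notin> S \<longrightarrow> winding_number (rectpath z1 z3) z = 0"
      proof (intro allI impI winding_number_rectpath_outside)
        fix z assume "z \<notin> S"
        thus "z \<notin> cbox z1 z3" using S(3) by (auto simp: in_cbox_complex_iff zd)
      qed (use ab T in \<open>auto simp: zd\<close>)
    qed auto
    also have "(\<Sum>p\<in>pts. winding_number (rectpath z1 z3) p * residue f p) = R"
      unfolding R_def
    proof (rule sum.mono_neutral_cong_right[OF pts(1)])
      show "\<forall>p\<in>pts - {p\<in>pts. a < Re p \<and> Re p < b}. winding_number (rectpath z1 z3) p * residue f p = 0"
      proof
        fix p assume "p \<in> pts - {p\<in>pts. a < Re p \<and> Re p < b}"
        hence "p \<notin> cbox z1 z3" using pts(2)[of p] by (auto simp: in_cbox_complex_iff zd)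
        hence "winding_number (rectpath z1 z3) p = 0"
          using ab T by (intro winding_number_rectpath_outside) (auto simp: zd)
        thus "winding_number (rectpath z1 z3) p * residue f p = 0" by simp
      qed
      fix p assume "p \<in> {p\<in>pts. a < Re p \<and> Re p < b}"
      hence "p \<in> box z1 z3" using pts(2)[of p] T by (auto simp: in_box_complex_iff zd)
      thus "winding_number (rectpath z1 z3) p * residue f p = residue f p"
        by (simp add: winding_number_rectpath)
    qed auto
    also have "contour_integral (rectpath z1 z3) f = contour_integral (linepath z1 z2) f + contour_integral (linepath z2 z3) f
        + contour_integral (linepath z3 z4) f + contour_integral (linepath z4 z1) f"
      unfolding rp using ci by (simp add: contour_integrable_joinI)
    also have "contour_integral (linepath z2 z3) f = \<i> * J b k"
      unfolding J_def using T by (intro contour_integral_linepath_same_Re) (auto simp: zd T_def)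
    also have "contour_integral (linepath z4 z1) f = - (\<i> * J a k)"
    proof -
      have "contour_integral (linepath z1 z4) f = \<i> * J a k"
        unfolding J_def using T by (intro contour_integral_linepath_same_Re) (auto simp: zd T_def)
      moreover have "continuous_on (closed_segment z1 z4) f"
        using cont[OF segs(4)] by (simp add: closed_segment_commute)
      ultimately show ?thesis using contour_integral_reverse_linepath[of z1 z4 f] by (metis minus_minus)
    qed
    \<comment> \<open>The vertical sides contribute a factor i through dz = i dt, which turns the
      usual 2 pi i into 2 pi.\<close>
    finally have eq: "\<i> * (J b k - J a k - 2 * pi * R) = - (contour_integral (linepath z1 z2) f + contour_integral (linepath z3 z4) f)"
      by (simp add: algebra_simps)
    have g0: "g T \<ge> 0" using hor[of a T] T ab by (auto intro: order_trans[OF norm_ge_zero])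
    have "norm (contour_integral (linepath z1 z2) f) \<le> g T * norm (z2 - z1)"
    proof (rule contour_integral_bound_linepath[OF ci(1) g0])
      fix x assume "x \<in> closed_segment z1 z2"
      hence "x = Complex (Re x) (-T)" "a \<le> Re x" "Re x \<le> b"
        using ab by (auto simp: zd closed_segment_same_Im closed_segment_eq_real_ivl complex_eq_iff)
      thus "norm (f x) \<le> g T" using hor[of "Re x" "-T"] T by simp
    qed
    moreover have "norm (contour_integral (linepath z3 z4) f) \<le> g T * norm (z4 - z3)"
    proof (rule contour_integral_bound_linepath[OF ci(3) g0])
      fix x assume "x \<in> closed_segment z3 z4"
      hence "x = Complex (Re x) T" "a \<le> Re x" "Re x \<le> b"
        using ab by (auto simp: zd closed_segment_same_Im closed_segment_eq_real_ivl complex_eq_iff)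
      thus "norm (f x) \<le> g T" using hor[of "Re x" T] T by simp
    qed
    moreover have "norm (z2 - z1) = b - a" "norm (z4 - z3) = b - a"
      using ab by (auto simp: zd cmod_def)
    moreover have "norm (J b k - J a k - 2 * pi * R) = norm (\<i> * (J b k - J a k - 2 * pi * R))"
      by (simp add: norm_mult)
    ultimately show ?thesis unfolding eq norm_minus_cancel
      using norm_triangle_ineq[of "contour_integral (linepath z1 z2) f" "contour_integral (linepath z3 z4) f"]
      by (simp add: T_def)
  qed
  have "(\<lambda>k. J b k - J a k - 2 * pi * R) \<longlonglongrightarrow> 0"
  proof (rule Lim_null_comparison)
    show "\<forall>\<^sub>F k in sequentially. norm (J b k - J a k - 2 * pi * R) \<le> 2 * (g (real k) * (b - a))"
      using eventually_ge_at_top[of "nat \<lceil>tmin\<rceil>"] eventually_gt_at_top[of 0]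
      by eventually_elim (rule bound, linarith+)
    have "(\<lambda>k. g (real k)) \<longlonglongrightarrow> 0"
      by (rule filterlim_compose[OF g filterlim_real_sequentially])
    thus "(\<lambda>k. 2 * (g (real k) * (b - a))) \<longlonglongrightarrow> 0"
      by (intro tendsto_mult_right_zero tendsto_mult_left_zero)
  qed
  moreover have "(\<lambda>k. J b k - J a k - 2 * pi * R) \<longlonglongrightarrow> (LINT t|lborel. f (Complex b t)) - (LINT t|lborel. f (Complex a t)) - 2 * pi * R"
    unfolding J_def by (intro tendsto_intros tendsto_truncated_integral int)
  ultimately have "(LINT t|lborel. f (Complex b t)) - (LINT t|lborel. f (Complex a t)) - 2 * pi * R = 0"
    using LIMSEQ_unique by blast
  thus ?thesis by (simp add: R_def)
qed

section \<open>The Mellin--Barnes kernel\<close>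

text \<open>Reflection in multiplied form, which stays true at the poles because Gamma has the value
  0 there.\<close>

lemma norm_Gamma_mult_sin_le:
  fixes z :: complex
  shows "norm (Gamma z) * norm (sin (of_real pi * z)) \<le> pi * norm (rGamma (1 - z))"
proof (cases "rGamma z = 0")
  case True
  thus ?thesis by (simp add: Gamma_def)
next
  case False
  have "sin (of_real pi * z) = of_real pi * (rGamma z * rGamma (1 - z))"
    by (simp add: rGamma_reflection_complex)
  hence "Gamma z * sin (of_real pi * z) = of_real pi * rGamma (1 - z)"
    using False by (simp add: Gamma_def)
  hence "norm (Gamma z * sin (of_real pi * z)) = norm (of_real pi * rGamma (1 - z))" by (rule arg_cong)
  thus ?thesis by (simp add: norm_mult)
qed

lemma exp_le_sinh: "exp \<bar>y\<bar> / 4 \<le> \<bar>sinh y\<bar>" if "\<bar>y\<bar> \<ge> 1" for y :: real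
proof -
  define u where "u = \<bar>y\<bar>"
  have u: "u \<ge> 1" using that by (simp add: u_def)
  have "1 \<le> exp u" using u by simp
  moreover have "2 \<le> exp u" using exp_ge_add_one_self[of u] u by linarith
  ultimately have "1 * 2 \<le> exp u * exp u" by (intro mult_mono) auto
  hence "exp (-u) \<le> exp u / 2" by (simp add: exp_minus field_simps)
  hence "exp u / 4 \<le> sinh u" by (simp add: sinh_def)
  also have "sinh u \<le> \<bar>sinh y\<bar>" by (auto simp: u_def abs_if)
  finally show ?thesis by (simp add: u_def)
qed

lemma le_divide_of_mult_bounds:
  fixes g p q s t1 t2 :: real
  assumes "g * p * q \<le> B" "g \<ge> 0" "u > 0" "v > 0" "u \<le> p" "v \<le> q"
  shows "g \<le> B / (u * v)"
proof -
  have "g * (u * v) \<le> g * (p * q)"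
    using assms by (intro mult_left_mono mult_mono) auto
  also have "\<dots> \<le> B" using assms by (simp add: mult.assoc)
  finally show ?thesis using assms by (simp add: pos_le_divide_eq)
qed

text \<open>The poles in the right half plane, from Gamma (\<nu> - s) and from Gamma ((n - \<alpha>
  s) / 2). A point of both progressions is one element of the set, with a double pole.\<close>

definition mb_poles :: "real \<Rightarrow> real \<Rightarrow> nat \<Rightarrow> real set" where
  "mb_poles \<alpha> \<nu> n = range (\<lambda>l. \<nu> + real l) \<union> range (\<lambda>j. (real n + 2 * real j) / \<alpha>)"

text \<open>By the reflection formula the poles of the kernel are zeros of these two sines; their moduli
  at real points enter the lower bounds on vertical lines.\<close>

definition sin1 :: "real \<Rightarrow> complex \<Rightarrow> complex" where
  "sin1 \<nu> s = sin (of_real pi * (of_real \<nu> - s))"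

definition sin2 :: "real \<Rightarrow> nat \<Rightarrow> complex \<Rightarrow> complex" where
  "sin2 \<alpha> n s = sin (of_real pi * ((of_nat n - of_real \<alpha> * s) / 2))"

definition abs_sin1 :: "real \<Rightarrow> real \<Rightarrow> real" where
  "abs_sin1 \<nu> x = \<bar>sin (pi * (\<nu> - x))\<bar>"

definition abs_sin2 :: "real \<Rightarrow> nat \<Rightarrow> real \<Rightarrow> real" where
  "abs_sin2 \<alpha> n x = \<bar>sin (pi * ((real n - \<alpha> * x) / 2))\<bar>"

context
  fixes \<alpha> \<nu> L :: real and n :: nat
  assumes \<alpha>: "0 < \<alpha>" "\<alpha> \<le> 2" and \<nu>: "0 < \<nu>" and n: "n > 0"
begin

private abbreviation "G \<equiv> mb_kernel \<alpha> \<nu> n L"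


section \<open>Bounds for the kernel on vertical lines and horizontal segments\<close>

lemma norm_sin1_ge: "abs_sin1 \<nu> x * exp (pi * \<bar>t\<bar>) / 2 \<le> norm (sin1 \<nu> (Complex x t))"
  using norm_sin_ge_exp[of "of_real pi * (of_real \<nu> - Complex x t)"]
  by (simp add: sin1_def abs_sin1_def abs_mult)

lemma norm_sin2_ge: "abs_sin2 \<alpha> n x * exp (pi * \<alpha> / 2 * \<bar>t\<bar>) / 2 \<le> norm (sin2 \<alpha> n (Complex x t))"
proof -
  define w where "w = of_real pi * ((of_nat n - of_real \<alpha> * Complex x t) / 2)"
  have "Re w = pi * ((real n - \<alpha> * x) / 2)" "Im w = - (pi * \<alpha> / 2 * t)" by (simp_all add: w_def)
  thus ?thesis using norm_sin_ge_exp[of w] \<alpha> by (simp add: sin2_def abs_sin2_def abs_mult w_def mult.assoc)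
qed

text \<open>Independent of x, hence usable on segments that pass above or below poles; the price is
  a lower bound on |t|.\<close>

lemma norm_sin1_ge': "exp (pi * \<bar>t\<bar>) / 4 \<le> norm (sin1 \<nu> (Complex x t))" if "pi * \<bar>t\<bar> \<ge> 1"
proof -
  define w where "w = of_real pi * (of_real \<nu> - Complex x t)"
  have im: "Im w = - (pi * t)" by (simp add: w_def)
  have "exp \<bar>Im w\<bar> / 4 \<le> \<bar>sinh (Im w)\<bar>" by (rule exp_le_sinh) (use that in \<open>simp add: im abs_mult\<close>)
  also have "\<dots> \<le> norm (sin w)" by (rule norm_sin_ge_sinh)
  finally show ?thesis by (simp add: im abs_mult sin1_def w_def)
qed

lemma norm_sin2_ge': "exp (pi * \<alpha> / 2 * \<bar>t\<bar>) / 4 \<le> norm (sin2 \<alpha> n (Complex x t))" if "pi * \<alpha> / 2 * \<bar>t\<bar> \<ge> 1"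
proof -
  define w where "w = of_real pi * ((of_nat n - of_real \<alpha> * Complex x t) / 2)"
  have im: "Im w = - (pi * \<alpha> / 2 * t)" by (simp add: w_def)
  have "exp \<bar>Im w\<bar> / 4 \<le> \<bar>sinh (Im w)\<bar>" by (rule exp_le_sinh) (use that \<alpha> in \<open>simp add: im abs_mult\<close>)
  also have "\<dots> \<le> norm (sin w)" by (rule norm_sin_ge_sinh)
  finally show ?thesis using \<alpha> by (simp add: im abs_mult sin2_def w_def mult.assoc)
qed

lemma norm_mb_kernel_mult_sin_le:
  "norm (G s) * norm (sin1 \<nu> s) * norm (sin2 \<alpha> n s) \<le> pi\<^sup>2 * norm (Gamma s) * norm (rGamma (of_real (1 - \<nu>) + s))
     * norm (rGamma (of_real \<alpha> * s / 2)) * norm (rGamma (of_real (1 - real n / 2) + of_real \<alpha> * s / 2)) * exp ((\<alpha> * Re s - real n) * L)"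
proof -
  define w where "w = (of_nat n - of_real \<alpha> * s) / 2"
  have 1: "norm (Gamma (of_real \<nu> - s)) * norm (sin1 \<nu> s) \<le> pi * norm (rGamma (of_real (1 - \<nu>) + s))"
    using norm_Gamma_mult_sin_le[of "of_real \<nu> - s"] by (simp add: sin1_def algebra_simps)
  have e: "1 - w = of_real (1 - real n / 2) + of_real \<alpha> * s / 2" by (simp add: w_def field_simps)
  have 2: "norm (Gamma w) * norm (sin2 \<alpha> n s) \<le> pi * norm (rGamma (of_real (1 - real n / 2) + of_real \<alpha> * s / 2))"
    using norm_Gamma_mult_sin_le[of w] unfolding e sin2_def w_def[symmetric] .
  define E where "E = exp ((\<alpha> * Re s - real n) * L)"
  have nG: "norm (G s) = norm (Gamma s) * norm (Gamma (of_real \<nu> - s)) * norm (rGamma (of_real \<alpha> * s / 2)) * norm (Gamma w) * E"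
    by (simp add: mb_kernel_def norm_mult w_def E_def)
  have "norm (G s) * norm (sin1 \<nu> s) * norm (sin2 \<alpha> n s) = (norm (Gamma s) * norm (rGamma (of_real \<alpha> * s / 2)) * E)
     * ((norm (Gamma (of_real \<nu> - s)) * norm (sin1 \<nu> s)) * (norm (Gamma w) * norm (sin2 \<alpha> n s)))"
    by (simp add: nG)
  also have "\<dots> \<le> (norm (Gamma s) * norm (rGamma (of_real \<alpha> * s / 2)) * E)
     * ((pi * norm (rGamma (of_real (1 - \<nu>) + s))) * (pi * norm (rGamma (of_real (1 - real n / 2) + of_real \<alpha> * s / 2))))"
    by (intro mult_left_mono mult_mono 1 2) (auto simp: E_def)
  finally show ?thesis by (simp add: E_def power2_eq_square mult_ac)
qed

text \<open>The shifted first reciprocal Gamma contributes the rate pi / 2, the other two pi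
  \<alpha> / 4 each, and the polynomial factors are absorbed by a further pi / 4. The total stays pi
  / 4 below the rate of the two sines.\<close>

lemma mb_kernel_strip_bound:
  assumes ab: "0 < a" "a \<le> b"
  obtains C where "C \<ge> 0" "\<And>x t. a \<le> x \<Longrightarrow> x \<le> b \<Longrightarrow> norm (G (Complex x t)) * norm (sin1 \<nu> (Complex x t)) * norm (sin2 \<alpha> n (Complex x t))
      \<le> C * exp ((3 * pi / 4 + pi * \<alpha> / 2) * \<bar>t\<bar>)"
proof -
  \<comment> \<open>One shift m that lifts the real parts of all three reciprocal Gamma arguments to
    at least 1/2, as \<open>norm_rGamma_le\<close> requires.\<close>
  obtain m :: nat where m: "real m \<ge> 1 + \<nu> + real n" using real_arch_simple by blast
  define A where "A = 1 + \<nu> + real n + b + real m"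
  have A: "A > 0" using ab \<nu> by (simp add: A_def add_pos_nonneg)
  have "continuous_on {a..b} (Gamma :: real \<Rightarrow> real)"
    using ab by (intro continuous_intros) (auto elim!: nonpos_Ints_cases)
  hence "bounded (Gamma ` {a..b})" by (intro compact_imp_bounded compact_continuous_image) auto
  then obtain C0 where C0: "\<forall>x\<in>{a..b}. \<bar>Gamma x :: real\<bar> \<le> C0"
    unfolding bounded_iff by auto
  have "\<bar>Gamma a\<bar> \<le> C0" using C0 ab by simp
  hence C00: "C0 \<ge> 0" by (rule order_trans[OF abs_ge_zero])
  \<comment> \<open>\<open>Gamma_ge_powr\<close> with M = (pi / 4) (A + |t|), read as the bound M^(3
    m) at most (3 m)! exp M.\<close>
  define F where "F = (4 / pi) powr (3 * m) * fact (3 * m) * exp (pi / 4 * A)"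
  have poly: "(A + \<bar>t\<bar>) ^ (3 * m) \<le> F * exp (pi / 4 * \<bar>t\<bar>)" for t
  proof -
    define M where "M = pi / 4 * (A + \<bar>t\<bar>)"
    have M: "M > 0" using A by (auto simp: M_def intro!: mult_pos_pos)
    have "M powr real (3 * m) * exp (- M) \<le> Gamma (real (3 * m) + 1)"
      by (rule Gamma_ge_powr[OF M]) simp
    also have "\<dots> = fact (3 * m)" using Gamma_fact[of "3 * m", where 'a = real] by (simp add: add.commute)
    finally have "M powr real (3 * m) \<le> fact (3 * m) * exp M" by (simp add: exp_minus field_simps)
    moreover have "(A + \<bar>t\<bar>) ^ (3 * m) = (4 / pi) powr (3 * m) * M powr real (3 * m)"
    proof -
      have "A + \<bar>t\<bar> = 4 / pi * M" by (simp add: M_def)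
      hence "(A + \<bar>t\<bar>) ^ (3 * m) = (4 / pi * M) ^ (3 * m)" by (rule arg_cong)
      also have "\<dots> = (4 / pi * M) powr real (3 * m)" using M by (intro powr_realpow[symmetric]) auto
      finally show ?thesis by (simp only: powr_mult)
    qed
    moreover have "exp M = exp (pi / 4 * A) * exp (pi / 4 * \<bar>t\<bar>)" by (simp add: M_def algebra_simps flip: exp_add)
    ultimately show ?thesis by (simp add: F_def mult.assoc mult_left_mono)
  qed
  have rg: "norm (rGamma w) \<le> exp 1 * (A + \<bar>t\<bar>) ^ m * exp (pi * \<bar>Im w\<bar> / 2)"
    if "Re w \<ge> 1 - \<nu> - real n" "\<bar>Re w\<bar> \<le> 1 + \<nu> + real n + b" "\<bar>Im w\<bar> \<le> \<bar>t\<bar>" for w t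
  proof -
    have "norm (rGamma w) \<le> exp 1 * (norm w + m) ^ m * exp (pi * \<bar>Im w\<bar> / 2)"
      using that m by (intro norm_rGamma_le) auto
    also have "\<dots> \<le> exp 1 * (A + \<bar>t\<bar>) ^ m * exp (pi * \<bar>Im w\<bar> / 2)"
      using that cmod_le[of w] by (intro mult_right_mono mult_left_mono power_mono) (auto simp: A_def)
    finally show ?thesis .
  qed
  define C where "C = pi\<^sup>2 * C0 * exp 1 * exp 1 * exp 1 * F * exp ((\<alpha> * b + real n) * \<bar>L\<bar>)"
  show ?thesis
  proof
    show "C \<ge> 0" using C00 by (simp add: C_def F_def)
    fix x t assume x: "a \<le> x" "x \<le> b"
    define s where "s = Complex x t"
    have ax: "\<alpha> * x \<le> 2 * b" using x \<alpha> ab by (intro mult_mono) auto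
    have ax0: "\<alpha> * x \<ge> 0" using x \<alpha> ab by simp
    have at: "\<alpha> * \<bar>t\<bar> \<le> 2 * \<bar>t\<bar>" using \<alpha> by (intro mult_right_mono) auto
    have 0: "norm (Gamma s) \<le> C0"
    proof -
      have "norm (Gamma s) \<le> Gamma x" using norm_Gamma_le[of s] x ab by (simp add: s_def)
      also have "\<dots> \<le> C0" using C0 x by force
      finally show ?thesis .
    qed
    have 1: "norm (rGamma (of_real (1 - \<nu>) + s)) \<le> exp 1 * (A + \<bar>t\<bar>) ^ m * exp (pi * \<bar>t\<bar> / 2)"
      using rg[of "of_real (1 - \<nu>) + s" t] x ab \<nu> by (auto simp: s_def)
    have 2: "norm (rGamma (of_real \<alpha> * s / 2)) \<le> exp 1 * (A + \<bar>t\<bar>) ^ m * exp (pi * \<alpha> * \<bar>t\<bar> / 4)"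
      using rg[of "of_real \<alpha> * s / 2" t] x ab \<nu> ax ax0 at n \<alpha> by (auto simp: s_def abs_mult mult.assoc)
    have 3: "norm (rGamma (of_real (1 - real n / 2) + of_real \<alpha> * s / 2)) \<le> exp 1 * (A + \<bar>t\<bar>) ^ m * exp (pi * \<alpha> * \<bar>t\<bar> / 4)"
    proof -
      have "\<bar>1 - real n / 2 + \<alpha> * x / 2\<bar> \<le> 1 + \<nu> + real n + b"
        using ax ax0 \<nu> ab by (simp add: abs_le_iff field_simps)
      thus ?thesis
      using rg[of "of_real (1 - real n / 2) + of_real \<alpha> * s / 2" t] x ab \<nu> ax ax0 at n \<alpha> by (auto simp: s_def abs_mult mult.assoc)
    qed
    have 4: "exp ((\<alpha> * Re s - real n) * L) \<le> exp ((\<alpha> * b + real n) * \<bar>L\<bar>)"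
    proof -
      have "\<alpha> * x \<le> \<alpha> * b" using x \<alpha> by (intro mult_left_mono) auto
      hence "\<bar>\<alpha> * x - real n\<bar> \<le> \<alpha> * b + real n" using ax0 by linarith
      hence "\<bar>\<alpha> * x - real n\<bar> * \<bar>L\<bar> \<le> (\<alpha> * b + real n) * \<bar>L\<bar>" by (intro mult_right_mono) auto
      moreover have "(\<alpha> * x - real n) * L \<le> \<bar>\<alpha> * x - real n\<bar> * \<bar>L\<bar>"
        unfolding abs_mult[symmetric] by simp
      ultimately show ?thesis by (simp add: s_def)
    qed
    have A0: "A + \<bar>t\<bar> \<ge> 0" using A by simp
    have "norm (G s) * norm (sin1 \<nu> s) * norm (sin2 \<alpha> n s) \<le> pi\<^sup>2 * norm (Gamma s) * norm (rGamma (of_real (1 - \<nu>) + s))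
     * norm (rGamma (of_real \<alpha> * s / 2)) * norm (rGamma (of_real (1 - real n / 2) + of_real \<alpha> * s / 2)) * exp ((\<alpha> * Re s - real n) * L)"
      by (rule norm_mb_kernel_mult_sin_le)
    also have "\<dots> \<le> pi\<^sup>2 * C0 * (exp 1 * (A + \<bar>t\<bar>) ^ m * exp (pi * \<bar>t\<bar> / 2))
     * (exp 1 * (A + \<bar>t\<bar>) ^ m * exp (pi * \<alpha> * \<bar>t\<bar> / 4)) * (exp 1 * (A + \<bar>t\<bar>) ^ m * exp (pi * \<alpha> * \<bar>t\<bar> / 4)) * exp ((\<alpha> * b + real n) * \<bar>L\<bar>)"
      using C00 A0 by (intro mult_mono 0 1 2 3 4) auto
    also have "\<dots> = pi\<^sup>2 * C0 * exp 1 * exp 1 * exp 1 * exp ((\<alpha> * b + real n) * \<bar>L\<bar>) * (A + \<bar>t\<bar>) ^ (3 * m)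
        * (exp (pi * \<bar>t\<bar> / 2) * exp (pi * \<alpha> * \<bar>t\<bar> / 4) * exp (pi * \<alpha> * \<bar>t\<bar> / 4))"
    proof -
      have cube: "(A + \<bar>t\<bar>) ^ (3 * m) = (A + \<bar>t\<bar>) ^ m * ((A + \<bar>t\<bar>) ^ m * (A + \<bar>t\<bar>) ^ m)"
        by (simp add: mult.commute[of 3] power_mult power3_eq_cube mult.assoc)
      show ?thesis unfolding cube by (simp add: mult_ac)
    qed
    also have "exp (pi * \<bar>t\<bar> / 2) * exp (pi * \<alpha> * \<bar>t\<bar> / 4) * exp (pi * \<alpha> * \<bar>t\<bar> / 4) = exp ((pi / 2 + pi * \<alpha> / 2) * \<bar>t\<bar>)"
      unfolding exp_add[symmetric] by (simp add: field_simps)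
    also have "pi\<^sup>2 * C0 * exp 1 * exp 1 * exp 1 * exp ((\<alpha> * b + real n) * \<bar>L\<bar>) * (A + \<bar>t\<bar>) ^ (3 * m) * exp ((pi / 2 + pi * \<alpha> / 2) * \<bar>t\<bar>)
      \<le> pi\<^sup>2 * C0 * exp 1 * exp 1 * exp 1 * exp ((\<alpha> * b + real n) * \<bar>L\<bar>) * (F * exp (pi / 4 * \<bar>t\<bar>)) * exp ((pi / 2 + pi * \<alpha> / 2) * \<bar>t\<bar>)"
      using C00 by (intro mult_right_mono mult_left_mono poly) auto
    also have "\<dots> = C * (exp (pi / 4 * \<bar>t\<bar>) * exp ((pi / 2 + pi * \<alpha> / 2) * \<bar>t\<bar>))"
      by (simp add: C_def mult_ac)
    also have "exp (pi / 4 * \<bar>t\<bar>) * exp ((pi / 2 + pi * \<alpha> / 2) * \<bar>t\<bar>) = exp ((3 * pi / 4 + pi * \<alpha> / 2) * \<bar>t\<bar>)"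
      unfolding exp_add[symmetric] by (simp add: field_simps)
    finally show "norm (G (Complex x t)) * norm (sin1 \<nu> (Complex x t)) * norm (sin2 \<alpha> n (Complex x t))
      \<le> C * exp ((3 * pi / 4 + pi * \<alpha> / 2) * \<bar>t\<bar>)" unfolding s_def .
  qed
qed

lemma mb_kernel_vertical_bound:
  assumes x: "x > 0" and r: "abs_sin1 \<nu> x > 0" "abs_sin2 \<alpha> n x > 0"
  obtains C where "\<And>t. norm (G (Complex x t)) \<le> C * exp (- (pi / 4) * \<bar>t\<bar>)"
proof -
  obtain C where C: "C \<ge> 0" "\<And>y t. x \<le> y \<Longrightarrow> y \<le> x \<Longrightarrow> norm (G (Complex y t)) * norm (sin1 \<nu> (Complex y t)) * norm (sin2 \<alpha> n (Complex y t))
      \<le> C * exp ((3 * pi / 4 + pi * \<alpha> / 2) * \<bar>t\<bar>)"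
    using mb_kernel_strip_bound[OF x order_refl] by blast
  show ?thesis
  proof
    fix t
    have "norm (G (Complex x t)) \<le> C * exp ((3 * pi / 4 + pi * \<alpha> / 2) * \<bar>t\<bar>) /
       ((abs_sin1 \<nu> x * exp (pi * \<bar>t\<bar>) / 2) * (abs_sin2 \<alpha> n x * exp (pi * \<alpha> / 2 * \<bar>t\<bar>) / 2))"
      using r by (intro le_divide_of_mult_bounds[OF C(2) _ _ _ norm_sin1_ge norm_sin2_ge]) auto
    also have "\<dots> = (4 * C / (abs_sin1 \<nu> x * abs_sin2 \<alpha> n x)) * (exp ((3 * pi / 4 + pi * \<alpha> / 2) * \<bar>t\<bar>) / (exp (pi * \<bar>t\<bar>) * exp (pi * \<alpha> / 2 * \<bar>t\<bar>)))"
      by (simp add: mult_ac)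
    also have "exp ((3 * pi / 4 + pi * \<alpha> / 2) * \<bar>t\<bar>) / (exp (pi * \<bar>t\<bar>) * exp (pi * \<alpha> / 2 * \<bar>t\<bar>)) = exp (- (pi / 4) * \<bar>t\<bar>)"
      unfolding exp_add[symmetric] exp_diff[symmetric] by (simp add: algebra_simps)
    finally show "norm (G (Complex x t)) \<le> (4 * C / (abs_sin1 \<nu> x * abs_sin2 \<alpha> n x)) * exp (- (pi / 4) * \<bar>t\<bar>)" .
  qed
qed

lemma mb_kernel_horizontal_bound:
  assumes ab: "0 < a" "a \<le> b"
  obtains C T0 where "\<And>x t. a \<le> x \<Longrightarrow> x \<le> b \<Longrightarrow> \<bar>t\<bar> \<ge> T0 \<Longrightarrow> norm (G (Complex x t)) \<le> C * exp (- (pi / 4) * \<bar>t\<bar>)"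
proof -
  obtain C where C: "C \<ge> 0" "\<And>y t. a \<le> y \<Longrightarrow> y \<le> b \<Longrightarrow> norm (G (Complex y t)) * norm (sin1 \<nu> (Complex y t)) * norm (sin2 \<alpha> n (Complex y t))
      \<le> C * exp ((3 * pi / 4 + pi * \<alpha> / 2) * \<bar>t\<bar>)"
    using mb_kernel_strip_bound[OF ab] by blast
  show ?thesis
  proof
    \<comment> \<open>The threshold makes both pi |t| and pi \<alpha> |t| / 2 at least 1, so both
      sinh bounds are available.\<close>
    fix x t assume x: "a \<le> x" "x \<le> b" and t: "\<bar>t\<bar> \<ge> 1 + 2 / (pi * \<alpha>)"
    have t1: "1 * 1 \<le> pi * \<bar>t\<bar>"
    proof (intro mult_mono)
      have "2 / (pi * \<alpha>) \<ge> 0" using \<alpha> by simp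
      thus "1 \<le> \<bar>t\<bar>" using t by linarith
    qed (use pi_ge_two in auto)
    have "2 / (pi * \<alpha>) \<le> \<bar>t\<bar>" using t by linarith
    hence t2: "pi * \<alpha> / 2 * \<bar>t\<bar> \<ge> 1" using \<alpha> by (simp add: field_simps)
    have "norm (G (Complex x t)) \<le> C * exp ((3 * pi / 4 + pi * \<alpha> / 2) * \<bar>t\<bar>) /
       ((exp (pi * \<bar>t\<bar>) / 4) * (exp (pi * \<alpha> / 2 * \<bar>t\<bar>) / 4))"
      using x t1 t2 by (intro le_divide_of_mult_bounds[OF C(2) _ _ _ norm_sin1_ge' norm_sin2_ge']) auto
    also have "\<dots> = (16 * C) * (exp ((3 * pi / 4 + pi * \<alpha> / 2) * \<bar>t\<bar>) / (exp (pi * \<bar>t\<bar>) * exp (pi * \<alpha> / 2 * \<bar>t\<bar>)))"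
      by (simp add: mult_ac)
    also have "exp ((3 * pi / 4 + pi * \<alpha> / 2) * \<bar>t\<bar>) / (exp (pi * \<bar>t\<bar>) * exp (pi * \<alpha> / 2 * \<bar>t\<bar>)) = exp (- (pi / 4) * \<bar>t\<bar>)"
      unfolding exp_add[symmetric] exp_diff[symmetric] by (simp add: algebra_simps)
    finally show "norm (G (Complex x t)) \<le> (16 * C) * exp (- (pi / 4) * \<bar>t\<bar>)" .
  qed
qed

text \<open>To the right of \<nu> and n / \<alpha> all three reciprocal Gamma arguments have real
  part at least 1/2, so no shift and no polynomial factor is needed. Unlike in the strip bound, the
  dependence on x is explicit.\<close>

lemma mb_kernel_far_bound:
  assumes x: "x > 0" "x \<ge> \<nu>" "\<alpha> * x \<ge> real n" and r: "abs_sin1 \<nu> x > 0" "abs_sin2 \<alpha> n x > 0"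
  shows "norm (G (Complex x t)) \<le> (4 * pi\<^sup>2 / (abs_sin1 \<nu> x * abs_sin2 \<alpha> n x)) * (gamma_quotient \<alpha> \<nu> n x * exp ((\<alpha> * x - real n) * L)) * exp (- (pi / 2) * \<bar>t\<bar>)"
proof -
  define s where "s = Complex x t"
  have p: "Gamma x \<ge> 0" "rGamma (1 - \<nu> + x) \<ge> 0" "rGamma (\<alpha> * x / 2) \<ge> 0" "rGamma (1 - real n / 2 + \<alpha> * x / 2) \<ge> 0"
    using x \<nu> \<alpha> by (auto simp: rGamma_inverse_Gamma intro!: less_imp_le[OF Gamma_real_pos])
  have e1: "of_real (1 - \<nu>) + s = Complex (1 - \<nu> + x) t" by (simp add: s_def complex_eq_iff)
  have e2: "of_real \<alpha> * s / 2 = Complex (\<alpha> * x / 2) (\<alpha> * t / 2)" by (simp add: s_def complex_eq_iff)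
  have e3: "of_real (1 - real n / 2) + of_real \<alpha> * s / 2 = Complex (1 - real n / 2 + \<alpha> * x / 2) (\<alpha> * t / 2)"
    by (simp add: s_def complex_eq_iff)
  have "norm (G s) * norm (sin1 \<nu> s) * norm (sin2 \<alpha> n s) \<le> pi\<^sup>2 * norm (Gamma s) * norm (rGamma (of_real (1 - \<nu>) + s))
     * norm (rGamma (of_real \<alpha> * s / 2)) * norm (rGamma (of_real (1 - real n / 2) + of_real \<alpha> * s / 2)) * exp ((\<alpha> * Re s - real n) * L)"
    by (rule norm_mb_kernel_mult_sin_le)
  also have "\<dots> \<le> pi\<^sup>2 * Gamma x * (rGamma (1 - \<nu> + x) * exp (pi * \<bar>t\<bar> / 2)) * (rGamma (\<alpha> * x / 2) * exp (pi * \<bar>\<alpha> * t / 2\<bar> / 2))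
      * (rGamma (1 - real n / 2 + \<alpha> * x / 2) * exp (pi * \<bar>\<alpha> * t / 2\<bar> / 2)) * exp ((\<alpha> * x - real n) * L)"
    unfolding e1 e3 unfolding e2
    using x p n norm_Gamma_le[of s]
    by (intro mult_mono norm_rGamma_vertical_le) (auto simp: s_def)
  also have "\<dots> = pi\<^sup>2 * (gamma_quotient \<alpha> \<nu> n x * exp ((\<alpha> * x - real n) * L)) * (exp (pi * \<bar>t\<bar> / 2) * exp (pi * \<bar>\<alpha> * t / 2\<bar> / 2) * exp (pi * \<bar>\<alpha> * t / 2\<bar> / 2))"
    by (simp add: gamma_quotient_def mult_ac)
  also have "exp (pi * \<bar>t\<bar> / 2) * exp (pi * \<bar>\<alpha> * t / 2\<bar> / 2) * exp (pi * \<bar>\<alpha> * t / 2\<bar> / 2) = exp ((pi / 2 + pi * \<alpha> / 2) * \<bar>t\<bar>)"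
    unfolding exp_add[symmetric] using \<alpha> by (simp add: abs_mult field_simps)
  finally have B: "norm (G s) * norm (sin1 \<nu> s) * norm (sin2 \<alpha> n s) \<le> pi\<^sup>2 * (gamma_quotient \<alpha> \<nu> n x * exp ((\<alpha> * x - real n) * L)) * exp ((pi / 2 + pi * \<alpha> / 2) * \<bar>t\<bar>)" .
  have "norm (G s) \<le> pi\<^sup>2 * (gamma_quotient \<alpha> \<nu> n x * exp ((\<alpha> * x - real n) * L)) * exp ((pi / 2 + pi * \<alpha> / 2) * \<bar>t\<bar>) /
       ((abs_sin1 \<nu> x * exp (pi * \<bar>t\<bar>) / 2) * (abs_sin2 \<alpha> n x * exp (pi * \<alpha> / 2 * \<bar>t\<bar>) / 2))"
    unfolding s_def using r by (intro le_divide_of_mult_bounds[OF B[unfolded s_def] _ _ _ norm_sin1_ge norm_sin2_ge]) auto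
  also have "\<dots> = (4 * pi\<^sup>2 / (abs_sin1 \<nu> x * abs_sin2 \<alpha> n x)) * (gamma_quotient \<alpha> \<nu> n x * exp ((\<alpha> * x - real n) * L)) *
      (exp ((pi / 2 + pi * \<alpha> / 2) * \<bar>t\<bar>) / (exp (pi * \<bar>t\<bar>) * exp (pi * \<alpha> / 2 * \<bar>t\<bar>)))"
    by (simp add: mult_ac)
  also have "exp ((pi / 2 + pi * \<alpha> / 2) * \<bar>t\<bar>) / (exp (pi * \<bar>t\<bar>) * exp (pi * \<alpha> / 2 * \<bar>t\<bar>)) = exp (- (pi / 2) * \<bar>t\<bar>)"
    unfolding exp_add[symmetric] exp_diff[symmetric] by (simp add: algebra_simps)
  finally show ?thesis unfolding s_def .
qed

lemma mb_kernel_integrable: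
  assumes x: "x > 0" and r: "abs_sin1 \<nu> x > 0" "abs_sin2 \<alpha> n x > 0"
  shows "integrable lborel (\<lambda>t. G (Complex x t))"
proof -
  obtain C where C: "\<And>t. norm (G (Complex x t)) \<le> C * exp (- (pi / 4) * \<bar>t\<bar>)"
    using mb_kernel_vertical_bound[OF assms] by blast
  have nn: "z \<notin> \<int>\<^sub>\<le>\<^sub>0" if "sin (pi * Re z) \<noteq> 0" for z :: complex
  proof
    assume "z \<in> \<int>\<^sub>\<le>\<^sub>0"
    then obtain k where "z = - of_nat k" by (elim nonpos_Ints_cases')
    hence "sin (pi * Re z) = 0" by simp
    thus False using that by contradiction
  qed
  have c1: "of_real \<nu> - Complex x t \<notin> \<int>\<^sub>\<le>\<^sub>0" for t
    using r(1) by (intro nn) (simp add: abs_sin1_def)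
  have c2: "(of_nat n - of_real \<alpha> * Complex x t) / 2 \<notin> \<int>\<^sub>\<le>\<^sub>0" for t
    using r(2) by (intro nn) (simp add: abs_sin2_def)
  show ?thesis
  proof (rule Bochner_Integration.integrable_bound)
    show "integrable lborel (\<lambda>t. C * exp (- (pi / 4) * \<bar>t\<bar>))"
      by (intro integrable_mult_right integrable_exp_neg_abs) auto
    have "continuous_on UNIV (\<lambda>t. G (Complex x t))"
      unfolding mb_kernel_def using x
      by (intro continuous_on_mult continuous_on_Gamma_compose continuous_intros c1 c2 Re_pos_not_nonpos_Ints
           continuous_on_compose2[OF continuous_on_rGamma[of UNIV]]) auto
    thus "(\<lambda>t. G (Complex x t)) \<in> borel_measurable lborel"
      by (simp add: borel_measurable_continuous_onI)
    show "AE t in lborel. norm (G (Complex x t)) \<le> norm (C * exp (- (pi / 4) * \<bar>t\<bar>))"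
      using order_trans[OF C abs_ge_self] by (intro AE_I2) simp
  qed
qed

section \<open>Moving the contour to infinity\<close>

lemma finite_mb_poles_below: "finite {p \<in> mb_poles \<alpha> \<nu> n. p < X}"
proof -
  have "{p \<in> mb_poles \<alpha> \<nu> n. p < X} \<subseteq> (\<lambda>l. \<nu> + real l) ` {..nat \<lceil>X\<rceil>} \<union> (\<lambda>j. (real n + 2 * real j) / \<alpha>) ` {..nat \<lceil>\<alpha> * X\<rceil>}"
  proof
    fix p assume p: "p \<in> {p \<in> mb_poles \<alpha> \<nu> n. p < X}"
    show "p \<in> (\<lambda>l. \<nu> + real l) ` {..nat \<lceil>X\<rceil>} \<union> (\<lambda>j. (real n + 2 * real j) / \<alpha>) ` {..nat \<lceil>\<alpha> * X\<rceil>}"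
    proof (cases "p \<in> range (\<lambda>l. \<nu> + real l)")
      case True
      then obtain l where "p = \<nu> + real l" by auto
      moreover from this have "real l \<le> X" using p \<nu> by auto
      hence "l \<le> nat \<lceil>X\<rceil>" by linarith
      ultimately show ?thesis by blast
    next
      case False
      then obtain j where j: "p = (real n + 2 * real j) / \<alpha>" using p by (auto simp: mb_poles_def)
      moreover have "\<alpha> * p < \<alpha> * X" using p \<alpha> by simp
      ultimately have "real n + 2 * real j < \<alpha> * X" using \<alpha> by simp
      hence "real j \<le> \<alpha> * X" by linarith
      hence "j \<le> nat \<lceil>\<alpha> * X\<rceil>" by linarith
      thus ?thesis using j by blast
    qed
  qed
  thus ?thesis by (rule finite_subset) auto
qed

lemma mb_kernel_holomorphic:
  "G holomorphic_on {s. 0 < Re s} - of_real ` mb_poles \<alpha> \<nu> n"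
proof -
  have 1: "of_real \<nu> - s \<notin> \<int>\<^sub>\<le>\<^sub>0" if "s \<notin> of_real ` mb_poles \<alpha> \<nu> n" for s :: complex
  proof
    assume "of_real \<nu> - s \<in> \<int>\<^sub>\<le>\<^sub>0"
    then obtain l where "of_real \<nu> - s = - of_nat l" by (elim nonpos_Ints_cases')
    hence "s = of_real (\<nu> + real l)" by (simp add: algebra_simps)
    hence "s \<in> of_real ` mb_poles \<alpha> \<nu> n" unfolding mb_poles_def by blast
    thus False using that by contradiction
  qed
  have 2: "(of_nat n - of_real \<alpha> * s) / 2 \<notin> \<int>\<^sub>\<le>\<^sub>0" if "s \<notin> of_real ` mb_poles \<alpha> \<nu> n" for s :: complex
  proof
    assume "(of_nat n - of_real \<alpha> * s) / 2 \<in> \<int>\<^sub>\<le>\<^sub>0"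
    then obtain j where "(of_nat n - of_real \<alpha> * s) / 2 = - of_nat j" by (elim nonpos_Ints_cases')
    hence "of_real \<alpha> * s = of_nat n + 2 * of_nat j" by (simp add: field_simps)
    hence "s = of_real ((real n + 2 * real j) / \<alpha>)" using \<alpha> by (simp add: field_simps)
    hence "s \<in> of_real ` mb_poles \<alpha> \<nu> n" unfolding mb_poles_def by blast
    thus False using that by contradiction
  qed
  show ?thesis unfolding mb_kernel_def
    by (intro holomorphic_intros holomorphic_Gamma' 1 2 Re_pos_not_nonpos_Ints holomorphic_rGamma') auto
qed

lemma mb_kernel_shift:
  assumes c: "0 < c" "c < X" "\<And>p. p \<in> mb_poles \<alpha> \<nu> n \<Longrightarrow> c < p"
    and r: "abs_sin1 \<nu> c > 0" "abs_sin2 \<alpha> n c > 0" "abs_sin1 \<nu> X > 0" "abs_sin2 \<alpha> n X > 0"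
  shows "(LINT t|lborel. G (Complex X t)) - (LINT t|lborel. G (Complex c t))
     = 2 * pi * (\<Sum>p | p \<in> mb_poles \<alpha> \<nu> n \<and> p < X. residue G (of_real p))"
proof -
  obtain C T0 where hb: "\<And>x t. c \<le> x \<Longrightarrow> x \<le> X \<Longrightarrow> \<bar>t\<bar> \<ge> T0 \<Longrightarrow> norm (G (Complex x t)) \<le> C * exp (- (pi / 4) * \<bar>t\<bar>)"
    using mb_kernel_horizontal_bound[of c X] c by (meson less_imp_le)
  \<comment> \<open>The residue theorem needs an open set around the closed strip. The margin 1 may
    bring in further poles; they are filtered out of the sum afterwards.\<close>
  define S where "S = {s::complex. 0 < Re s \<and> Re s < X + 1}"
  define P where "P = {p \<in> mb_poles \<alpha> \<nu> n. p < X + 1}"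
  have XP: "X \<notin> mb_poles \<alpha> \<nu> n"
  proof
    assume "X \<in> mb_poles \<alpha> \<nu> n"
    hence "abs_sin1 \<nu> X = 0 \<or> abs_sin2 \<alpha> n X = 0"
      using \<alpha> by (auto simp: mb_poles_def abs_sin1_def abs_sin2_def)
    thus False using r by auto
  qed
  have "(LINT t|lborel. G (Complex X t)) - (LINT t|lborel. G (Complex c t))
     = 2 * pi * (\<Sum>p\<in>{p\<in>of_real ` P. c < Re p \<and> Re p < X}. residue G p)"
  proof (rule vertical_contour_shift[where S = S and tmin = T0 and g = "\<lambda>t. C * exp (- (pi / 4) * t)"])
    have "S = {s. 0 < Re s} \<inter> {s. Re s < X + 1}" by (auto simp: S_def)
    thus "open S" "connected S"
      by (auto intro!: open_Int open_halfspace_Re_gt open_halfspace_Re_lt convex_connected convex_Int convex_halfspace_Re_gt convex_halfspace_Re_lt)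
    show "finite (complex_of_real ` P)" unfolding P_def by (intro finite_imageI finite_mb_poles_below)
    show "G holomorphic_on S - of_real ` P"
      by (rule holomorphic_on_subset[OF mb_kernel_holomorphic]) (auto simp: S_def P_def)
    show "((\<lambda>t. C * exp (- (pi / 4) * t)) \<longlongrightarrow> 0) at_top"
      by (intro tendsto_mult_right_zero) (real_asymp)
    show "Im p = 0 \<and> Re p \<noteq> c \<and> Re p \<noteq> X" if "p \<in> of_real ` P" for p
      using that c(3)[of c] XP by (auto simp: P_def)
  qed (use c r hb in \<open>auto simp: S_def intro!: mb_kernel_integrable\<close>)
  also have "{p\<in>of_real ` P. c < Re p \<and> Re p < X} = complex_of_real ` {p \<in> mb_poles \<alpha> \<nu> n. p < X}"
    using c(3) by (auto simp: P_def)
  also have "(\<Sum>p\<in>complex_of_real ` {p \<in> mb_poles \<alpha> \<nu> n. p < X}. residue G p) = (\<Sum>p | p \<in> mb_poles \<alpha> \<nu> n \<and> p < X. residue G (of_real p))"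
    by (subst sum.reindex) (auto simp: inj_on_def)
  finally show ?thesis .
qed

text \<open>Along these lines the sine moduli are constant by assumption, so the far bound tends to
  0 with \<open>gamma_quotient\<close>.\<close>

lemma mb_kernel_far_tendsto:
  assumes d: "d > 0" and r: "abs_sin1 \<nu> c > 0" "abs_sin2 \<alpha> n c > 0"
    and per: "\<And>k. abs_sin1 \<nu> (c + d * real k) = abs_sin1 \<nu> c" "\<And>k. abs_sin2 \<alpha> n (c + d * real k) = abs_sin2 \<alpha> n c"
  shows "(\<lambda>k. LINT t|lborel. G (Complex (c + d * real k) t)) \<longlonglongrightarrow> 0"
proof -
  \<comment> \<open>The exponential absorbs the power of r / 2 that sits in the kernel; the factor 2
    leaves the decay 2^(- N k).\<close>
  define K where "K = 2 * (exp (\<alpha> * \<bar>L\<bar>))"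
  have "exp (\<alpha> * \<bar>L\<bar>) \<ge> 1" using \<alpha> by simp
  hence K: "K \<ge> 1" unfolding K_def by linarith
  obtain C where C: "C \<ge> 0" "\<And>x. x \<ge> \<nu> \<Longrightarrow> \<bar>gamma_quotient \<alpha> \<nu> n x\<bar> * K powr x \<le> C"
    using gamma_quotient_superexp[OF \<alpha>(1) \<nu> \<nu> K, of n] by blast
  define I where "I = (LINT t|lborel. exp (- (pi / 2) * \<bar>t\<bar>))"
  define B where "B = (4 * pi\<^sup>2 / (abs_sin1 \<nu> c * abs_sin2 \<alpha> n c)) * (C * exp (real n * \<bar>L\<bar>)) * I"
  define N where "N = (\<lambda>k. c + d * real k)"
  have Ninf: "filterlim N at_top sequentially" unfolding N_def using d by real_asymp
  show ?thesis
  proof (rule Lim_null_comparison)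
    show "\<forall>\<^sub>F k in sequentially. norm (LINT t|lborel. G (Complex (c + d * real k) t)) \<le> B * 2 powr (- N k)"
      using Ninf[unfolded filterlim_at_top, rule_format, of "max \<nu> (real n / \<alpha>)"]
    proof eventually_elim
      case (elim k)
      have x: "N k > 0" "N k \<ge> \<nu>" "\<alpha> * N k \<ge> real n" using elim \<nu> \<alpha> by (auto simp: field_simps)
      have r': "abs_sin1 \<nu> (N k) = abs_sin1 \<nu> c" "abs_sin2 \<alpha> n (N k) = abs_sin2 \<alpha> n c" using per by (auto simp: N_def)
      define Q where "Q = gamma_quotient \<alpha> \<nu> n (N k) * exp ((\<alpha> * N k - real n) * L)"
      have Qb: "Q \<le> C * exp (real n * \<bar>L\<bar>) * 2 powr (- N k)"
      proof -
        have "Q \<le> \<bar>gamma_quotient \<alpha> \<nu> n (N k)\<bar> * exp ((\<alpha> * N k - real n) * L)"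
          unfolding Q_def by (intro mult_right_mono) auto
        also have "\<dots> \<le> \<bar>gamma_quotient \<alpha> \<nu> n (N k)\<bar> * (exp (\<alpha> * \<bar>L\<bar> * N k) * exp (real n * \<bar>L\<bar>))"
        proof (intro mult_left_mono)
          have "\<bar>\<alpha> * N k - real n\<bar> * \<bar>L\<bar> \<le> (\<alpha> * N k + real n) * \<bar>L\<bar>"
            using x \<alpha> by (intro mult_right_mono) auto
          moreover have "(\<alpha> * N k - real n) * L \<le> \<bar>\<alpha> * N k - real n\<bar> * \<bar>L\<bar>"
            unfolding abs_mult[symmetric] by simp
          ultimately have "(\<alpha> * N k - real n) * L \<le> \<alpha> * \<bar>L\<bar> * N k + real n * \<bar>L\<bar>"
            by (simp add: algebra_simps)
          thus "exp ((\<alpha> * N k - real n) * L) \<le> exp (\<alpha> * \<bar>L\<bar> * N k) * exp (real n * \<bar>L\<bar>)"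
            by (simp flip: exp_add)
        qed auto
        also have "exp (\<alpha> * \<bar>L\<bar> * N k) = K powr N k * 2 powr (- N k)"
        proof -
          have "K powr N k = 2 powr N k * exp (\<alpha> * \<bar>L\<bar> * N k)"
            by (simp add: K_def powr_mult exp_powr_real)
          thus ?thesis by (simp add: powr_minus)
        qed
        also have "\<bar>gamma_quotient \<alpha> \<nu> n (N k)\<bar> * (K powr N k * 2 powr (- N k) * exp (real n * \<bar>L\<bar>))
          = (\<bar>gamma_quotient \<alpha> \<nu> n (N k)\<bar> * K powr N k) * (2 powr (- N k) * exp (real n * \<bar>L\<bar>))"
          by simp
        also have "\<dots> \<le> C * (2 powr (- N k) * exp (real n * \<bar>L\<bar>))"
          by (intro mult_right_mono C(2) x) auto
        finally show ?thesis by (simp add: mult_ac)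
      qed
      have "norm (LINT t|lborel. G (Complex (N k) t)) \<le> (LINT t|lborel. (4 * pi\<^sup>2 / (abs_sin1 \<nu> c * abs_sin2 \<alpha> n c)) * Q * exp (- (pi / 2) * \<bar>t\<bar>))"
      proof (rule Bochner_Integration.integral_norm_bound_integral)
        show "integrable lborel (\<lambda>t. G (Complex (N k) t))"
          using x r r' by (intro mb_kernel_integrable) auto
        show "integrable lborel (\<lambda>t. (4 * pi\<^sup>2 / (abs_sin1 \<nu> c * abs_sin2 \<alpha> n c)) * Q * exp (- (pi / 2) * \<bar>t\<bar>))"
          by (intro integrable_mult_right integrable_exp_neg_abs) auto
        show "norm (G (Complex (N k) t)) \<le> (4 * pi\<^sup>2 / (abs_sin1 \<nu> c * abs_sin2 \<alpha> n c)) * Q * exp (- (pi / 2) * \<bar>t\<bar>)" for t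
          using mb_kernel_far_bound[OF x] r unfolding r' Q_def by blast
      qed
      also have "\<dots> = (4 * pi\<^sup>2 / (abs_sin1 \<nu> c * abs_sin2 \<alpha> n c)) * Q * I" by (simp add: I_def)
      also have "\<dots> \<le> (4 * pi\<^sup>2 / (abs_sin1 \<nu> c * abs_sin2 \<alpha> n c)) * (C * exp (real n * \<bar>L\<bar>) * 2 powr (- N k)) * I"
        using r by (intro mult_right_mono mult_left_mono Qb) (auto simp: I_def)
      finally show ?case by (simp add: B_def N_def mult_ac)
    qed
    show "(\<lambda>k. B * 2 powr (- N k)) \<longlonglongrightarrow> 0"
      unfolding N_def using d by real_asymp
  qed
qed

text \<open>Moving to the right makes the residues enter with a minus sign. The limit is along
  particular abscissae; that the residues form a summable family is a separate matter, settled
  through the coefficient bounds.\<close>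

lemma mb_kernel_residue_sums:
  assumes c: "0 < c" "\<And>p. p \<in> mb_poles \<alpha> \<nu> n \<Longrightarrow> c < p"
    and d: "d > 0" and r: "abs_sin1 \<nu> c > 0" "abs_sin2 \<alpha> n c > 0"
    and per: "\<And>k. abs_sin1 \<nu> (c + d * real k) = abs_sin1 \<nu> c" "\<And>k. abs_sin2 \<alpha> n (c + d * real k) = abs_sin2 \<alpha> n c"
  shows "(\<lambda>k. 2 * pi * (\<Sum>p | p \<in> mb_poles \<alpha> \<nu> n \<and> p < c + d * real k. - residue G (of_real p)))
      \<longlonglongrightarrow> (LINT t|lborel. G (Complex c t))"
proof -
  have "(\<lambda>k. (LINT t|lborel. G (Complex c t)) - (LINT t|lborel. G (Complex (c + d * real k) t))) \<longlonglongrightarrow> (LINT t|lborel. G (Complex c t)) - 0"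
    by (intro tendsto_diff tendsto_const mb_kernel_far_tendsto[OF d r per])
  moreover have "\<forall>\<^sub>F k in sequentially. (LINT t|lborel. G (Complex c t)) - (LINT t|lborel. G (Complex (c + d * real k) t))
     = 2 * pi * (\<Sum>p | p \<in> mb_poles \<alpha> \<nu> n \<and> p < c + d * real k. - residue G (of_real p))"
    using eventually_gt_at_top[of 0]
  proof eventually_elim
    case (elim k)
    hence "c < c + d * real k" using d by simp
    from mb_kernel_shift[OF c(1) this c(2) r] r per[of k] show ?case
      by (simp add: sum_negf algebra_simps)
  qed
  ultimately show ?thesis by (simp add: Lim_transform_eventually)
qed

end

section \<open>Residues of the kernel\<close>

text \<open>This function is even with value $1$ at $0$, so it contributes neither to the residue at a simple pole nor,
  having a vanishing derivative at $0$, to the residue at a double one.\<close>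

definition Gamma_pair :: "complex \<Rightarrow> complex" where
  "Gamma_pair d = Gamma (1 + d) * Gamma (1 - d)"

lemma not_nonpos_Ints_1_add: "norm d < 1 \<Longrightarrow> 1 + of_nat k + d \<notin> \<int>\<^sub>\<le>\<^sub>0" for d :: complex
  using abs_Re_le_cmod[of d] by (intro Re_pos_not_nonpos_Ints) auto

text \<open>Reflection is used twice: at -k - d, and at d to write sin (pi d) / pi as d / (Gamma (1
  + d) Gamma (1 - d)). This isolates the pole 1 / d from factors that are holomorphic and explicit
  near 0.\<close>

lemma Gamma_near_nonpos_Int:
  fixes d :: complex
  assumes d: "norm d < 1" "d \<noteq> 0"
  shows "Gamma (- of_nat k - d) = - ((-1) ^ k * Gamma_pair d * rGamma (1 + of_nat k + d)) / d"
proof -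
  have s: "sin (of_real pi * (- of_nat k - d)) = - ((-1) ^ k * sin (of_real pi * d))" for k :: nat
  proof (induction k)
    case (Suc k)
    have "of_real pi * (- of_nat (Suc k) - d) = of_real pi * (- of_nat k - d) - of_real pi"
      by (simp add: algebra_simps)
    thus ?case using Suc by (simp only: sin_diff) simp
  qed simp
  have np: "1 + d \<notin> \<int>\<^sub>\<le>\<^sub>0" "1 - d \<notin> \<int>\<^sub>\<le>\<^sub>0"
    using not_nonpos_Ints_1_add[of d 0] not_nonpos_Ints_1_add[of "-d" 0] d by auto
  have e: "1 - (- of_nat k - d) = 1 + of_nat k + d" by simp
  have "rGamma (- of_nat k - d) * rGamma (1 + of_nat k + d) = - ((-1) ^ k * (sin (of_real pi * d) / of_real pi))"
    using rGamma_reflection_complex[of "- of_nat k - d"] unfolding e s by simp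
  also have "sin (of_real pi * d) / of_real pi = rGamma d * rGamma (1 - d)"
    by (rule rGamma_reflection_complex[symmetric])
  also have "rGamma d = d * rGamma (1 + d)"
    by (metis add.commute rGamma_plus1)
  finally have eq: "rGamma (- of_nat k - d) * rGamma (1 + of_nat k + d) = - ((-1) ^ k * (d * rGamma (1 + d) * rGamma (1 - d)))" .
  have nz: "rGamma (1 + d) \<noteq> 0" "rGamma (1 - d) \<noteq> 0"
    using np by (auto simp: rGamma_eq_zero_iff)
  have nz': "rGamma (- of_nat k - d) \<noteq> 0"
  proof
    assume "rGamma (- of_nat k - d) = 0"
    with eq have "d * rGamma (1 + d) * rGamma (1 - d) = 0" by simp
    with nz d show False by simp
  qed
  have sq: "((-1) ^ k * (-1) ^ k :: complex) = 1" by (simp flip: power_mult_distrib)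
  have "rGamma (- of_nat k - d) * - ((-1) ^ k * Gamma_pair d * rGamma (1 + of_nat k + d))
     = - ((-1) ^ k * Gamma_pair d) * (rGamma (- of_nat k - d) * rGamma (1 + of_nat k + d))" by simp
  also have "\<dots> = ((-1) ^ k * (-1) ^ k) * d * (Gamma (1 + d) * rGamma (1 + d)) * (Gamma (1 - d) * rGamma (1 - d))"
    unfolding eq by (simp add: Gamma_pair_def mult_ac)
  also have "\<dots> = d" using nz by (simp add: sq Gamma_def)
  finally show ?thesis using nz' d by (simp add: Gamma_def field_simps)
qed

lemma Gamma_pair_0: "Gamma_pair 0 = 1"
  by (simp add: Gamma_pair_def)

lemma Gamma_pair_holomorphic: "Gamma_pair holomorphic_on {d. norm d < 1}"
  unfolding Gamma_pair_def
  using not_nonpos_Ints_1_add[of _ 0] not_nonpos_Ints_1_add[of "- _" 0]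
  by (intro holomorphic_intros holomorphic_Gamma') auto

lemma has_field_derivative_Gamma_pair: "(Gamma_pair has_field_derivative 0) (at 0)"
proof -
  have n: "(1 :: complex) \<notin> \<int>\<^sub>\<le>\<^sub>0" by (intro Re_pos_not_nonpos_Ints) simp
  have "((\<lambda>d. Gamma (1 + d) * Gamma (1 - d)) has_field_derivative
     (Gamma (1 + 0) * Digamma (1 + 0) * (0 + 1)) * Gamma (1 - 0) + (Gamma (1 - 0) * Digamma (1 - 0) * (0 - 1)) * Gamma (1 + 0)) (at (0::complex))"
    using n by (intro DERIV_mult DERIV_chain2[OF has_field_derivative_Gamma] DERIV_add DERIV_diff DERIV_const DERIV_ident) auto
  thus ?thesis by (simp add: Gamma_pair_def[abs_def])
qed

text \<open>The derivative is f z times a and not a quotient, so that the rule for products is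
  additive without any condition that f z be nonzero.\<close>

definition log_deriv_at :: "(complex \<Rightarrow> complex) \<Rightarrow> complex \<Rightarrow> complex \<Rightarrow> bool" where
  "log_deriv_at f a z \<longleftrightarrow> (f has_field_derivative f z * a) (at z)"

lemma log_deriv_at_mult:
  "log_deriv_at f a z \<Longrightarrow> log_deriv_at g b z \<Longrightarrow> log_deriv_at (\<lambda>w. f w * g w) (a + b) z"
  unfolding log_deriv_at_def by (drule (1) DERIV_mult) (simp add: algebra_simps)

lemma log_deriv_at_const: "log_deriv_at (\<lambda>w. c) 0 z"
  by (simp add: log_deriv_at_def)

lemma log_deriv_at_compose:
  assumes "log_deriv_at f a (g z)" "(g has_field_derivative b) (at z)"
  shows "log_deriv_at (\<lambda>w. f (g w)) (a * b) z"
  using DERIV_chain2[OF assms[unfolded log_deriv_at_def]] by (simp add: log_deriv_at_def mult.assoc)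

lemma log_deriv_at_Gamma: "z \<notin> \<int>\<^sub>\<le>\<^sub>0 \<Longrightarrow> log_deriv_at Gamma (Digamma z) z"
  unfolding log_deriv_at_def by (rule has_field_derivative_Gamma)

lemma log_deriv_at_rGamma: "z \<notin> \<int>\<^sub>\<le>\<^sub>0 \<Longrightarrow> log_deriv_at rGamma (- Digamma z) z"
  unfolding log_deriv_at_def using has_field_derivative_rGamma_no_nonpos_int[of z UNIV] by simp

lemma log_deriv_at_exp: "log_deriv_at exp 1 z"
  unfolding log_deriv_at_def using DERIV_exp[of z] by simp

lemma log_deriv_at_Gamma_pair: "log_deriv_at Gamma_pair 0 0"
  unfolding log_deriv_at_def using has_field_derivative_Gamma_pair by simp

context
  fixes \<alpha> \<nu> L :: real and n :: nat
  assumes \<alpha>: "0 < \<alpha>" "\<alpha> \<le> 2" and \<nu>: "0 < \<nu>" and n: "n > 0"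
begin

private lemma G_near_l:
  fixes l :: nat and w :: complex
  assumes "norm (w - of_real (\<nu> + real l)) < 1" "w \<noteq> of_real (\<nu> + real l)"
  shows "Gamma (of_real \<nu> - w) = - ((-1) ^ l * Gamma_pair (w - of_real (\<nu> + real l)) * rGamma (1 + of_nat l + (w - of_real (\<nu> + real l)))) / (w - of_real (\<nu> + real l))"
  using Gamma_near_nonpos_Int[of "w - of_real (\<nu> + real l)" l] assms by simp

text \<open>Here the local variable is (\<alpha> / 2) (w - p), whence the extra factor 2 / \<alpha>;
  \<alpha> at most 2 keeps it inside the unit disc.\<close>

private lemma G_near_j:
  fixes j :: nat and w :: complex
  defines "p \<equiv> (real n + 2 * real j) / \<alpha>"
  assumes w: "norm (w - of_real p) < 1" "w \<noteq> of_real p"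
  shows "Gamma ((of_nat n - of_real \<alpha> * w) / 2) = - ((-1) ^ j * Gamma_pair (of_real (\<alpha> / 2) * (w - of_real p)) * rGamma (1 + of_nat j + of_real (\<alpha> / 2) * (w - of_real p))) * of_real (2 / \<alpha>) / (w - of_real p)"
proof -
  define d where "d = of_real (\<alpha> / 2) * (w - of_real p)"
  have "norm d = (\<alpha> / 2) * norm (w - of_real p)" using \<alpha> unfolding d_def norm_mult norm_of_real by simp
  also have "\<dots> \<le> 1 * norm (w - of_real p)" using \<alpha> by (intro mult_right_mono) auto
  finally have nd: "norm d < 1" "d \<noteq> 0" using w \<alpha> by (auto simp: d_def)
  have "\<alpha> * p = real n + 2 * real j" using \<alpha> by (simp add: p_def)
  hence "of_real \<alpha> * of_real p = (of_nat n + 2 * of_nat j :: complex)"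
    by (metis of_real_mult of_real_add of_real_of_nat_eq of_real_numeral)
  hence e: "(of_nat n - of_real \<alpha> * w) / 2 = - of_nat j - d" by (simp add: d_def field_simps)
  have "w - of_real p \<noteq> 0" using w by simp
  thus ?thesis unfolding e Gamma_near_nonpos_Int[OF nd]
    unfolding d_def[symmetric] using \<alpha> by (simp add: d_def field_simps)
qed

private lemma open_near:
  fixes p :: real
  assumes "p > 0"
  shows "open {w::complex. norm (w - of_real p) < 1 \<and> Re w > 0}"
proof -
  have "{w::complex. norm (w - of_real p) < 1 \<and> Re w > 0} = ball (of_real p) 1 \<inter> {w. Re w > 0}"
    by (auto simp: dist_norm norm_minus_commute)
  thus ?thesis by (simp add: open_Int open_halfspace_Re_gt)
qed

private lemma open_not_nonpos:
  "continuous_on UNIV f \<Longrightarrow> open {w::complex. f w \<notin> (\<int>\<^sub>\<le>\<^sub>0 :: complex set)}"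
  using open_vimage[of "- \<int>\<^sub>\<le>\<^sub>0" f] closed_nonpos_Ints by (simp add: vimage_def open_Compl)

private lemma residue_aux:
  assumes A: "open A" "p \<in> A" "H holomorphic_on A"
    and eq: "\<And>w. w \<in> A \<Longrightarrow> w \<noteq> p \<Longrightarrow> f w = H w / (w - p) ^ Suc k"
  shows "residue f p = (deriv ^^ k) H p / fact k"
proof -
  have "\<forall>\<^sub>F w in at p. f w = H w / (w - p) ^ Suc k"
    using eventually_at_topological A eq by blast
  hence "residue f p = residue (\<lambda>w. H w / (w - p) ^ Suc k) p" by (rule residue_cong) simp
  thus ?thesis using residue_holomorphic_over_power[OF A] by simp
qed

private lemma hol_Gp: "(\<lambda>w. Gamma_pair (of_real c * (w - of_real p))) holomorphic_on A"
  if A: "\<And>w. w \<in> A \<Longrightarrow> norm (w - of_real p) < 1" and c: "0 \<le> c" "c \<le> 1" for c p A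
proof -
  have *: "norm (of_real c * (w - of_real p) :: complex) < 1" if w: "w \<in> A" for w
  proof -
    have "norm (of_real c * (w - of_real p) :: complex) \<le> 1 * norm (w - of_real p)"
      unfolding norm_mult norm_of_real using c by (intro mult_right_mono) auto
    thus ?thesis using A[OF w] by simp
  qed
  have "Gamma_pair \<circ> (\<lambda>w. of_real c * (w - of_real p)) holomorphic_on A"
    by (rule holomorphic_on_compose_gen[OF _ Gamma_pair_holomorphic]) (auto intro!: holomorphic_intros *)
  thus ?thesis by (simp add: o_def)
qed

lemma residue_mb_kernel_l:
  fixes l :: nat
  defines "p \<equiv> \<nu> + real l"
  assumes nr: "(real n - \<alpha> * p) / 2 \<notin> \<int>\<^sub>\<le>\<^sub>0"
  shows "- residue (mb_kernel \<alpha> \<nu> n L) (of_real p) =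
     of_real ((-1) ^ l / fact l * Gamma p * (Gamma ((real n - \<alpha> * p) / 2) / Gamma (\<alpha> * p / 2)) * exp ((\<alpha> * p - real n) * L))"
proof -
  have p: "p > 0" using \<nu> by (simp add: p_def)
  define f where "f = (\<lambda>w::complex. (of_nat n - of_real \<alpha> * w) / 2)"
  \<comment> \<open>Besides the disc and the half plane, A avoids the poles of the other Gamma
    factor; the hypothesis \<open>nr\<close> says that p itself is left in A.\<close>
  define A where "A = {w::complex. norm (w - of_real p) < 1 \<and> Re w > 0} \<inter> {w. f w \<notin> \<int>\<^sub>\<le>\<^sub>0}"
  define H where "H = (\<lambda>w. - ((-1) ^ l * Gamma_pair (of_real 1 * (w - of_real p)) * rGamma (1 + of_nat l + (w - of_real p)))
     * (Gamma w * rGamma (of_real \<alpha> * w / 2) * Gamma (f w) * exp ((of_real \<alpha> * w - of_nat n) * of_real L)))"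
  have fp: "f (of_real p) = of_real ((real n - \<alpha> * p) / 2)" by (simp add: f_def)
  have oA: "open A" unfolding A_def
    by (intro open_Int open_near[OF p] open_not_nonpos) (auto simp: f_def intro!: continuous_intros)
  have pA: "of_real p \<in> A" using p nr unfolding A_def by (simp add: fp of_real_in_nonpos_Ints_iff del: of_real_divide of_real_diff)
  have nA: "w \<notin> \<int>\<^sub>\<le>\<^sub>0" "f w \<notin> \<int>\<^sub>\<le>\<^sub>0" if "w \<in> A" for w
    using that Re_pos_not_nonpos_Ints[of w] by (auto simp: A_def)
  have hf: "f holomorphic_on A" unfolding f_def by (intro holomorphic_intros) auto
  have hH: "H holomorphic_on A"
    unfolding H_def by (intro holomorphic_intros hol_Gp holomorphic_rGamma' holomorphic_Gamma' nA hf)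
       (auto simp: A_def intro: nA)
  have eq: "mb_kernel \<alpha> \<nu> n L w = H w / (w - of_real p) ^ Suc 0" if "w \<in> A" "w \<noteq> of_real p" for w
    unfolding mb_kernel_def using G_near_l[of w l] that
    by (simp add: A_def H_def f_def p_def)
  have "residue (mb_kernel \<alpha> \<nu> n L) (of_real p) = H (of_real p)"
    using residue_aux[OF oA pA hH eq] by simp
  also have "\<dots> = - of_real ((-1) ^ l * rGamma (1 + real l) * (Gamma p * rGamma (\<alpha> * p / 2) * Gamma ((real n - \<alpha> * p) / 2) * exp ((\<alpha> * p - real n) * L)))"
    unfolding H_def fp
    by (simp add: Gamma_pair_0 Gamma_complex_of_real[symmetric] rGamma_complex_of_real[symmetric] exp_of_real[symmetric])
  also have "rGamma (1 + real l) = 1 / fact l"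
    by (simp add: rGamma_inverse_Gamma Gamma_fact inverse_eq_divide)
  finally show ?thesis by (simp add: rGamma_inverse_Gamma inverse_eq_divide)
qed

lemma residue_mb_kernel_j:
  fixes j :: nat
  defines "p \<equiv> (real n + 2 * real j) / \<alpha>"
  assumes nr: "\<nu> - p \<notin> \<int>\<^sub>\<le>\<^sub>0"
  shows "- residue (mb_kernel \<alpha> \<nu> n L) (of_real p) =
     of_real (2 / \<alpha> * ((-1) ^ j / fact j * (Gamma p / Gamma ((real n + 2 * real j) / 2)) * Gamma (\<nu> - p) * exp (2 * real j * L)))"
proof -
  have p: "p > 0" using n \<alpha> by (simp add: p_def add_pos_nonneg)
  have ap: "\<alpha> * p = real n + 2 * real j" using \<alpha> by (simp add: p_def)
  define f where "f = (\<lambda>w::complex. of_real \<nu> - w)"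
  define A where "A = {w::complex. norm (w - of_real p) < 1 \<and> Re w > 0} \<inter> {w. f w \<notin> \<int>\<^sub>\<le>\<^sub>0}"
  define H where "H = (\<lambda>w. - ((-1) ^ j * Gamma_pair (of_real (\<alpha> / 2) * (w - of_real p)) * rGamma (1 + of_nat j + of_real (\<alpha> / 2) * (w - of_real p))) * of_real (2 / \<alpha>)
     * (Gamma w * rGamma (of_real \<alpha> * w / 2) * Gamma (f w) * exp ((of_real \<alpha> * w - of_nat n) * of_real L)))"
  have fp: "f (of_real p) = of_real (\<nu> - p)" by (simp add: f_def)
  have oA: "open A" unfolding A_def
    by (intro open_Int open_near[OF p] open_not_nonpos) (auto simp: f_def intro!: continuous_intros)
  have pA: "of_real p \<in> A" using p nr unfolding A_def by (simp add: fp of_real_in_nonpos_Ints_iff del: of_real_diff)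
  have nA: "w \<notin> \<int>\<^sub>\<le>\<^sub>0" "f w \<notin> \<int>\<^sub>\<le>\<^sub>0" if "w \<in> A" for w
    using that Re_pos_not_nonpos_Ints[of w] by (auto simp: A_def)
  have hf: "f holomorphic_on A" unfolding f_def by (intro holomorphic_intros)
  have hH: "H holomorphic_on A"
    unfolding H_def using \<alpha> by (intro holomorphic_intros hol_Gp holomorphic_rGamma' holomorphic_Gamma' nA hf)
       (auto simp: A_def intro: nA)
  have eq: "mb_kernel \<alpha> \<nu> n L w = H w / (w - of_real p) ^ Suc 0" if "w \<in> A" "w \<noteq> of_real p" for w
    unfolding mb_kernel_def using G_near_j[of w j] that
    by (simp add: A_def H_def f_def p_def)
  have "residue (mb_kernel \<alpha> \<nu> n L) (of_real p) = H (of_real p)"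
    using residue_aux[OF oA pA hH eq] by simp
  also have "\<dots> = - of_real ((-1) ^ j * rGamma (1 + real j) * (2 / \<alpha>) * (Gamma p * rGamma (\<alpha> * p / 2) * Gamma (\<nu> - p) * exp ((\<alpha> * p - real n) * L)))"
    unfolding H_def fp
    by (simp add: Gamma_pair_0 Gamma_complex_of_real[symmetric] rGamma_complex_of_real[symmetric] exp_of_real[symmetric])
  also have "rGamma (1 + real j) = 1 / fact j"
    by (simp add: rGamma_inverse_Gamma Gamma_fact inverse_eq_divide)
  finally show ?thesis unfolding ap by (simp add: rGamma_inverse_Gamma inverse_eq_divide mult_ac)
qed

text \<open>Both Gamma factors have a pole, so the residue is H' (p) for H = (w - p)^2 times the
  kernel. It equals H p times the sum of the logarithmic derivatives of the factors of H, which
  gives the digamma bracket and, from the exponential, the logarithm.\<close>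

lemma residue_mb_kernel_double:
  fixes l j :: nat
  defines "p \<equiv> \<nu> + real l"
  assumes res: "real n + 2 * real j = \<alpha> * (\<nu> + real l)"
  shows "- residue (mb_kernel \<alpha> \<nu> n L) (of_real p) =
     of_real (- (2 / \<alpha>) * (-1) ^ (l + j) * (1 / (fact l * fact j) * (Gamma p / Gamma (real n / 2 + real j)) * exp (2 * real j * L)
       * (Digamma p - Digamma (real (l + 1)) - \<alpha> / 2 * Digamma (real n / 2 + real j) - \<alpha> / 2 * Digamma (real (j + 1)) + \<alpha> * L)))"
proof -
  have p: "p > 0" using \<nu> by (simp add: p_def)
  have ap: "\<alpha> * p = real n + 2 * real j" using res by (simp add: p_def)
  have pj: "p = (real n + 2 * real j) / \<alpha>" using ap \<alpha> by (simp add: field_simps)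
  define A where "A = {w::complex. norm (w - of_real p) < 1 \<and> Re w > 0}"
  define H where "H = (\<lambda>w. of_real ((-1) ^ (l + j) * (2 / \<alpha>)) * Gamma_pair (of_real 1 * (w - of_real p)) * Gamma_pair (of_real (\<alpha> / 2) * (w - of_real p))
     * rGamma (1 + of_nat l + (w - of_real p)) * rGamma (1 + of_nat j + of_real (\<alpha> / 2) * (w - of_real p))
     * Gamma w * rGamma (of_real \<alpha> * w / 2) * exp ((of_real \<alpha> * w - of_nat n) * of_real L))"
  have oA: "open A" unfolding A_def by (rule open_near[OF p])
  have pA: "of_real p \<in> A" using p unfolding A_def by simp
  have hH: "H holomorphic_on A"
    unfolding H_def using \<alpha> by (intro holomorphic_intros hol_Gp holomorphic_rGamma' holomorphic_Gamma' Re_pos_not_nonpos_Ints)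
       (auto simp: A_def)
  have eq: "mb_kernel \<alpha> \<nu> n L w = H w / (w - of_real p) ^ Suc 1" if "w \<in> A" "w \<noteq> of_real p" for w
    unfolding mb_kernel_def using G_near_l[of w l] G_near_j[of w j] that
    unfolding pj[symmetric] p_def[symmetric]
    by (simp add: A_def H_def power_add power2_eq_square mult_ac)
  \<comment> \<open>One summand per factor of H, in the same order; the zeros belong to the constant
    and to the two \<open>Gamma_pair\<close> factors.\<close>
  define D where "D = (0::complex) + 0 * 1 + 0 * of_real (\<alpha> / 2) + - Digamma (1 + of_nat l) * 1 + - Digamma (1 + of_nat j) * of_real (\<alpha> / 2)
    + Digamma (of_real p) + - Digamma (of_real \<alpha> * of_real p / 2) * of_real (\<alpha> / 2) + 1 * (of_real \<alpha> * of_real L)"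
  have np: "of_real p \<notin> (\<int>\<^sub>\<le>\<^sub>0 :: complex set)" "of_real \<alpha> * of_real p / 2 \<notin> (\<int>\<^sub>\<le>\<^sub>0 :: complex set)"
      "1 + of_nat m \<notin> (\<int>\<^sub>\<le>\<^sub>0 :: complex set)" for m
    using p \<alpha> by (auto intro!: Re_pos_not_nonpos_Ints)
  have "log_deriv_at H D (of_real p)"
    unfolding H_def D_def
    by (intro log_deriv_at_mult log_deriv_at_const log_deriv_at_compose[where f = Gamma_pair] log_deriv_at_compose[where f = rGamma]
         log_deriv_at_compose[where f = exp] log_deriv_at_Gamma log_deriv_at_exp)
       (auto intro!: derivative_eq_intros log_deriv_at_Gamma_pair log_deriv_at_rGamma np)
  hence "deriv H (of_real p) = H (of_real p) * D"
    unfolding log_deriv_at_def by (rule DERIV_imp_deriv)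
  moreover have "residue (mb_kernel \<alpha> \<nu> n L) (of_real p) = deriv H (of_real p)"
    using residue_aux[OF oA pA hH eq] by simp
  ultimately have "residue (mb_kernel \<alpha> \<nu> n L) (of_real p) = H (of_real p) * D" by simp
  also have "H (of_real p) = of_real ((-1) ^ (l + j) * (2 / \<alpha>) * rGamma (1 + real l) * rGamma (1 + real j) * Gamma p * rGamma (\<alpha> * p / 2) * exp ((\<alpha> * p - real n) * L))"
    unfolding H_def
    by (simp add: Gamma_pair_0 Gamma_complex_of_real[symmetric] rGamma_complex_of_real[symmetric] exp_of_real[symmetric])
  also have "D = of_real (Digamma p - Digamma (real (l + 1)) - \<alpha> / 2 * Digamma (\<alpha> * p / 2) - \<alpha> / 2 * Digamma (real (j + 1)) + \<alpha> * L)"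
  proof -
    have "of_real p \<noteq> (0::complex)" "\<alpha> * p / 2 \<noteq> 0" "real (l + 1) \<noteq> 0" "real (j + 1) \<noteq> 0" using p \<alpha> by auto
    thus ?thesis
      using Polygamma_of_real[of p 0, where 'a = complex] Polygamma_of_real[of "\<alpha> * p / 2" 0, where 'a = complex]
        Polygamma_of_real[of "real (l + 1)" 0, where 'a = complex] Polygamma_of_real[of "real (j + 1)" 0, where 'a = complex]
      by (simp add: D_def mult_ac)
  qed
  also have "rGamma (1 + real l) = 1 / fact l"
    by (simp add: rGamma_inverse_Gamma Gamma_fact inverse_eq_divide)
  also have "rGamma (1 + real j) = 1 / fact j"
    by (simp add: rGamma_inverse_Gamma Gamma_fact inverse_eq_divide)
  also have "\<alpha> * p / 2 = real n / 2 + real j" by (simp add: ap)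
  also have "\<alpha> * p - real n = 2 * real j" by (simp add: ap)
  finally show ?thesis
    unfolding of_real_mult[symmetric] of_real_minus[symmetric] of_real_eq_iff
    by (simp add: rGamma_inverse_Gamma inverse_eq_divide mult_ac)
qed

end

section \<open>Entire series and resonances\<close>

text \<open>The bound is demanded only for large indices in I because the estimates of
  \<open>A1_coeff\<close> and \<open>A2_coeff\<close> fail for finitely many; K is arbitrary, so the
  radius of convergence is infinite.\<close>

lemma entire_series:
  fixes c :: "nat \<Rightarrow> complex" and I :: "nat set"
  assumes bnd: "\<And>K. K \<ge> 1 \<Longrightarrow> \<exists>C N. \<forall>l\<in>I. l \<ge> N \<longrightarrow> norm (c l) * K ^ l \<le> C"
  shows "(\<lambda>l. c l * z ^ l) summable_on I"
    and "(\<lambda>l. (if l \<in> I then c l else 0) * z ^ l) sums (\<Sum>\<^sub>\<infinity>l\<in>I. c l * z ^ l)"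
    and "(\<lambda>z. \<Sum>\<^sub>\<infinity>l\<in>I. c l * z ^ l) holomorphic_on UNIV"
proof -
  define d where "d = (\<lambda>l. if l \<in> I then c l else 0)"
  have abs: "summable (\<lambda>l. norm (d l * z ^ l))" for z
  proof -
    \<comment> \<open>The factor 2 yields a geometric majorant with ratio 1/2, the 1 ensures that K
      is at least 1 even for z = 0.\<close>
    define K where "K = 2 * (norm z + 1)"
    have "1 * 1 \<le> 2 * (norm z + 1)" by (intro mult_mono) auto
    hence "K \<ge> 1" by (simp add: K_def)
    from bnd[OF this] obtain C N where C: "\<And>l. l \<in> I \<Longrightarrow> l \<ge> N \<Longrightarrow> norm (c l) * K ^ l \<le> C"
      by blast
    have "summable (\<lambda>l. \<bar>C\<bar> * (1 / 2) ^ l)"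
      by (intro summable_mult summable_geometric) simp
    moreover have "\<forall>\<^sub>F l in sequentially. norm (norm (d l * z ^ l)) \<le> \<bar>C\<bar> * (1 / 2) ^ l"
      using eventually_ge_at_top[of N]
    proof eventually_elim
      case (elim l)
      show ?case
      proof (cases "l \<in> I")
        case True
        have "norm (c l) * norm z ^ l * 2 ^ l \<le> norm (c l) * K ^ l"
          unfolding K_def power_mult_distrib mult.assoc
          by (intro mult_left_mono) (auto simp: mult.commute intro!: mult_left_mono power_mono)
        also have "\<dots> \<le> \<bar>C\<bar>" using C[OF True elim] by simp
        finally show ?thesis using True by (simp add: d_def norm_mult norm_power power_one_over field_simps)
      qed (simp add: d_def)
    qed
    ultimately show ?thesis by (rule summable_comparison_test_ev[rotated])
  qed
  have s: "(\<lambda>l. d l * z ^ l) sums suminf (\<lambda>l. d l * z ^ l)" for z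
    using summable_norm_cancel[OF abs] by (rule summable_sums)
  have hs: "((\<lambda>l. d l * z ^ l) has_sum suminf (\<lambda>l. d l * z ^ l)) UNIV" for z
    by (rule norm_summable_imp_has_sum[OF abs s])
  have hs': "((\<lambda>l. c l * z ^ l) has_sum suminf (\<lambda>l. d l * z ^ l)) I" for z
    using hs[of z] by (subst (asm) has_sum_cong_neutral[where T = I and g = "\<lambda>l. c l * z ^ l"]) (auto simp: d_def)
  have eq: "(\<Sum>\<^sub>\<infinity>l\<in>I. c l * z ^ l) = suminf (\<lambda>l. d l * z ^ l)" for z
    by (rule infsumI[OF hs'])
  show "(\<lambda>l. c l * z ^ l) summable_on I" using hs' by (auto simp: summable_on_def)
  show "(\<lambda>l. (if l \<in> I then c l else 0) * z ^ l) sums (\<Sum>\<^sub>\<infinity>l\<in>I. c l * z ^ l)"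
    using s[of z] unfolding eq d_def .
  show "(\<lambda>z. \<Sum>\<^sub>\<infinity>l\<in>I. c l * z ^ l) holomorphic_on UNIV"
  proof -
    have "(\<lambda>z. \<Sum>\<^sub>\<infinity>l\<in>I. c l * z ^ l) holomorphic_on (\<Union>r\<in>UNIV. ball 0 r)"
    proof (rule holomorphic_on_UN_open)
      fix r :: real
      show "(\<lambda>z. \<Sum>\<^sub>\<infinity>l\<in>I. c l * z ^ l) holomorphic_on ball 0 r"
        unfolding eq by (rule power_series_holomorphic[where a = d]) (use s in simp)
    qed auto
    also have "(\<Union>r\<in>UNIV. ball (0::complex) r) = UNIV"
      by (auto intro: gt_ex)
    finally show ?thesis .
  qed
qed

lemma entire_power_series:
  fixes c :: "nat \<Rightarrow> complex"
  assumes bnd: "\<And>K. K \<ge> 1 \<Longrightarrow> \<exists>C. \<forall>l. norm (c l) * K ^ l \<le> C"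
  shows "summable (\<lambda>l. c l * z ^ l)"
    and "(\<lambda>l. c l * z ^ l) summable_on UNIV"
    and "(\<Sum>l. c l * z ^ l) = (\<Sum>\<^sub>\<infinity>l. c l * z ^ l)"
    and "(\<lambda>z. \<Sum>l. c l * z ^ l) holomorphic_on UNIV"
proof -
  have bnd': "\<exists>C N. \<forall>l\<in>UNIV. l \<ge> N \<longrightarrow> norm (c l) * K ^ l \<le> C" if "K \<ge> 1" for K
    using bnd[OF that] by blast
  note E = entire_series[OF bnd']
  have s: "(\<lambda>l. c l * z ^ l) sums (\<Sum>\<^sub>\<infinity>l. c l * z ^ l)" for z
    using E(2)[of z] by simp
  show "summable (\<lambda>l. c l * z ^ l)" using s by (rule sums_summable)
  show "(\<lambda>l. c l * z ^ l) summable_on UNIV" by (rule E(1))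
  have eq: "(\<Sum>l. c l * z ^ l) = (\<Sum>\<^sub>\<infinity>l. c l * z ^ l)" for z using s by (rule sums_unique[symmetric])
  show "(\<Sum>l. c l * z ^ l) = (\<Sum>\<^sub>\<infinity>l. c l * z ^ l)" by (rule eq)
  show "(\<lambda>z. \<Sum>l. c l * z ^ l) holomorphic_on UNIV" unfolding eq by (rule E(3))
qed

section \<open>Periodicity of the sine moduli and growth of the digamma function\<close>

lemma abs_Gamma_mult_sin_le: "\<bar>Gamma x\<bar> * \<bar>sin (pi * x)\<bar> \<le> pi * \<bar>rGamma (1 - x)\<bar>" for x :: real
proof -
  have "norm (Gamma (complex_of_real x)) * norm (sin (of_real pi * complex_of_real x)) \<le> pi * norm (rGamma (1 - complex_of_real x))"
    by (rule norm_Gamma_mult_sin_le)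
  moreover have "of_real pi * complex_of_real x = of_real (pi * x)" "1 - complex_of_real x = of_real (1 - x)" by simp_all
  ultimately show ?thesis by (simp only: Gamma_complex_of_real rGamma_complex_of_real sin_of_real norm_of_real)
qed

lemma periodic_lower_bound:
  fixes f :: "nat \<Rightarrow> real"
  assumes d: "d > 0" and per: "\<And>l. f (l + d) = f l"
  obtains e where "e > 0" "\<And>l. f l > 0 \<Longrightarrow> f l \<ge> e"
proof
  \<comment> \<open>Positive values over one period; the 1 keeps the set nonempty so that its
    minimum exists.\<close>
  define S where "S = insert 1 {x \<in> f ` {..<d}. x > 0}"
  have S: "finite S" by (simp add: S_def)
  have rep: "f (l + d * k) = f l" for l k
  proof (induction k)
    case (Suc k)
    have "l + d * Suc k = (l + d * k) + d" by simp
    thus ?case using per[of "l + d * k"] Suc by metis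
  qed simp
  have mod: "f l = f (l mod d)" for l
    using rep[of "l mod d" "l div d"] by simp
  have "Min S \<in> S" using S by (intro Min_in) (auto simp: S_def)
  thus "Min S > 0" by (auto simp: S_def)
  fix l assume "f l > 0"
  hence "f l \<in> S" using mod[of l] d unfolding S_def by (auto intro!: image_eqI[of _ f "l mod d"])
  thus "f l \<ge> Min S" using S by simp
qed

text \<open>Digamma is increasing on the positive reals: compare from below with \<open>x0\<close>
  and from above with the next integer, where it is a harmonic number minus Euler's constant. Linear
  growth is crude but enough.\<close>

lemma Digamma_linear_bound:
  fixes x0 :: real
  assumes x0: "x0 > 0"
  obtains C where "C \<ge> 0" "\<And>x. x \<ge> x0 \<Longrightarrow> \<bar>Digamma x\<bar> \<le> C + x"
proof
  have harm: "harm m \<le> real m" for m :: nat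
  proof (induction m)
    case (Suc m)
    have "inverse (real (Suc m)) \<le> 1" by (simp add: field_simps)
    thus ?case using Suc by (simp add: harm_Suc)
  qed (simp add: harm_def)
  fix x assume x: "x \<ge> x0"
  define m where "m = nat \<lceil>x\<rceil>"
  have m: "x \<le> real (Suc m)" "real m \<le> x + 1" using x x0 unfolding m_def by linarith+
  have "Digamma x \<le> Digamma (real (Suc m))" using m x x0 by (intro Digamma_real_mono) auto
  also have "\<dots> = harm m - euler_mascheroni" by (rule Digamma_of_nat)
  also have "\<dots> \<le> x + 1" using harm[of m] m euler_mascheroni_pos by linarith
  finally have "Digamma x \<le> x + 1" .
  moreover have "Digamma x0 \<le> Digamma x" using x x0 by (intro Digamma_real_mono) auto
  ultimately show "\<bar>Digamma x\<bar> \<le> (\<bar>Digamma x0\<bar> + 1) + x" using x x0 by linarith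
qed auto

lemma abs_sin_minus_pi_nat: "\<bar>sin (x - pi * real k)\<bar> = \<bar>sin x\<bar>"
proof (induction k)
  case (Suc k)
  have "x - pi * real (Suc k) = (x - pi * real k) - pi" by (simp add: algebra_simps)
  thus ?case using Suc by (simp only: sin_minus_pi abs_minus_cancel)
qed simp

text \<open>Moving by 2 b changes the first argument by 2 b pi and, since \<alpha> = a / b, the
  second by a pi: both are integer multiples of pi. This is where rationality of \<alpha> controls
  the small divisors.\<close>

lemma abs_sin_shift:
  assumes "b > 0"
  shows "abs_sin1 \<nu> (x + 2 * real b * real k) = abs_sin1 \<nu> x"
    and "abs_sin2 (real a / real b) n (x + 2 * real b * real k) = abs_sin2 (real a / real b) n x"
proof -
  have "pi * (\<nu> - (x + 2 * real b * real k)) = pi * (\<nu> - x) - pi * real (2 * b * k)" by (simp add: algebra_simps)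
  thus "abs_sin1 \<nu> (x + 2 * real b * real k) = abs_sin1 \<nu> x"
    unfolding abs_sin1_def by (simp only: abs_sin_minus_pi_nat)
  have "pi * ((real n - real a / real b * (x + 2 * real b * real k)) / 2) = pi * ((real n - real a / real b * x) / 2) - pi * real (a * k)"
    using assms by (simp add: field_simps)
  thus "abs_sin2 (real a / real b) n (x + 2 * real b * real k) = abs_sin2 (real a / real b) n x"
    unfolding abs_sin2_def by (simp only: abs_sin_minus_pi_nat)
qed

section \<open>Solutions of the resonance equation\<close>

locale resonant_parameters =
  fixes a b e f n :: nat and \<alpha> \<nu> :: real
  assumes n: "n > 0"
    and pos: "a > 0" "b > 0" "e > 0" "f > 0"
    and coprime: "coprime a b" "coprime e f"
    and \<alpha>: "\<alpha> = real a / real b" "0 < \<alpha>" "\<alpha> < 2"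
    and \<nu>: "\<nu> = real e / real f" "0 < \<nu>"
    and cond: "(odd n \<and> f dvd a \<and> odd (a div f))
             \<or> (even n \<and> f dvd a \<and> even (a div f))
             \<or> (even n \<and> f dvd a \<and> odd (a div f) \<and> odd a \<and> odd f)"
begin

text \<open>With a = f m the equation reads n + 2 j = m (e + f l) / b. As f is coprime to b, some l
  makes k = (e + f l) / b an integer, and adding b t to l adds f t to k. It remains to give m k the
  parity of n and to make it at least n; the three conditions cover exactly this choice of
  parity.\<close>

lemma resonance_exists: "\<exists>j l. resonance n \<alpha> \<nu> j l"
proof -
  obtain m where m: "a = f * m" using cond by (auto elim!: dvdE)
  have m0: "m > 0" using m pos by auto
  have am: "a div f = m" using m pos by simp
  have cf: "coprime f b" "coprime m b" using coprime(1) unfolding m by auto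
  \<comment> \<open>The inverse of f modulo b; below, e (b - 1) plays the role of - e in the natural
    numbers.\<close>
  obtain x where x: "[f * x = Suc 0] (mod b)" using cong_solve_coprime_nat[OF cf(1)] by blast
  have "[f * (x * e * (b - 1)) + e = Suc 0 * (e * (b - 1)) + e] (mod b)"
    using cong_mult[OF x cong_refl[of "e * (b - 1)" b]] by (intro cong_add) (auto simp: mult_ac)
  also have "Suc 0 * (e * (b - 1)) + e = e * b" using pos by (cases b) auto
  finally have "b dvd f * (x * e * (b - 1)) + e" by (simp add: cong_def mod_eq_0_iff_dvd)
  then obtain l1 k1 where k1: "e + f * l1 = b * k1" by (auto elim!: dvdE simp: add.commute)
  have ev: "\<exists>t\<ge>n. even (m * (k1 + f * t) + n)"
  proof -
    \<comment> \<open>For odd f, going from t to t + 1 flips the parity of k, so one of n and n + 1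
      works.\<close>
    have choose: "\<exists>t\<ge>n. odd (k1 + f * t) \<longleftrightarrow> P" if "odd f" for P
    proof (cases "odd (k1 + f * n) \<longleftrightarrow> P")
      case False
      thus ?thesis using that by (intro exI[of _ "Suc n"]) auto
    qed blast
    consider "odd n" "odd m" | "even n" "even m" | "even n" "odd f"
      using cond unfolding am by blast
    thus ?thesis
    proof cases
      case 1
      show ?thesis
      proof (cases "odd f")
        case True
        thus ?thesis using choose[of True] 1 by auto
      next
        case False
        \<comment> \<open>If f is even then so is a, and coprimality makes e and b odd; then b k = e
          + f l is odd, which forces k odd.\<close>
        hence "odd e" "odd b" using coprime m by (auto simp: coprime_commute elim: coprime_common_divisor)
        have "odd (b * (k1 + f * n))"
          using False \<open>odd e\<close> k1 by (metis even_add even_mult_iff)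
        thus ?thesis using 1 by auto
      qed
    next
      case 3
      thus ?thesis using choose[of False] by auto
    qed auto
  qed
  then obtain t where t: "t \<ge> n" "even (m * (k1 + f * t) + n)" by blast
  \<comment> \<open>Taking t at least n makes m k at least n, so that j is a natural number.\<close>
  have "t \<le> f * t" "f * t \<le> k1 + f * t" "k1 + f * t \<le> m * (k1 + f * t)" using pos m0 by auto
  hence ge: "m * (k1 + f * t) \<ge> n" using t by linarith
  hence "even (m * (k1 + f * t) - n)" using t by simp
  then obtain j where "m * (k1 + f * t) - n = 2 * j" by (elim evenE)
  hence j: "n + 2 * j = m * (k1 + f * t)" using ge by simp
  define l where "l = l1 + b * t"
  have l: "e + f * l = b * (k1 + f * t)" using k1 by (simp add: l_def algebra_simps)
  have "real n + 2 * real j = real m * real (k1 + f * t)"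
    using arg_cong[OF j, of real] by simp
  moreover have "real e + real f * real l = real b * real (k1 + f * t)"
    using arg_cong[OF l, of real] by simp
  moreover have "\<alpha> * (\<nu> + real l) = real m / real b * (real e + real f * real l)"
    using pos by (simp add: \<alpha>(1) \<nu>(1) m field_simps)
  ultimately have "resonance n \<alpha> \<nu> j l" using pos by (simp add: resonance_def)
  thus ?thesis by blast
qed

abbreviation "j0 \<equiv> res_j n \<alpha> \<nu>"
abbreviation "l0 \<equiv> res_l n \<alpha> \<nu>"

text \<open>The least positive u, and the v that goes with it, in 2 b v = a u for coprime a and b.
  Working with these steps treats the two parities of a together.\<close>

definition "step_l = (if odd a then 2 * b else b)"
definition "step_j = (if odd a then a else a div 2)"

lemma step_eq: "\<alpha> * real step_l = 2 * real step_j"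
  using pos by (auto simp: step_l_def step_j_def \<alpha>(1) real_of_nat_div)

lemma step_pos: "step_l > 0" "step_j > 0"
  using pos by (auto simp: step_l_def step_j_def elim!: evenE)

lemma resonance_diff:
  assumes "resonance n \<alpha> \<nu> j l" "resonance n \<alpha> \<nu> j' l'"
  shows "2 * (real j' - real j) = \<alpha> * (real l' - real l)"
  using assms by (simp add: resonance_def algebra_simps)

text \<open>The two coordinates are minimised separately, but j and l increase together along the
  solutions, so the minima belong to the same one.\<close>

lemma resonance_least: "resonance n \<alpha> \<nu> j0 l0"
proof -
  obtain j where j: "resonance n \<alpha> \<nu> j l0"
    unfolding res_l_def using LeastI_ex[of "\<lambda>l. \<exists>j. resonance n \<alpha> \<nu> j l"] resonance_exists by blast
  obtain l where l: "resonance n \<alpha> \<nu> j0 l"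
    unfolding res_j_def using LeastI_ex[of "\<lambda>j. \<exists>l. resonance n \<alpha> \<nu> j l"] resonance_exists by blast
  have "l0 \<le> l" unfolding res_l_def using l by (blast intro: Least_le)
  hence "0 \<le> \<alpha> * (real l - real l0)" using \<alpha> by simp
  hence "j \<le> j0" using resonance_diff[OF j l] by simp
  moreover have "j0 \<le> j" unfolding res_j_def using j by (blast intro: Least_le)
  ultimately show ?thesis using j by simp
qed

text \<open>The difference (v, u) of two solutions satisfies 2 b v = a u. Coprimality gives b dvd u,
  and for odd a the cofactor must be even as well.\<close>

lemma resonance_iff: "resonance n \<alpha> \<nu> j l \<longleftrightarrow> (\<exists>q. j = j0 + step_j * q \<and> l = l0 + step_l * q)"
proof
  assume r: "resonance n \<alpha> \<nu> j l"
  have "l0 \<le> l" unfolding res_l_def using r by (blast intro: Least_le)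
  then obtain u where u: "l = l0 + u" by (auto simp: le_iff_add)
  have "j0 \<le> j" unfolding res_j_def using r by (blast intro: Least_le)
  then obtain v where v: "j = j0 + v" by (auto simp: le_iff_add)
  have "2 * real v = \<alpha> * real u" using resonance_diff[OF resonance_least r] by (simp add: u v)
  hence "real (2 * b * v) = real (a * u)" using pos by (simp add: \<alpha>(1) field_simps)
  hence eq: "2 * b * v = a * u" by (simp only: of_nat_eq_iff)
  hence "b dvd a * u" by (metis dvd_triv_left mult.assoc mult.left_commute)
  hence "b dvd u" using coprime(1) by (simp add: coprime_commute coprime_dvd_mult_right_iff)
  then obtain w where w: "u = b * w" by (elim dvdE)
  have eq': "2 * v = a * w" using eq pos by (simp add: w mult_ac)
  have "\<exists>q. u = step_l * q"
  proof (cases "odd a")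
    case True
    have "even w" using eq' True by (metis dvd_triv_left even_mult_iff)
    then obtain q where "w = 2 * q" by (elim evenE)
    thus ?thesis using True w by (auto simp: step_l_def)
  qed (use w in \<open>auto simp: step_l_def\<close>)
  then obtain q where q: "u = step_l * q" by blast
  have "2 * real v = 2 * real (step_j * q)"
    using \<open>2 * real v = \<alpha> * real u\<close> step_eq by (simp add: q mult.assoc[symmetric])
  hence "v = step_j * q" by (simp only: mult_cancel_left of_nat_eq_iff) simp
  thus "\<exists>q. j = j0 + step_j * q \<and> l = l0 + step_l * q" using u v q by blast
next
  assume "\<exists>q. j = j0 + step_j * q \<and> l = l0 + step_l * q"
  then obtain q where q: "j = j0 + step_j * q" "l = l0 + step_l * q" by blast
  have "\<alpha> * (\<nu> + real l) = \<alpha> * (\<nu> + real l0) + (\<alpha> * real step_l) * real q" by (simp add: q algebra_simps)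
  thus "resonance n \<alpha> \<nu> j l"
    using resonance_least unfolding step_eq by (simp add: resonance_def q)
qed

lemma A1_index_eq: "A1_index a b \<alpha> \<nu> n = {l. \<nexists>q. l = l0 + step_l * q}"
  by (auto simp: A1_index_def step_l_def)

lemma A2_index_eq: "A2_index a \<alpha> \<nu> n = {j. \<nexists>q. j = j0 + step_j * q}"
proof -
  have "even a \<Longrightarrow> a * q div 2 = a div 2 * q" for q by (auto elim!: evenE)
  thus ?thesis by (auto simp: A2_index_def step_j_def)
qed

text \<open>The form used for residues: the index set selects the poles \<nu> + l that do not meet
  the other progression, that is, the simple ones.\<close>

lemma A1_index_iff: "l \<in> A1_index a b \<alpha> \<nu> n \<longleftrightarrow> (\<nexists>j. resonance n \<alpha> \<nu> j l)"
  unfolding A1_index_eq resonance_iff by auto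

lemma A2_index_iff: "j \<in> A2_index a \<alpha> \<nu> n \<longleftrightarrow> (\<nexists>l. resonance n \<alpha> \<nu> j l)"
  unfolding A2_index_eq resonance_iff by auto

end

section \<open>Coefficient bounds\<close>

lemma rGamma_fact: "rGamma (1 + real k) = 1 / fact k"
  by (simp add: rGamma_inverse_Gamma Gamma_fact inverse_eq_divide)

context resonant_parameters
begin

lemma alpha_le_2: "\<alpha> \<le> 2" using \<alpha>(2,3) by simp

definition "A1_coeff l = (-1) ^ l / fact l * Gamma (\<nu> + real l)
  * (Gamma ((real n - \<alpha> * (\<nu> + real l)) / 2) / Gamma (\<alpha> * (\<nu> + real l) / 2)) / 2 powr (\<alpha> * real l)"

definition "A2_coeff j = (-1) ^ j / fact j
  * (Gamma ((real n + 2 * real j) / \<alpha>) / Gamma ((real n + 2 * real j) / 2))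
  * Gamma ((\<alpha> * \<nu> - real n - 2 * real j) / \<alpha>) / 2 ^ (2 * j)"

lemma A1_term_eq: "A1_term \<alpha> \<nu> n z l = of_real (A1_coeff l) * z ^ l"
  by (simp add: A1_term_def A1_coeff_def)

lemma A2_term_eq: "A2_term \<alpha> \<nu> n z j = of_real (A2_coeff j) * z ^ j"
  by (simp add: A2_term_def A2_coeff_def)

text \<open>The one factor with a possibly very negative argument is Gamma ((n - \<alpha> x) / 2);
  reflection bounds it once its sine is at least d. The denominators 2^(\<alpha> l) are at least 1
  and are dropped.\<close>

lemma A1_coeff_le:
  assumes d: "d > 0" "abs_sin2 \<alpha> n (\<nu> + real l) \<ge> d"
  shows "\<bar>A1_coeff l\<bar> \<le> (pi / d) * \<bar>gamma_quotient \<alpha> \<nu> n (\<nu> + real l)\<bar>"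
proof -
  define x where "x = \<nu> + real l"
  define w where "w = (real n - \<alpha> * x) / 2"
  have w: "1 - w = 1 - real n / 2 + \<alpha> * x / 2" by (simp add: w_def field_simps)
  have "\<bar>Gamma w\<bar> * d \<le> \<bar>Gamma w\<bar> * abs_sin2 \<alpha> n x" using d by (intro mult_left_mono) (auto simp: x_def)
  also have "\<dots> \<le> pi * \<bar>rGamma (1 - w)\<bar>" using abs_Gamma_mult_sin_le[of w] by (simp add: abs_sin2_def w_def)
  finally have G: "\<bar>Gamma w\<bar> \<le> (pi / d) * \<bar>rGamma (1 - w)\<bar>" using d by (simp add: field_simps)
  have p: "2 powr (\<alpha> * real l) \<ge> 1" using \<alpha>(2,3) by (intro ge_one_powr_ge_zero) auto
  have nu: "1 - \<nu> + x = 1 + real l" by (simp add: x_def)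
  have "\<bar>A1_coeff l\<bar> = (\<bar>Gamma x\<bar> * rGamma (1 - \<nu> + x) * \<bar>rGamma (\<alpha> * x / 2)\<bar> * \<bar>Gamma w\<bar>) / 2 powr (\<alpha> * real l)"
    unfolding nu rGamma_fact by (simp add: A1_coeff_def x_def[symmetric] w_def[symmetric] abs_mult rGamma_inverse_Gamma inverse_eq_divide)
  also have "\<dots> \<le> (\<bar>Gamma x\<bar> * rGamma (1 - \<nu> + x) * \<bar>rGamma (\<alpha> * x / 2)\<bar> * \<bar>Gamma w\<bar>) / 1"
    unfolding nu rGamma_fact using p by (intro divide_left_mono mult_nonneg_nonneg) auto
  also have "\<dots> \<le> (\<bar>Gamma x\<bar> * rGamma (1 - \<nu> + x) * \<bar>rGamma (\<alpha> * x / 2)\<bar> * ((pi / d) * \<bar>rGamma (1 - w)\<bar>)) / 1"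
    unfolding nu rGamma_fact by (intro divide_right_mono mult_left_mono G mult_nonneg_nonneg) auto
  also have "\<dots> = (pi / d) * \<bar>gamma_quotient \<alpha> \<nu> n x\<bar>"
    unfolding nu rGamma_fact gamma_quotient_def w by (simp add: abs_mult mult_ac)
  finally show ?thesis by (simp add: x_def)
qed

lemma A2_coeff_le:
  fixes j :: nat
  defines "x \<equiv> (real n + 2 * real j) / \<alpha>"
  assumes d: "d > 0" "abs_sin1 \<nu> x \<ge> d"
  shows "\<bar>A2_coeff j\<bar> \<le> (pi / d) * \<bar>gamma_quotient \<alpha> \<nu> n x\<bar>"
proof -
  define w where "w = \<nu> - x"
  have ax: "\<alpha> * x = real n + 2 * real j" using \<alpha>(2,3) by (simp add: x_def)
  have wx: "1 - w = 1 - \<nu> + x" by (simp add: w_def)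
  have w: "(\<alpha> * \<nu> - real n - 2 * real j) / \<alpha> = w" using \<alpha>(2,3) by (simp add: w_def x_def field_simps)
  have "\<bar>Gamma w\<bar> * d \<le> \<bar>Gamma w\<bar> * abs_sin1 \<nu> x" using d by (intro mult_left_mono) auto
  also have "\<dots> \<le> pi * \<bar>rGamma (1 - w)\<bar>" using abs_Gamma_mult_sin_le[of w] by (simp add: abs_sin1_def w_def)
  finally have G: "\<bar>Gamma w\<bar> \<le> (pi / d) * \<bar>rGamma (1 - w)\<bar>" using d by (simp add: field_simps)
  have p: "(2::real) ^ (2 * j) \<ge> 1" by simp
  have nu: "1 - real n / 2 + \<alpha> * x / 2 = 1 + real j" by (simp add: ax add_divide_distrib)
  have "\<bar>A2_coeff j\<bar> = (\<bar>Gamma x\<bar> * rGamma (1 - real n / 2 + \<alpha> * x / 2) * \<bar>rGamma (\<alpha> * x / 2)\<bar> * \<bar>Gamma w\<bar>) / 2 ^ (2 * j)"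
    unfolding nu rGamma_fact
    by (simp add: A2_coeff_def w ax x_def[symmetric] abs_mult rGamma_inverse_Gamma inverse_eq_divide)
  also have "\<dots> \<le> (\<bar>Gamma x\<bar> * rGamma (1 - real n / 2 + \<alpha> * x / 2) * \<bar>rGamma (\<alpha> * x / 2)\<bar> * \<bar>Gamma w\<bar>) / 1"
    unfolding nu rGamma_fact using p by (intro divide_left_mono mult_nonneg_nonneg) auto
  also have "\<dots> \<le> (\<bar>Gamma x\<bar> * rGamma (1 - real n / 2 + \<alpha> * x / 2) * \<bar>rGamma (\<alpha> * x / 2)\<bar> * ((pi / d) * \<bar>rGamma (1 - w)\<bar>)) / 1"
    unfolding nu rGamma_fact by (intro divide_right_mono mult_left_mono G mult_nonneg_nonneg) auto
  also have "\<dots> = (pi / d) * \<bar>gamma_quotient \<alpha> \<nu> n x\<bar>"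
    unfolding nu rGamma_fact gamma_quotient_def wx by (simp add: abs_mult mult_ac)
  finally show ?thesis .
qed

text \<open>A zero of the sine makes (n - \<alpha> x) / 2 an integer. The second hypothesis makes
  that integer nonpositive, hence -j for a natural number j, and l would be resonant.\<close>

lemma abs_sin2_pos:
  assumes "l \<in> A1_index a b \<alpha> \<nu> n" "real n \<le> \<alpha> * (\<nu> + real l)"
  shows "abs_sin2 \<alpha> n (\<nu> + real l) > 0"
proof (rule ccontr)
  assume "\<not> abs_sin2 \<alpha> n (\<nu> + real l) > 0"
  hence "sin ((real n - \<alpha> * (\<nu> + real l)) / 2 * pi) = 0" by (simp add: abs_sin2_def mult.commute)
  hence "(real n - \<alpha> * (\<nu> + real l)) / 2 \<in> \<int>" by (simp only: sin_times_pi_eq_0)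
  then obtain k :: int where k: "(real n - \<alpha> * (\<nu> + real l)) / 2 = of_int k" by (elim Ints_cases)
  hence k': "\<alpha> * (\<nu> + real l) - real n = - 2 * of_int k" by (simp add: field_simps)
  hence "k \<le> 0" using assms(2) by simp
  hence "resonance n \<alpha> \<nu> (nat (- k)) l" using k' by (simp add: resonance_def)
  thus False using assms(1) by (simp add: A1_index_iff)
qed

lemma abs_sin1_pos:
  assumes "j \<in> A2_index a \<alpha> \<nu> n" "\<nu> \<le> (real n + 2 * real j) / \<alpha>"
  shows "abs_sin1 \<nu> ((real n + 2 * real j) / \<alpha>) > 0"
proof (rule ccontr)
  assume "\<not> abs_sin1 \<nu> ((real n + 2 * real j) / \<alpha>) > 0"
  hence "sin ((\<nu> - (real n + 2 * real j) / \<alpha>) * pi) = 0" by (simp add: abs_sin1_def mult.commute)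
  hence "\<nu> - (real n + 2 * real j) / \<alpha> \<in> \<int>" by (simp only: sin_times_pi_eq_0)
  then obtain k :: int where k: "\<nu> - (real n + 2 * real j) / \<alpha> = of_int k" by (elim Ints_cases)
  hence "k \<le> 0" using assms(2) by linarith
  moreover have "real n + 2 * real j = \<alpha> * (\<nu> - of_int k)" using k \<alpha>(2,3) by (simp add: field_simps)
  ultimately have "resonance n \<alpha> \<nu> j (nat (- k))" by (simp add: resonance_def)
  thus False using assms(1) by (simp add: A2_index_iff)
qed

lemma A1_coeff_bound:
  assumes K: "K \<ge> 1"
  shows "\<exists>C N. \<forall>l\<in>A1_index a b \<alpha> \<nu> n. l \<ge> N \<longrightarrow> norm (complex_of_real (A1_coeff l)) * K ^ l \<le> C"
proof -
  \<comment> \<open>Period 2 b in l leaves finitely many values, so the positive ones have a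
    positive lower bound: no small divisors occur.\<close>
  have per: "abs_sin2 \<alpha> n (\<nu> + real (l + 2 * b)) = abs_sin2 \<alpha> n (\<nu> + real l)" for l
    using abs_sin_shift(2)[OF pos(2), of a n "\<nu> + real l" 1] by (simp add: \<alpha>(1) add.assoc)
  obtain d where d: "d > 0" "\<And>l. abs_sin2 \<alpha> n (\<nu> + real l) > 0 \<Longrightarrow> abs_sin2 \<alpha> n (\<nu> + real l) \<ge> d"
    using periodic_lower_bound[of "2 * b" "\<lambda>l. abs_sin2 \<alpha> n (\<nu> + real l)"] per pos by auto
  obtain C where C: "C \<ge> 0" "\<And>x. x \<ge> \<nu> \<Longrightarrow> \<bar>gamma_quotient \<alpha> \<nu> n x\<bar> * K powr x \<le> C"
    using gamma_quotient_superexp[OF \<alpha>(2) \<nu>(2) \<nu>(2) K, of n] by blast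
  obtain N :: nat where N: "real N \<ge> real n / \<alpha>" using real_arch_simple by blast
  show ?thesis
  proof (intro exI ballI impI)
    fix l assume l: "l \<in> A1_index a b \<alpha> \<nu> n" "l \<ge> N"
    have "real n / \<alpha> \<le> \<nu> + real l" using N l \<nu>(2) by linarith
    hence "real n \<le> \<alpha> * (\<nu> + real l)" using \<alpha>(2,3) by (simp add: field_simps)
    note r = d(2)[OF abs_sin2_pos[OF l(1) this]]
    have Kp: "K ^ l \<le> K powr (\<nu> + real l)"
      using K \<nu>(2) by (subst powr_realpow[symmetric]) (auto intro!: powr_mono)
    have "norm (complex_of_real (A1_coeff l)) * K ^ l \<le> ((pi / d) * \<bar>gamma_quotient \<alpha> \<nu> n (\<nu> + real l)\<bar>) * K powr (\<nu> + real l)"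
      using A1_coeff_le[OF d(1) r] d K by (intro mult_mono Kp) auto
    also have "\<dots> = (pi / d) * (\<bar>gamma_quotient \<alpha> \<nu> n (\<nu> + real l)\<bar> * K powr (\<nu> + real l))" by simp
    also have "\<dots> \<le> (pi / d) * C" using d by (intro mult_left_mono C(2)) auto
    finally show "norm (complex_of_real (A1_coeff l)) * K ^ l \<le> (pi / d) * C" .
  qed
qed

lemma A2_coeff_bound:
  assumes K: "K \<ge> 1"
  shows "\<exists>C N. \<forall>j\<in>A2_index a \<alpha> \<nu> n. j \<ge> N \<longrightarrow> norm (complex_of_real (A2_coeff j)) * K ^ j \<le> C"
proof -
  define x where "x = (\<lambda>j. (real n + 2 * real j) / \<alpha>)"
  \<comment> \<open>Along the second progression the period in j is a, which corresponds to the same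
    shift 2 b of the point.\<close>
  have "x (j + a) = x j + 2 * real b * real 1" for j
    using pos by (simp add: x_def \<alpha>(1) field_simps)
  hence per: "abs_sin1 \<nu> (x (j + a)) = abs_sin1 \<nu> (x j)" for j
    by (simp only: abs_sin_shift(1)[OF pos(2)])
  obtain d where d: "d > 0" "\<And>j. abs_sin1 \<nu> (x j) > 0 \<Longrightarrow> abs_sin1 \<nu> (x j) \<ge> d"
    using periodic_lower_bound[of a "\<lambda>j. abs_sin1 \<nu> (x j)"] per pos by auto
  have x0: "x 0 > 0" using n \<alpha>(2,3) by (simp add: x_def)
  obtain C where C: "C \<ge> 0" "\<And>y. y \<ge> x 0 \<Longrightarrow> \<bar>gamma_quotient \<alpha> \<nu> n y\<bar> * K powr y \<le> C"
    using gamma_quotient_superexp[OF \<alpha>(2) \<nu>(2) x0 K, of n] by blast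
  obtain N :: nat where N: "real N \<ge> \<nu>" using real_arch_simple by blast
  \<comment> \<open>Here \<alpha> at most 2 is used: K^j can be replaced by K^(x j).\<close>
  have xj: "real j \<le> x j" "x 0 \<le> x j" for j
  proof -
    have "\<alpha> * real j \<le> 2 * real j" using \<alpha>(2,3) by (intro mult_right_mono) auto
    hence "\<alpha> * real j \<le> real n + 2 * real j" by linarith
    thus "real j \<le> x j" using \<alpha>(2,3) by (simp add: x_def field_simps)
    show "x 0 \<le> x j" using \<alpha>(2,3) by (auto simp: x_def intro!: divide_right_mono)
  qed
  show ?thesis
  proof (intro exI ballI impI)
    fix j assume j: "j \<in> A2_index a \<alpha> \<nu> n" "j \<ge> N"
    have "\<nu> \<le> x j" using N j xj[of j] by linarith
    note r = d(2)[OF abs_sin1_pos[OF j(1) this[unfolded x_def], folded x_def[THEN fun_cong]]]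
    have Kp: "K ^ j \<le> K powr (x j)"
      using K xj[of j] by (subst powr_realpow[symmetric]) (auto intro!: powr_mono)
    have "norm (complex_of_real (A2_coeff j)) * K ^ j \<le> ((pi / d) * \<bar>gamma_quotient \<alpha> \<nu> n (x j)\<bar>) * K powr (x j)"
      using A2_coeff_le[OF d(1) r[unfolded x_def]] d K by (intro mult_mono Kp) (auto simp: x_def)
    also have "\<dots> = (pi / d) * (\<bar>gamma_quotient \<alpha> \<nu> n (x j)\<bar> * K powr (x j))" by simp
    also have "\<dots> \<le> (pi / d) * C" using d xj by (intro mult_left_mono C(2)) auto
    finally show "norm (complex_of_real (A2_coeff j)) * K ^ j \<le> (pi / d) * C" .
  qed
qed

section \<open>Coefficients of the resonant series\<close>

definition "lq q = l0 + step_l * q"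
definition "jq q = j0 + step_j * q"
text \<open>\<open>A3_term\<close> and \<open>A4_term\<close> contain z^(2 q) for odd a and z^q for
  even a; this exponent turns both into power series in one power of z.\<close>

definition "z_exponent = (if odd a then 2 else 1 :: nat)"

text \<open>The sign (-1)^(lq q + jq q) comes from the residue; the second sign compensates the
  prefactor (-1)^(l0 + j0) in front of the sums.\<close>

definition "A4_coeff q = (-1) ^ (lq q + jq q) * (-1) ^ (l0 + j0) / (fact (lq q) * fact (jq q))
  * (Gamma (\<nu> + real (lq q)) / Gamma (real n / 2 + real (jq q))) / 2 ^ (2 * step_j * q)"

definition "bracket q = Digamma (\<nu> + real (lq q)) - Digamma (real (lq q + 1)) - \<alpha> / 2 * Digamma (real n / 2 + real (jq q))
  - \<alpha> / 2 * Digamma (real (jq q + 1))"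

lemma resonance_q: "resonance n \<alpha> \<nu> (jq q) (lq q)"
  unfolding resonance_iff by (auto simp: jq_def lq_def)

lemma a_z_exponent: "a * z_exponent = 2 * step_j"
  by (auto simp: z_exponent_def step_j_def)

lemma sign_eq: "(-1) ^ (lq q + jq q) * (-1) ^ (l0 + j0) = ((-1) ^ ((step_l + step_j) * q) :: real)"
proof -
  have "(lq q + jq q) + (l0 + j0) = 2 * (l0 + j0) + (step_l + step_j) * q"
    by (simp add: lq_def jq_def algebra_simps)
  hence "(-1) ^ ((lq q + jq q) + (l0 + j0)) = ((-1) ^ (2 * (l0 + j0) + (step_l + step_j) * q) :: real)" by (rule arg_cong)
  thus ?thesis by (simp only: power_add[of _ "lq q + jq q"] power_add[of _ "2 * (l0 + j0)"]) simp
qed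

lemma A4_term_eq: "A4_term a b \<alpha> \<nu> n z q = of_real (A4_coeff q) * (z ^ z_exponent) ^ q"
proof (cases "odd a")
  case True
  \<comment> \<open>For odd a the sum of the steps is 2 b + a, which is odd.\<close>
  have s: "(-1) ^ (lq q + jq q) * (-1) ^ (l0 + j0) = ((-1) ^ q :: real)"
    unfolding sign_eq using True by (simp add: step_l_def step_j_def minus_one_power_iff)
  have "2 * step_j * q = 2 * a * q" using True by (simp add: step_j_def)
  thus ?thesis using True unfolding A4_coeff_def s
    by (simp add: A4_term_def Let_def lq_def jq_def step_l_def step_j_def z_exponent_def mult_ac power_mult[symmetric])
next
  case False
  have d: "a * q div 2 = (a div 2) * q" using False by (auto elim!: evenE)
  have s: "(-1) ^ (lq q + jq q) * (-1) ^ (l0 + j0) = ((-1) ^ (q * (b + a div 2)) :: real)"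
    unfolding sign_eq using False by (simp add: step_l_def step_j_def mult.commute)
  have "2 * step_j * q = a * q" using False by (simp add: step_j_def)
  thus ?thesis using False unfolding A4_coeff_def s
    by (simp add: A4_term_def Let_def lq_def jq_def step_l_def step_j_def z_exponent_def d mult_ac)
qed

lemma A3_bracket_eq: "A3_bracket a b \<alpha> \<nu> n q = bracket q"
proof -
  have h: "\<alpha> / 2 = real a / (2 * real b)" by (simp add: \<alpha>(1))
  have d: "a * q div 2 = (a div 2) * q" if "even a" using that by (auto elim!: evenE)
  show ?thesis unfolding A3_bracket_def bracket_def h
    by (cases "even a") (simp_all add: Let_def lq_def jq_def step_l_def step_j_def d mult_ac)
qed

lemma A3_term_eq: "A3_term a b \<alpha> \<nu> n z q = of_real (A4_coeff q * bracket q) * (z ^ z_exponent) ^ q"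
  by (simp add: A3_term_def A4_term_eq A3_bracket_eq)

lemma A4_coeff_le: "\<bar>A4_coeff q\<bar> \<le> \<bar>gamma_quotient \<alpha> \<nu> n (\<nu> + real (lq q))\<bar>"
proof -
  define x where "x = \<nu> + real (lq q)"
  have ax: "\<alpha> * x = real n + 2 * real (jq q)" using resonance_q[of q] by (simp add: resonance_def x_def)
  have e: "1 - \<nu> + x = 1 + real (lq q)" "1 - real n / 2 + \<alpha> * x / 2 = 1 + real (jq q)" "\<alpha> * x / 2 = real n / 2 + real (jq q)"
    by (simp_all add: x_def[symmetric] ax add_divide_distrib) (simp add: x_def)
  have "\<bar>A4_coeff q\<bar> = \<bar>gamma_quotient \<alpha> \<nu> n x\<bar> / 2 ^ (2 * step_j * q)"
    unfolding gamma_quotient_def e(1,2) rGamma_fact unfolding e(3)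
    by (simp add: A4_coeff_def x_def[symmetric] abs_mult power_abs rGamma_inverse_Gamma inverse_eq_divide mult_ac)
  also have "\<dots> \<le> \<bar>gamma_quotient \<alpha> \<nu> n x\<bar> / 1"
    by (intro divide_left_mono) auto
  finally show ?thesis by (simp add: x_def)
qed

lemma q_le_lq: "q \<le> lq q"
proof -
  have "1 * q \<le> step_l * q" using step_pos by (intro mult_right_mono) auto
  thus ?thesis unfolding lq_def by linarith
qed

lemma A4_coeff_bound:
  assumes K: "K \<ge> 1"
  shows "\<exists>C. \<forall>q. norm (complex_of_real (A4_coeff q)) * K ^ q \<le> C"
proof -
  obtain C where C: "C \<ge> 0" "\<And>x. x \<ge> \<nu> \<Longrightarrow> \<bar>gamma_quotient \<alpha> \<nu> n x\<bar> * K powr x \<le> C"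
    using gamma_quotient_superexp[OF \<alpha>(2) \<nu>(2) \<nu>(2) K, of n] by blast
  have "norm (complex_of_real (A4_coeff q)) * K ^ q \<le> C" for q
  proof -
    have Kp: "K ^ q \<le> K powr (\<nu> + real (lq q))"
      using K \<nu>(2) q_le_lq[of q] by (subst powr_realpow[symmetric]) (auto intro!: powr_mono)
    have "norm (complex_of_real (A4_coeff q)) * K ^ q \<le> \<bar>gamma_quotient \<alpha> \<nu> n (\<nu> + real (lq q))\<bar> * K powr (\<nu> + real (lq q))"
      using A4_coeff_le[of q] K by (intro mult_mono Kp) auto
    also have "\<dots> \<le> C" by (intro C(2)) auto
    finally show ?thesis .
  qed
  thus ?thesis by blast
qed

text \<open>The bracket grows linearly; 2^q is a convenient majorant because
  \<open>A3_coeff_bound\<close> can absorb it by replacing K with 2 K.\<close>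

lemma bracket_bound: "\<exists>B\<ge>0. \<forall>q. \<bar>bracket q\<bar> \<le> B * 2 ^ q"
proof -
  define x0 where "x0 = min \<nu> (1/2)"
  have x0: "x0 > 0" using \<nu>(2) by (simp add: x0_def)
  obtain C where C: "C \<ge> 0" "\<And>x. x \<ge> x0 \<Longrightarrow> \<bar>Digamma x\<bar> \<le> C + x"
    using Digamma_linear_bound[OF x0] by blast
  define B where "B = 4 * C + \<nu> + 2 + real n + 2 * real l0 + 2 * real j0 + 2 * real step_l + 2 * real step_j"
  have B0: "B \<ge> 0" using C \<nu>(2) by (simp add: B_def)
  have "\<bar>bracket q\<bar> \<le> B * 2 ^ q" for q
  proof -
    have half: "\<bar>\<alpha> / 2 * y\<bar> \<le> \<bar>y\<bar>" for y
      using \<alpha>(2,3) mult_right_mono[of "\<alpha> / 2" 1 "\<bar>y\<bar>"] by (simp add: abs_mult)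
    have "\<bar>bracket q\<bar> \<le> \<bar>Digamma (\<nu> + real (lq q))\<bar> + \<bar>Digamma (real (lq q + 1))\<bar> + \<bar>Digamma (real n / 2 + real (jq q))\<bar> + \<bar>Digamma (real (jq q + 1))\<bar>"
      using half[of "Digamma (real n / 2 + real (jq q))"] half[of "Digamma (real (jq q + 1))"]
      unfolding bracket_def by linarith
    also have "\<dots> \<le> (C + (\<nu> + real (lq q))) + (C + real (lq q + 1)) + (C + (real n / 2 + real (jq q))) + (C + real (jq q + 1))"
      using n by (intro add_mono C(2)) (auto simp: x0_def min_le_iff_disj)
    also have "\<dots> = 4 * C + \<nu> + 2 + real n / 2 + 2 * real l0 + 2 * real j0 + (2 * real step_l + 2 * real step_j) * real q"
      by (simp add: lq_def jq_def algebra_simps)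
    also have "\<dots> \<le> B * (1 + real q)"
    proof -
      have "0 \<le> (4 * C + \<nu> + 2 + real n + 2 * real l0 + 2 * real j0) * real q"
        using C \<nu>(2) by (intro mult_nonneg_nonneg) auto
      thus ?thesis by (simp add: B_def algebra_simps)
    qed
    also have "1 + real q \<le> 2 ^ q"
    proof (induction q)
      case (Suc q)
      have "1 + real (Suc q) \<le> 2 * (1 + real q)" by simp
      also have "\<dots> \<le> 2 * 2 ^ q" using Suc by (intro mult_left_mono) auto
      finally show ?case by simp
    qed simp
    hence "B * (1 + real q) \<le> B * 2 ^ q" using B0 by (intro mult_left_mono)
    finally show ?thesis .
  qed
  thus ?thesis using B0 by blast
qed

lemma A3_coeff_bound:
  assumes K: "K \<ge> 1"
  shows "\<exists>C. \<forall>q. norm (complex_of_real (A4_coeff q * bracket q)) * K ^ q \<le> C"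
proof -
  obtain B where B: "B \<ge> 0" "\<And>q. \<bar>bracket q\<bar> \<le> B * 2 ^ q" using bracket_bound by blast
  have "2 * K \<ge> 1" using K by simp
  from A4_coeff_bound[OF this] obtain C where C: "\<And>q. norm (complex_of_real (A4_coeff q)) * (2 * K) ^ q \<le> C" by blast
  have "norm (complex_of_real (A4_coeff q * bracket q)) * K ^ q \<le> B * C" for q
  proof -
    have "norm (complex_of_real (A4_coeff q * bracket q)) * K ^ q = (\<bar>A4_coeff q\<bar> * K ^ q) * \<bar>bracket q\<bar>"
      by (simp add: norm_mult)
    also have "\<dots> \<le> (\<bar>A4_coeff q\<bar> * K ^ q) * (B * 2 ^ q)"
      using K by (intro mult_left_mono B) auto
    also have "\<dots> = B * (norm (complex_of_real (A4_coeff q)) * (2 * K) ^ q)"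
      by (simp add: power_mult_distrib mult_ac)
    also have "\<dots> \<le> B * C" by (intro mult_left_mono C B)
    finally show ?thesis .
  qed
  thus ?thesis by blast
qed

lemma A1_props:
  "A1_term \<alpha> \<nu> n z summable_on A1_index a b \<alpha> \<nu> n" "A1 a b \<alpha> \<nu> n holomorphic_on UNIV"
  using entire_series(1)[OF A1_coeff_bound] entire_series(3)[OF A1_coeff_bound]
  by (simp_all add: A1_def[abs_def] A1_term_eq[abs_def])

lemma A2_props:
  "A2_term \<alpha> \<nu> n z summable_on A2_index a \<alpha> \<nu> n" "A2 a \<alpha> \<nu> n holomorphic_on UNIV"
  using entire_series(1)[OF A2_coeff_bound] entire_series(3)[OF A2_coeff_bound]
  by (auto simp: A2_def[abs_def] A2_term_eq[abs_def] intro!: holomorphic_intros)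

lemma A4_props:
  "summable (A4_term a b \<alpha> \<nu> n z)" "A4_term a b \<alpha> \<nu> n z summable_on UNIV"
  "(\<Sum>q. A4_term a b \<alpha> \<nu> n z q) = (\<Sum>\<^sub>\<infinity>q. A4_term a b \<alpha> \<nu> n z q)" "A4 a b \<alpha> \<nu> n holomorphic_on UNIV"
proof -
  note E = entire_power_series[OF A4_coeff_bound]
  show "summable (A4_term a b \<alpha> \<nu> n z)" "A4_term a b \<alpha> \<nu> n z summable_on UNIV"
    "(\<Sum>q. A4_term a b \<alpha> \<nu> n z q) = (\<Sum>\<^sub>\<infinity>q. A4_term a b \<alpha> \<nu> n z q)"
    using E(1-3)[of "z ^ z_exponent"] by (simp_all add: A4_term_eq[abs_def])
  have "(\<lambda>z. \<Sum>l. complex_of_real (A4_coeff l) * z ^ l) \<circ> (\<lambda>z. z ^ z_exponent) holomorphic_on UNIV"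
    by (intro holomorphic_on_compose holomorphic_on_subset[OF E(4)] holomorphic_intros) auto
  thus "A4 a b \<alpha> \<nu> n holomorphic_on UNIV"
    unfolding A4_def[abs_def] A4_term_eq[abs_def] by (intro holomorphic_on_mult holomorphic_on_const) (simp add: o_def)
qed

lemma A3_props:
  "summable (A3_term a b \<alpha> \<nu> n z)" "A3_term a b \<alpha> \<nu> n z summable_on UNIV"
  "(\<Sum>q. A3_term a b \<alpha> \<nu> n z q) = (\<Sum>\<^sub>\<infinity>q. A3_term a b \<alpha> \<nu> n z q)" "A3 a b \<alpha> \<nu> n holomorphic_on UNIV"
proof -
  note E = entire_power_series[OF A3_coeff_bound]
  show "summable (A3_term a b \<alpha> \<nu> n z)" "A3_term a b \<alpha> \<nu> n z summable_on UNIV"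
    "(\<Sum>q. A3_term a b \<alpha> \<nu> n z q) = (\<Sum>\<^sub>\<infinity>q. A3_term a b \<alpha> \<nu> n z q)"
    using E(1-3)[of "z ^ z_exponent"] unfolding A3_term_eq[abs_def] by auto
  have "(\<lambda>z. \<Sum>l. complex_of_real (A4_coeff l * bracket l) * z ^ l) \<circ> (\<lambda>z. z ^ z_exponent) holomorphic_on UNIV"
    by (intro holomorphic_on_compose holomorphic_on_subset[OF E(4)] holomorphic_intros) auto
  thus "A3 a b \<alpha> \<nu> n holomorphic_on UNIV"
    unfolding A3_def[abs_def] A3_term_eq[abs_def] by (intro holomorphic_on_mult holomorphic_on_const) (simp add: o_def)
qed

section \<open>Matching the residues with the terms of the four series\<close>

lemma residue_l:
  assumes r: "r > 0" and l: "l \<in> A1_index a b \<alpha> \<nu> n"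
  shows "- residue (mb_kernel \<alpha> \<nu> n (ln (r / 2))) (of_real (\<nu> + real l)) =
    of_real (r powr (\<alpha> * \<nu> - real n) / 2 powr (\<alpha> * \<nu> - real n)) * A1_term \<alpha> \<nu> n (of_real (r powr \<alpha>)) l"
proof -
  have nr: "(real n - \<alpha> * (\<nu> + real l)) / 2 \<notin> \<int>\<^sub>\<le>\<^sub>0"
  proof
    assume "(real n - \<alpha> * (\<nu> + real l)) / 2 \<in> \<int>\<^sub>\<le>\<^sub>0"
    then obtain k where "(real n - \<alpha> * (\<nu> + real l)) / 2 = - real k" by (elim nonpos_Ints_cases')
    hence "resonance n \<alpha> \<nu> k l" by (simp add: resonance_def field_simps)
    thus False using l by (simp add: A1_index_iff)
  qed
  have "exp ((\<alpha> * (\<nu> + real l) - real n) * ln (r / 2)) = (r / 2) powr (\<alpha> * \<nu> - real n + \<alpha> * real l)"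
    using r by (simp add: powr_def algebra_simps)
  also have "\<dots> = (r powr (\<alpha> * \<nu> - real n) / 2 powr (\<alpha> * \<nu> - real n)) * ((r powr \<alpha>) ^ l / 2 powr (\<alpha> * real l))"
    using r by (simp add: powr_add powr_divide powr_realpow[symmetric] powr_powr)
  finally have e: "exp ((\<alpha> * (\<nu> + real l) - real n) * ln (r / 2)) = (r powr (\<alpha> * \<nu> - real n) / 2 powr (\<alpha> * \<nu> - real n)) * ((r powr \<alpha>) ^ l / 2 powr (\<alpha> * real l))" .
  show ?thesis
    unfolding residue_mb_kernel_l[OF \<alpha>(2) alpha_le_2 \<nu>(2) n nr] e A1_term_eq A1_coeff_def
    by (simp add: mult_ac)
qed

lemma residue_j:
  assumes r: "r > 0" and j: "j \<in> A2_index a \<alpha> \<nu> n"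
  shows "- residue (mb_kernel \<alpha> \<nu> n (ln (r / 2))) (of_real ((real n + 2 * real j) / \<alpha>)) =
    of_real (2 / \<alpha>) * A2_term \<alpha> \<nu> n (of_real (r ^ 2)) j"
proof -
  have nr: "\<nu> - (real n + 2 * real j) / \<alpha> \<notin> \<int>\<^sub>\<le>\<^sub>0"
  proof
    assume "\<nu> - (real n + 2 * real j) / \<alpha> \<in> \<int>\<^sub>\<le>\<^sub>0"
    then obtain k where "\<nu> - (real n + 2 * real j) / \<alpha> = - real k" by (elim nonpos_Ints_cases')
    hence "resonance n \<alpha> \<nu> j k" using \<alpha>(2) by (simp add: resonance_def field_simps)
    thus False using j by (simp add: A2_index_iff)
  qed
  have e: "exp (2 * real j * ln (r / 2)) = (r ^ 2) ^ j / 2 ^ (2 * j)"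
  proof -
    have "exp (2 * real j * ln (r / 2)) = (r / 2) powr real (2 * j)" using r by (simp add: powr_def)
    also have "\<dots> = (r / 2) ^ (2 * j)" using r by (intro powr_realpow) auto
    finally show ?thesis by (simp add: power_divide power_mult)
  qed
  have w: "(\<alpha> * \<nu> - real n - 2 * real j) / \<alpha> = \<nu> - (real n + 2 * real j) / \<alpha>" using \<alpha>(2) by (simp add: field_simps)
  show ?thesis
    unfolding residue_mb_kernel_j[OF \<alpha>(2) alpha_le_2 \<nu>(2) n nr] e A2_term_eq A2_coeff_def w
    by (simp add: mult_ac)
qed

text \<open>The digamma part of the double-pole residue becomes the term of \<open>A3\<close>, the
  part \<alpha> ln (r / 2) the term of \<open>A4\<close>; that \<alpha> cancels the denominator of 2
  / \<alpha>.\<close>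

lemma residue_q:
  assumes r: "r > 0"
  shows "- residue (mb_kernel \<alpha> \<nu> n (ln (r / 2))) (of_real (\<nu> + real (lq q))) =
    of_real (r ^ (2 * j0) / 2 ^ (2 * j0)) * (of_real (- (2 * (-1) ^ (l0 + j0) / \<alpha>)) * A3_term a b \<alpha> \<nu> n (of_real (r ^ a)) q
      + of_real (- 2 * (-1) ^ (l0 + j0)) * A4_term a b \<alpha> \<nu> n (of_real (r ^ a)) q * of_real (ln (r / 2)))"
proof -
  have e: "exp (2 * real (jq q) * ln (r / 2)) = (r ^ (2 * j0) / 2 ^ (2 * j0)) * (((r ^ a) ^ z_exponent) ^ q / 2 ^ (2 * step_j * q))"
  proof -
    have "exp (2 * real (jq q) * ln (r / 2)) = (r / 2) powr real (2 * jq q)" using r by (simp add: powr_def)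
    also have "\<dots> = (r / 2) ^ (2 * jq q)" using r by (intro powr_realpow) auto
    also have "2 * jq q = 2 * j0 + 2 * step_j * q" by (simp add: jq_def)
    also have "(r / 2) ^ (2 * j0 + 2 * step_j * q) = (r ^ (2 * j0) / 2 ^ (2 * j0)) * (r ^ (2 * step_j * q) / 2 ^ (2 * step_j * q))"
      by (simp add: power_add power_divide)
    also have "r ^ (2 * step_j * q) = ((r ^ a) ^ z_exponent) ^ q"
      unfolding a_z_exponent[symmetric] by (simp add: power_mult)
    finally show ?thesis .
  qed
  \<comment> \<open>The prefactor's sign and the compensating one inside \<open>A4_coeff\<close>
    multiply to 1.\<close>
  have s: "(-1) ^ (l0 + j0) * (-1) ^ (l0 + j0) = (1::real)" by (simp flip: power_mult_distrib)
  define E where "E = ((r ^ a) ^ z_exponent) ^ q"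
  define P where "P = r ^ (2 * j0) / 2 ^ (2 * j0)"
  define S where "S = ((-1) ^ (l0 + j0) :: real)"
  define T where "T = 1 / (fact (lq q) * fact (jq q)) * (Gamma (\<nu> + real (lq q)) / Gamma (real n / 2 + real (jq q))) * (E / 2 ^ (2 * step_j * q))"
  define U where "U = ((-1) ^ (lq q + jq q) :: real)"
  have c4: "A4_coeff q * E = U * S * T"
    by (simp add: A4_coeff_def T_def U_def S_def)
  have "- residue (mb_kernel \<alpha> \<nu> n (ln (r / 2))) (of_real (\<nu> + real (lq q))) =
     of_real (- (2 / \<alpha>) * U * (P * T * (bracket q + \<alpha> * ln (r / 2))))"
    unfolding residue_mb_kernel_double[OF \<alpha>(2) alpha_le_2 \<nu>(2) n resonance_q[unfolded resonance_def]] e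
    by (simp add: bracket_def T_def E_def P_def U_def mult_ac)
  also have "- (2 / \<alpha>) * U * (P * T * (bracket q + \<alpha> * ln (r / 2)))
     = P * (- (2 * S / \<alpha>) * ((A4_coeff q * E) * bracket q) + - 2 * S * (A4_coeff q * E) * ln (r / 2))"
  proof -
    have "S * S = 1" using s by (simp add: S_def)
    hence h: "S * (U * S * T) = U * T" by algebra
    have "P * (- (2 * S / \<alpha>) * ((U * S * T) * bracket q) + - 2 * S * (U * S * T) * ln (r / 2))
      = P * (- (2 / \<alpha>) * (S * (U * S * T)) * bracket q - 2 * (S * (U * S * T)) * ln (r / 2))"
      by (simp add: mult_ac)
    also have "\<dots> = - (2 / \<alpha>) * U * (P * T * (bracket q + \<alpha> * ln (r / 2)))"
      unfolding h using \<alpha>(2) by (simp add: field_simps)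
    finally show ?thesis unfolding c4 ..
  qed
  finally show ?thesis
    unfolding A3_term_eq A4_term_eq by (simp add: E_def P_def S_def mult_ac)
qed

end

section \<open>The expansion\<close>

text \<open>Every finite set of poles is eventually contained in the finite segment below
  \<open>N k\<close>, so the segments converge along the filter that defines
  \<open>infsum\<close>.\<close>

lemma infsum_initial_segments:
  fixes g :: "real \<Rightarrow> complex"
  assumes g: "g summable_on P" and fin: "\<And>x. finite {p \<in> P. p < x}"
    and N: "filterlim N at_top sequentially"
  shows "(\<lambda>k. \<Sum>p | p \<in> P \<and> p < N k. g p) \<longlonglongrightarrow> infsum g P"
proof -
  have "filterlim (\<lambda>k. {p \<in> P. p < N k}) (finite_subsets_at_top P) sequentially"
    unfolding filterlim_finite_subsets_at_top
  proof (intro allI impI)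
    fix X assume X: "finite X \<and> X \<subseteq> P"
    hence "bdd_above X" by simp
    then obtain M where "\<And>p. p \<in> X \<Longrightarrow> p \<le> M" by (auto simp: bdd_above_def)
    hence B: "p < M + 1" if "p \<in> X" for p using that by fastforce
    have "\<forall>\<^sub>F k in sequentially. M + 1 \<le> N k" using N by (simp add: filterlim_at_top)
    thus "\<forall>\<^sub>F k in sequentially. finite {p \<in> P. p < N k} \<and> X \<subseteq> {p \<in> P. p < N k} \<and> {p \<in> P. p < N k} \<subseteq> P"
    proof eventually_elim
      case (elim k)
      have "p < N k" if "p \<in> X" for p using B[OF that] elim by linarith
      thus ?case using fin X by auto
    qed
  qed
  from filterlim_compose[OF infsum_tendsto[OF g] this] show ?thesis .
qed

context resonant_parameters
begin

text \<open>Absolute control of each series lets the family of residues be split freely into simple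
  poles of either progression and double poles.\<close>

lemma has_sum_residues:
  assumes r: "r > 0"
  defines "\<rho> \<equiv> \<lambda>p. - residue (mb_kernel \<alpha> \<nu> n (ln (r / 2))) (complex_of_real p)"
  shows "\<rho> summable_on mb_poles \<alpha> \<nu> n"
    and "infsum \<rho> (mb_poles \<alpha> \<nu> n) =
        of_real (r powr (\<alpha> * \<nu> - real n) / 2 powr (\<alpha> * \<nu> - real n)) * A1 a b \<alpha> \<nu> n (of_real (r powr \<alpha>))
      + A2 a \<alpha> \<nu> n (of_real (r ^ 2))
      + of_real (r ^ (2 * j0) / 2 ^ (2 * j0)) * A3 a b \<alpha> \<nu> n (of_real (r ^ a))
      + of_real (r ^ (2 * j0) / 2 ^ (2 * j0)) * A4 a b \<alpha> \<nu> n (of_real (r ^ a)) * of_real (ln (r / 2))"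
proof -
  define h1 where "h1 = (\<lambda>l. \<nu> + real l)"
  define h2 where "h2 = (\<lambda>j. (real n + 2 * real j) / \<alpha>)"
  define h3 where "h3 = (\<lambda>q. \<nu> + real (lq q))"
  define I1 where "I1 = A1_index a b \<alpha> \<nu> n"
  define I2 where "I2 = A2_index a \<alpha> \<nu> n"
  have inj: "inj_on h1 I1" "inj_on h2 I2" "inj_on h3 UNIV"
    using \<alpha>(2) step_pos by (auto simp: inj_on_def h1_def h2_def h3_def lq_def)
  have res: "resonance n \<alpha> \<nu> j l \<longleftrightarrow> h2 j = h1 l" for j l
    using \<alpha>(2) by (simp add: resonance_def h1_def h2_def field_simps)
  have h3: "h3 q = h1 (lq q)" "h3 q = h2 (jq q)" for q
    using resonance_q[of q] unfolding res by (simp_all add: h3_def h1_def)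
  have disj: "h1 ` I1 \<inter> h2 ` I2 = {}" "(h1 ` I1 \<union> h2 ` I2) \<inter> h3 ` UNIV = {}"
  proof -
    show "h1 ` I1 \<inter> h2 ` I2 = {}"
      using res by (force simp: I1_def A1_index_iff)
    have f1: "h1 l \<noteq> h3 q" if "l \<in> I1" for l q
      using that res[of "jq q" l] unfolding h3(2) I1_def A1_index_iff by auto
    have f2: "h2 j \<noteq> h3 q" if "j \<in> I2" for j q
      using that res[of j "lq q"] unfolding h3(1) I2_def A2_index_iff by auto
    show "(h1 ` I1 \<union> h2 ` I2) \<inter> h3 ` UNIV = {}"
    proof (rule Int_emptyI)
      fix y assume "y \<in> h1 ` I1 \<union> h2 ` I2" "y \<in> h3 ` UNIV"
      thus False using f1 f2 by (elim UnE imageE) metis+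
    qed
  qed
  \<comment> \<open>An index missing from either index set is resonant, so its pole is one of the
    points \<open>h3 q\<close>; disjointness prevents counting it twice.\<close>
  have un: "mb_poles \<alpha> \<nu> n = (h1 ` I1 \<union> h2 ` I2) \<union> h3 ` UNIV"
  proof
    show "mb_poles \<alpha> \<nu> n \<subseteq> (h1 ` I1 \<union> h2 ` I2) \<union> h3 ` UNIV"
    proof
      fix p assume "p \<in> mb_poles \<alpha> \<nu> n"
      then consider l where "p = h1 l" | j where "p = h2 j" by (auto simp: mb_poles_def h1_def h2_def)
      thus "p \<in> (h1 ` I1 \<union> h2 ` I2) \<union> h3 ` UNIV"
      proof cases
        case 1
        show ?thesis
        proof (cases "l \<in> I1")
          case False
          then obtain q where "l = lq q" by (auto simp: I1_def A1_index_eq lq_def)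
          thus ?thesis using 1 h3(1) by auto
        qed (use 1 in auto)
      next
        case 2
        show ?thesis
        proof (cases "j \<in> I2")
          case False
          then obtain q where "j = jq q" by (auto simp: I2_def A2_index_eq jq_def)
          thus ?thesis using 2 h3(2) by auto
        qed (use 2 in auto)
      qed
    qed
    show "(h1 ` I1 \<union> h2 ` I2) \<union> h3 ` UNIV \<subseteq> mb_poles \<alpha> \<nu> n"
      by (auto simp: mb_poles_def h1_def h2_def h3_def)
  qed
  define c1 where "c1 = complex_of_real (r powr (\<alpha> * \<nu> - real n) / 2 powr (\<alpha> * \<nu> - real n))"
  define c2 where "c2 = complex_of_real (2 / \<alpha>)"
  define P where "P = complex_of_real (r ^ (2 * j0) / 2 ^ (2 * j0))"
  define c3 where "c3 = complex_of_real (- (2 * (-1) ^ (l0 + j0) / \<alpha>))"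
  define c4 where "c4 = complex_of_real (- 2 * (-1) ^ (l0 + j0))"
  define Lg where "Lg = complex_of_real (ln (r / 2))"
  have t1: "(\<rho> \<circ> h1) l = c1 * A1_term \<alpha> \<nu> n (of_real (r powr \<alpha>)) l" if "l \<in> I1" for l
    using residue_l[OF r that[unfolded I1_def]] by (simp add: \<rho>_def h1_def c1_def)
  have t2: "(\<rho> \<circ> h2) j = c2 * A2_term \<alpha> \<nu> n (of_real (r ^ 2)) j" if "j \<in> I2" for j
    using residue_j[OF r that[unfolded I2_def]] by (simp add: \<rho>_def h2_def c2_def)
  have t3: "(\<rho> \<circ> h3) q = (P * c3) * A3_term a b \<alpha> \<nu> n (of_real (r ^ a)) q + (P * c4 * Lg) * A4_term a b \<alpha> \<nu> n (of_real (r ^ a)) q" for q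
    using residue_q[OF r, of q] unfolding P_def[symmetric] c3_def[symmetric] c4_def[symmetric] Lg_def[symmetric]
    by (simp add: \<rho>_def h3_def algebra_simps)
  have s1: "(\<rho> \<circ> h1) summable_on I1"
    using summable_on_cmult_right[OF A1_props(1)] by (subst summable_on_cong[OF t1]) (auto simp: I1_def)
  have s2: "(\<rho> \<circ> h2) summable_on I2"
    using summable_on_cmult_right[OF A2_props(1)] by (subst summable_on_cong[OF t2]) (auto simp: I2_def)
  have s3: "(\<rho> \<circ> h3) summable_on UNIV"
    using summable_on_add[OF summable_on_cmult_right[OF A3_props(2)] summable_on_cmult_right[OF A4_props(2)]]
    by (subst summable_on_cong[OF t3]) auto
  have S: "\<rho> summable_on h1 ` I1" "\<rho> summable_on h2 ` I2" "\<rho> summable_on h3 ` UNIV"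
    using s1 s2 s3 by (simp_all add: summable_on_reindex inj)
  have S12: "\<rho> summable_on h1 ` I1 \<union> h2 ` I2"
    by (rule summable_on_Un_disjoint[OF S(1,2) disj(1)])
  show "\<rho> summable_on mb_poles \<alpha> \<nu> n"
    unfolding un by (rule summable_on_Un_disjoint[OF S12 S(3) disj(2)])
  have v1: "infsum (\<rho> \<circ> h1) I1 = c1 * A1 a b \<alpha> \<nu> n (of_real (r powr \<alpha>))"
  proof -
    have "infsum (\<rho> \<circ> h1) I1 = (\<Sum>\<^sub>\<infinity>l\<in>I1. c1 * A1_term \<alpha> \<nu> n (of_real (r powr \<alpha>)) l)"
      by (rule infsum_cong[OF t1])
    also have "\<dots> = c1 * (\<Sum>\<^sub>\<infinity>l\<in>I1. A1_term \<alpha> \<nu> n (of_real (r powr \<alpha>)) l)"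
      using A1_props(1) by (intro infsum_cmult_right) (simp add: I1_def)
    finally show ?thesis by (simp add: A1_def I1_def)
  qed
  have v2: "infsum (\<rho> \<circ> h2) I2 = A2 a \<alpha> \<nu> n (of_real (r ^ 2))"
  proof -
    have "infsum (\<rho> \<circ> h2) I2 = (\<Sum>\<^sub>\<infinity>j\<in>I2. c2 * A2_term \<alpha> \<nu> n (of_real (r ^ 2)) j)"
      by (rule infsum_cong[OF t2])
    also have "\<dots> = c2 * (\<Sum>\<^sub>\<infinity>j\<in>I2. A2_term \<alpha> \<nu> n (of_real (r ^ 2)) j)"
      using A2_props(1) by (intro infsum_cmult_right) (simp add: I2_def)
    finally show ?thesis by (simp add: A2_def I2_def c2_def)
  qed
  have v3: "infsum (\<rho> \<circ> h3) UNIV = P * c3 * (\<Sum>\<^sub>\<infinity>q. A3_term a b \<alpha> \<nu> n (of_real (r ^ a)) q) + P * c4 * Lg * (\<Sum>\<^sub>\<infinity>q. A4_term a b \<alpha> \<nu> n (of_real (r ^ a)) q)"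
  proof -
    have "infsum (\<rho> \<circ> h3) UNIV = (\<Sum>\<^sub>\<infinity>q. (P * c3) * A3_term a b \<alpha> \<nu> n (of_real (r ^ a)) q + (P * c4 * Lg) * A4_term a b \<alpha> \<nu> n (of_real (r ^ a)) q)"
      by (rule infsum_cong[OF t3])
    also have "\<dots> = (\<Sum>\<^sub>\<infinity>q. (P * c3) * A3_term a b \<alpha> \<nu> n (of_real (r ^ a)) q) + (\<Sum>\<^sub>\<infinity>q. (P * c4 * Lg) * A4_term a b \<alpha> \<nu> n (of_real (r ^ a)) q)"
      by (intro infsum_add summable_on_cmult_right A3_props(2) A4_props(2))
    also have "(\<Sum>\<^sub>\<infinity>q. (P * c3) * A3_term a b \<alpha> \<nu> n (of_real (r ^ a)) q) = (P * c3) * (\<Sum>\<^sub>\<infinity>q. A3_term a b \<alpha> \<nu> n (of_real (r ^ a)) q)"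
      by (intro infsum_cmult_right A3_props(2))
    also have "(\<Sum>\<^sub>\<infinity>q. (P * c4 * Lg) * A4_term a b \<alpha> \<nu> n (of_real (r ^ a)) q) = (P * c4 * Lg) * (\<Sum>\<^sub>\<infinity>q. A4_term a b \<alpha> \<nu> n (of_real (r ^ a)) q)"
      by (intro infsum_cmult_right A4_props(2))
    finally show ?thesis .
  qed
  have "infsum \<rho> (mb_poles \<alpha> \<nu> n) = infsum (\<rho> \<circ> h1) I1 + infsum (\<rho> \<circ> h2) I2 + infsum (\<rho> \<circ> h3) UNIV"
    unfolding un infsum_Un_disjoint[OF S12 S(3) disj(2)] infsum_Un_disjoint[OF S(1,2) disj(1)]
    by (simp add: infsum_reindex inj)
  also note v1 also note v2 also note v3
  also have "P * c3 * (\<Sum>\<^sub>\<infinity>q. A3_term a b \<alpha> \<nu> n (of_real (r ^ a)) q) + P * c4 * Lg * (\<Sum>\<^sub>\<infinity>q. A4_term a b \<alpha> \<nu> n (of_real (r ^ a)) q) = P * A3 a b \<alpha> \<nu> n (of_real (r ^ a)) + P * A4 a b \<alpha> \<nu> n (of_real (r ^ a)) * Lg"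
    unfolding A3_def A4_def A3_props(3) A4_props(3) c3_def[symmetric] c4_def[symmetric] by (simp add: mult_ac)
  finally show "infsum \<rho> (mb_poles \<alpha> \<nu> n) =
        of_real (r powr (\<alpha> * \<nu> - real n) / 2 powr (\<alpha> * \<nu> - real n)) * A1 a b \<alpha> \<nu> n (of_real (r powr \<alpha>))
      + A2 a \<alpha> \<nu> n (of_real (r ^ 2))
      + of_real (r ^ (2 * j0) / 2 ^ (2 * j0)) * A3 a b \<alpha> \<nu> n (of_real (r ^ a))
      + of_real (r ^ (2 * j0) / 2 ^ (2 * j0)) * A4 a b \<alpha> \<nu> n (of_real (r ^ a)) * of_real (ln (r / 2))"
    by (simp only: c1_def P_def Lg_def add.assoc)
qed

lemma abscissa_exists:
  obtains c where "0 < c" "c \<le> 1/2" "c < \<nu>" "abs_sin1 \<nu> c > 0" "abs_sin2 \<alpha> n c > 0" "\<And>p. p \<in> mb_poles \<alpha> \<nu> n \<Longrightarrow> c < p"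
proof
  \<comment> \<open>Half the distance from \<nu> down to the largest integer strictly below it, cut
    off at 1/4. Then \<nu> - c lies strictly between consecutive integers and \<alpha> c <
    1.\<close>
  define c where "c = min (1/2) (\<nu> + 1 - of_int \<lceil>\<nu>\<rceil>) / 2"
  have "\<lceil>\<nu>\<rceil> \<ge> 1" using \<nu>(2) by (simp add: le_ceiling_iff)
  hence c1: "(1::real) \<le> of_int \<lceil>\<nu>\<rceil>" by simp
  have gap: "\<nu> + 1 - of_int \<lceil>\<nu>\<rceil> > 0" using ceiling_correct[of \<nu>] by linarith
  have le: "c \<le> 1/4" "c \<le> (\<nu> + 1 - of_int \<lceil>\<nu>\<rceil>) / 2" by (auto simp: c_def min_def)
  show c: "0 < c" using gap by (simp add: c_def)
  show c2: "c \<le> 1/2" using le by linarith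
  have "(\<nu> + 1 - of_int \<lceil>\<nu>\<rceil>) / 2 \<le> \<nu> / 2" using c1 by simp
  with le(2) have "c \<le> \<nu> / 2" by (rule order_trans)
  with \<nu>(2) show c3: "c < \<nu>" by simp
  note c = c c2 c3
  have nz: "\<bar>sin (pi * x)\<bar> > 0" if "x \<notin> \<int>" for x :: real
    using that sin_times_pi_eq_0[of x] by (simp add: mult.commute)
  show "abs_sin1 \<nu> c > 0" unfolding abs_sin1_def
  proof (intro nz notI)
    assume "\<nu> - c \<in> \<int>"
    then obtain k :: int where k: "\<nu> - c = of_int k" by (elim Ints_cases)
    have "2 * c \<le> \<nu> + 1 - of_int \<lceil>\<nu>\<rceil>" using le(2) by simp
    hence "of_int \<lceil>\<nu>\<rceil> - 1 < \<nu> - c" using gap by linarith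
    moreover have "\<nu> - c < of_int \<lceil>\<nu>\<rceil>" using c le_of_int_ceiling[of \<nu>] by linarith
    ultimately have "real_of_int (\<lceil>\<nu>\<rceil> - 1) < of_int k" "real_of_int k < of_int \<lceil>\<nu>\<rceil>"
      unfolding k by simp_all
    hence "\<lceil>\<nu>\<rceil> - 1 < k" "k < \<lceil>\<nu>\<rceil>" by (simp_all only: of_int_less_iff)
    thus False by presburger
  qed
  have ac: "0 < \<alpha> * c" "\<alpha> * c < 1"
  proof -
    show "0 < \<alpha> * c" using \<alpha>(2) c by simp
    have "\<alpha> * c < 2 * (1/2)" using \<alpha>(2,3) c by (intro mult_less_le_imp_less) auto
    thus "\<alpha> * c < 1" by simp
  qed
  show "abs_sin2 \<alpha> n c > 0" unfolding abs_sin2_def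
  proof (intro nz notI)
    assume "(real n - \<alpha> * c) / 2 \<in> \<int>"
    then obtain k :: int where "(real n - \<alpha> * c) / 2 = of_int k" by (elim Ints_cases)
    \<comment> \<open>This would be an integer strictly between 0 and 1.\<close>
    hence "\<alpha> * c = of_int (int n - 2 * k)" by (simp add: field_simps)
    hence "0 < int n - 2 * k" "int n - 2 * k < 1"
      using ac by (simp_all only: of_int_0_less_iff of_int_less_1_iff)
    thus False by presburger
  qed
  fix p assume "p \<in> mb_poles \<alpha> \<nu> n"
  then consider l where "p = \<nu> + real l" | j where "p = (real n + 2 * real j) / \<alpha>" by (auto simp: mb_poles_def)
  thus "c < p"
  proof cases
    case 2
    have "real n \<ge> 1" using n by simp
    hence "\<alpha> * c < real n + 2 * real j" using ac by linarith
    also have "real n + 2 * real j = \<alpha> * p" using 2 \<alpha>(2) by simp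
    finally show ?thesis using \<alpha>(2) by simp
  qed (use c in auto)
qed

text \<open>The partial sums over poles below c + 2 b k have two limits: the contour integral,
  because the shifted integrals vanish, and the unordered sum, because the residues are
  summable.\<close>

lemma mb_integral_eq:
  assumes r: "r > 0" and c: "0 < c" "\<And>p. p \<in> mb_poles \<alpha> \<nu> n \<Longrightarrow> c < p"
    and s: "abs_sin1 \<nu> c > 0" "abs_sin2 \<alpha> n c > 0"
  shows "(LINT t|lborel. mb_kernel \<alpha> \<nu> n (ln (r / 2)) (Complex c t)) =
    2 * pi * infsum (\<lambda>p. - residue (mb_kernel \<alpha> \<nu> n (ln (r / 2))) (of_real p)) (mb_poles \<alpha> \<nu> n)"
proof (rule LIMSEQ_unique)
  have b: "2 * real b > 0" using pos by simp
  show "(\<lambda>k. 2 * pi * (\<Sum>p | p \<in> mb_poles \<alpha> \<nu> n \<and> p < c + 2 * real b * real k. - residue (mb_kernel \<alpha> \<nu> n (ln (r / 2))) (of_real p)))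
      \<longlonglongrightarrow> (LINT t|lborel. mb_kernel \<alpha> \<nu> n (ln (r / 2)) (Complex c t))"
    by (intro mb_kernel_residue_sums \<alpha>(2) alpha_le_2 \<nu>(2) n c s b abs_sin_shift(1)[OF pos(2)] abs_sin_shift(2)[OF pos(2), of a, folded \<alpha>(1)])
  show "(\<lambda>k. 2 * pi * (\<Sum>p | p \<in> mb_poles \<alpha> \<nu> n \<and> p < c + 2 * real b * real k. - residue (mb_kernel \<alpha> \<nu> n (ln (r / 2))) (of_real p)))
      \<longlonglongrightarrow> 2 * pi * infsum (\<lambda>p. - residue (mb_kernel \<alpha> \<nu> n (ln (r / 2))) (of_real p)) (mb_poles \<alpha> \<nu> n)"
  proof (intro tendsto_mult tendsto_const infsum_initial_segments has_sum_residues(1)[OF r])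
    show "finite {p \<in> mb_poles \<alpha> \<nu> n. p < x}" for x
      by (rule finite_mb_poles_below[OF \<alpha>(2) alpha_le_2 \<nu>(2) n])
    show "filterlim (\<lambda>k. c + 2 * real b * real k) at_top sequentially"
      using b by real_asymp
  qed
qed

end

lemma linnik_density_integrable:
  assumes "linnik_density \<alpha> \<nu> p"
  shows "integrable lborel p"
proof -
  have [measurable]: "p \<in> borel_measurable borel" and nn: "\<And>x. 0 \<le> p x"
    and ps: "prob_space (density lborel (\<lambda>x. ennreal (p x)))"
    using assms by (auto simp: linnik_density_def)
  have "(\<integral>\<^sup>+x. ennreal (p x) \<partial>lborel) = 1"
    using prob_space.emeasure_space_1[OF ps] by (simp add: emeasure_density)
  thus ?thesis using nn by (intro integrableI_nonneg) auto
qed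

text \<open>The operators \<open>infsum\<close> and \<open>suminf\<close> are total, so the first
  conjuncts certify that the four series really converge. Quantifying over all x with norm r
  expresses that p is radial, with q (r) as the common value.\<close>

theorem proposition4p3:
  fixes p :: "real ^ 'n \<Rightarrow> real" and a b e f n j0 :: nat and \<alpha> \<nu> :: real
  assumes n: "n = CARD('n)"
    and pos: "a > 0" "b > 0" "e > 0" "f > 0"
    and coprime: "coprime a b" "coprime e f"
    and \<alpha>: "\<alpha> = real a / real b" "0 < \<alpha>" "\<alpha> < 2"
    and \<nu>: "\<nu> = real e / real f" "0 < \<nu>"
    and p: "linnik_density \<alpha> \<nu> p"
    and cond: "(odd n \<and> f dvd a \<and> odd (a div f))
             \<or> (even n \<and> f dvd a \<and> even (a div f))
             \<or> (even n \<and> f dvd a \<and> odd (a div f) \<and> odd a \<and> odd f)"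
    and j0: "j0 = res_j n \<alpha> \<nu>"
  shows "(\<forall>z. A1_term \<alpha> \<nu> n z summable_on A1_index a b \<alpha> \<nu> n)
       \<and> (\<forall>z. A2_term \<alpha> \<nu> n z summable_on A2_index a \<alpha> \<nu> n)
       \<and> (\<forall>z. summable (A3_term a b \<alpha> \<nu> n z))
       \<and> (\<forall>z. summable (A4_term a b \<alpha> \<nu> n z))
       \<and> A1 a b \<alpha> \<nu> n holomorphic_on UNIV
       \<and> A2 a \<alpha> \<nu> n holomorphic_on UNIV
       \<and> A3 a b \<alpha> \<nu> n holomorphic_on UNIV
       \<and> A4 a b \<alpha> \<nu> n holomorphic_on UNIV
       \<and> (\<forall>r>0. \<forall>x. norm x = r \<longrightarrow>
            complex_of_real (p x) =
              complex_of_real (1 / (2 ^ n * pi powr (real n / 2) * Gamma \<nu>)) *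
              (complex_of_real (r powr (\<alpha> * \<nu> - real n) / 2 powr (\<alpha> * \<nu> - real n))
                 * A1 a b \<alpha> \<nu> n (complex_of_real (r powr \<alpha>))
               + A2 a \<alpha> \<nu> n (complex_of_real (r ^ 2))
               + complex_of_real (r ^ (2 * j0) / 2 ^ (2 * j0))
                 * A3 a b \<alpha> \<nu> n (complex_of_real (r ^ a))
               + complex_of_real (r ^ (2 * j0) / 2 ^ (2 * j0))
                 * A4 a b \<alpha> \<nu> n (complex_of_real (r ^ a)) * complex_of_real (ln (r / 2))))"
proof -
  interpret R: resonant_parameters a b e f n \<alpha> \<nu>
    using n pos coprime \<alpha> \<nu> cond by unfold_locales auto
  have "complex_of_real (p x) =
              complex_of_real (1 / (2 ^ n * pi powr (real n / 2) * Gamma \<nu>)) *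
              (complex_of_real (r powr (\<alpha> * \<nu> - real n) / 2 powr (\<alpha> * \<nu> - real n))
                 * A1 a b \<alpha> \<nu> n (complex_of_real (r powr \<alpha>))
               + A2 a \<alpha> \<nu> n (complex_of_real (r ^ 2))
               + complex_of_real (r ^ (2 * j0) / 2 ^ (2 * j0))
                 * A3 a b \<alpha> \<nu> n (complex_of_real (r ^ a))
               + complex_of_real (r ^ (2 * j0) / 2 ^ (2 * j0))
                 * A4 a b \<alpha> \<nu> n (complex_of_real (r ^ a)) * complex_of_real (ln (r / 2)))"
    (is "_ = _ * ?S") if r: "r > 0" and x: "norm x = r" for r x
  proof -
    obtain c where c: "0 < c" "c \<le> 1/2" "c < \<nu>" "abs_sin1 \<nu> c > 0" "abs_sin2 \<alpha> n c > 0" "\<And>p. p \<in> mb_poles \<alpha> \<nu> n \<Longrightarrow> c < p"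
      using R.abscissa_exists by blast
    have D: "DIM(real ^ 'n) = n" by (simp add: n)
    have x0: "x \<noteq> 0" using r x by auto
    have "isCont p x"
      using p x0 by (auto simp: linnik_density_def continuous_on_eq_continuous_at open_Compl)
    hence cont: "isCont (\<lambda>x. complex_of_real (p x)) x" by (intro continuous_intros)
    have "(2 * pi) ^ n * complex_of_real (p x) * (2 * pi * Gamma \<nu>)
       = pi powr (n / 2) * (LINT t|lborel. mb_kernel \<alpha> \<nu> n (ln (r / 2)) (Complex c t))"
      unfolding x[symmetric] D[symmetric]
    proof (rule radial_density_mellin_barnes[OF \<alpha>(2,3) c(1-3) _ cont x0])
      show "integrable lborel (\<lambda>x. complex_of_real (p x))"
        using linnik_density_integrable[OF p] by (simp add: complex_of_real_integrable_eq)
      show "(LINT x|lborel. complex_of_real (p x) * exp (\<i> * of_real (x \<bullet> t))) = of_real ((1 + norm t powr \<alpha>) powr (- \<nu>))" for t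
        using p by (simp add: linnik_density_def mult.commute)
    qed
    also have "(LINT t|lborel. mb_kernel \<alpha> \<nu> n (ln (r / 2)) (Complex c t)) = 2 * pi * ?S"
      using R.mb_integral_eq[OF r c(1,6,4,5)] unfolding R.has_sum_residues(2)[OF r] j0 .
    finally have eq: "(2 * pi) ^ n * complex_of_real (p x) * (2 * pi * Gamma \<nu>) = pi powr (n / 2) * (2 * pi * ?S)" .
    have G: "Gamma \<nu> > 0" using \<nu> by (intro Gamma_real_pos)
    \<comment> \<open>The inversion constant (2 pi)^n and the factor pi^(n/2) of the Gaussian
      integral combine to the 2^n pi^(n/2) of the claim; the two factors 2 pi cancel.\<close>
    have pp: "pi ^ n = pi powr (n / 2) * pi powr (n / 2)"
      by (simp add: powr_realpow flip: powr_add)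
    define S where "S = ?S"
    define Q where "Q = pi powr (n / 2)"
    have Q: "Q > 0" by (simp add: Q_def)
    from eq have "2 ^ n * (of_real Q * of_real Q) * complex_of_real (p x) * of_real (Gamma \<nu>) = of_real Q * S"
      unfolding S_def[symmetric] Q_def[symmetric] power_mult_distrib of_real_power[symmetric] pp[folded Q_def]
      by simp
    hence "complex_of_real (p x) = S / (2 ^ n * of_real Q * of_real (Gamma \<nu>))"
      using Q G by (simp add: field_simps)
    thus ?thesis unfolding S_def[symmetric] Q_def[symmetric] by simp
  qed
  thus ?thesis using R.A1_props R.A2_props R.A3_props(1,4) R.A4_props(1,4) by blast
qed

end
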